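(* For each integer $k\ge 5$, $$r_k(k+1,k;n)>\mathrm{tw}_{k-2}\bigl(n^{\Omega(\log\log n)}\bigr),$$ that is, for each $k\ge5$ there is a constant $c=c(k)>0$ such that $r_k(k+1,k;n)>\mathrm{tw}_{k-2}\bigl(n^{c\log\log n}\bigr)$ for all sufficiently large integers $n$.
   Context: For $k\ge 2$, a $k$-graph is a $k$-uniform hypergraph, and $K^{(k)}_n$ denotes the complete $k$-graph on an $n$-element vertex set. For integers $2\le k<n$ and $2\le t\le k+1$, the Erdős–Hajnal function $r_k(k+1,t;n)$ is the minimum $N$ such that for every red/blue coloring of the edges of $K^{(k)}_N$, either there are $k+1$ vertices such that at least $t$ of the $k+1$ edges contained in them are red, or there is a blue copy of $K^{(k)}_n$ (i.e. $n$ vertices all of whose $k$-subsets are blue). The tower function is defined by $\mathrm{tw}_1(x)=x$ and $\mathrm{tw}_{i+1}(x)=2^{\mathrm{tw}_i(x)}$ for $i\ge1$. All logarithms are to base 2. *)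

theory Defs
  imports Complex_Main "HOL-Library.Ramsey"
begin

datatype colour = Red | Blue

text \<open>
  The edges of the complete \<open>k\<close>-graph on a vertex set \<open>V\<close> are \<open>[V]\<^bsup>k\<^esup>\<close>; only the values of a
  colouring on these sets matter.
\<close>

definition eh_arrow :: "nat \<Rightarrow> nat \<Rightarrow> nat \<Rightarrow> nat \<Rightarrow> bool" where
  "eh_arrow k t n N \<longleftrightarrow>
     (\<forall>\<chi> :: nat set \<Rightarrow> colour.
        (\<exists>S \<in> [{..<N}]\<^bsup>(k + 1)\<^esup>. t \<le> card {e \<in> [S]\<^bsup>k\<^esup>. \<chi> e = Red}) \<or>
        (\<exists>T \<in> [{..<N}]\<^bsup>n\<^esup>. \<forall>e \<in> [T]\<^bsup>k\<^esup>. \<chi> e = Blue))"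

text \<open>
  \<open>erdos_hajnal k t n\<close> is the Erdos--Hajnal function \<open>r\<^sub>k(k + 1, t; n)\<close>, intended for
  \<open>2 \<le> k < n\<close> and \<open>2 \<le> t \<le> k + 1\<close>.
  The minimum exists by Ramsey's theorem; see \<open>eh_arrow_erdos_hajnal\<close> below.
\<close>

definition erdos_hajnal :: "nat \<Rightarrow> nat \<Rightarrow> nat \<Rightarrow> nat" where
  "erdos_hajnal k t n = (LEAST N. eh_arrow k t n N)"

text \<open>The tower function is indexed from 1; its value at index 0 is left unspecified.\<close>

fun tw :: "nat \<Rightarrow> real \<Rightarrow> real" where
  "tw (Suc 0) x = x"
| "tw (Suc (Suc i)) x = 2 powr tw (Suc i) x"

lemma eh_arrow_ex:
  assumes "t \<le> k + 1"
  shows "\<exists>N. eh_arrow k t n N"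
proof -
  obtain N :: nat where N: "partn_lst {..<N} [k + 1, n] k"
    using ramsey_full by blast
  have "eh_arrow k t n N"
    unfolding eh_arrow_def
  proof
    fix \<chi> :: "nat set \<Rightarrow> colour"
    define f where "f = (\<lambda>e. if \<chi> e = Red then 0 else 1 :: nat)"
    have "f \<in> [{..<N}]\<^bsup>k\<^esup> \<rightarrow> {..<length [k + 1, n]}"
      by (auto simp: f_def)
    then obtain i where i: "i < length [k + 1, n]"
      and "monochromatic {..<N} ([k + 1, n] ! i) k f i"
      using N unfolding partn_lst_def by blast
    then obtain H where H: "H \<in> [{..<N}]\<^bsup>([k + 1, n] ! i)\<^esup>" and mono: "f ` [H]\<^bsup>k\<^esup> \<subseteq> {i}"
      unfolding monochromatic_def by blast
    consider "i = 0" | "i = 1" using i by fastforce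
    then show "(\<exists>S \<in> [{..<N}]\<^bsup>(k + 1)\<^esup>. t \<le> card {e \<in> [S]\<^bsup>k\<^esup>. \<chi> e = Red}) \<or>
        (\<exists>T \<in> [{..<N}]\<^bsup>n\<^esup>. \<forall>e \<in> [T]\<^bsup>k\<^esup>. \<chi> e = Blue)"
    proof cases
      case 1
      have "{e \<in> [H]\<^bsup>k\<^esup>. \<chi> e = Red} = [H]\<^bsup>k\<^esup>"
        using mono 1 by (auto simp: f_def image_subset_iff split: if_splits)
      moreover have "card ([H]\<^bsup>k\<^esup>) = k + 1"
        using H 1 by (auto simp: nsets_def[of "{..<N}"])
      moreover have "H \<in> [{..<N}]\<^bsup>(k + 1)\<^esup>" using H 1 by simp
      ultimately show ?thesis using assms by (metis (no_types, lifting))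
    next
      case 2
      have "\<forall>e \<in> [H]\<^bsup>k\<^esup>. \<chi> e = Blue"
      proof
        fix e assume "e \<in> [H]\<^bsup>k\<^esup>"
        then have "f e = 1" using mono 2 by blast
        then show "\<chi> e = Blue" by (cases "\<chi> e") (simp_all add: f_def)
      qed
      moreover have "H \<in> [{..<N}]\<^bsup>n\<^esup>" using H 2 by simp
      ultimately show ?thesis by blast
    qed
  qed
  then show ?thesis ..
qed

lemma eh_arrow_erdos_hajnal:
  "t \<le> k + 1 \<Longrightarrow> eh_arrow k t n (erdos_hajnal k t n)"
  unfolding erdos_hajnal_def using eh_arrow_ex by (metis LeastI_ex)

end

theory Submission
  imports Defs "HOL-Library.FuncSet" "HOL-Library.Disjoint_Sets"
begin

text \<open>
  The height of the tower comes from stepping up from \<open>k - 1\<close> to \<open>k\<close>, its top floor from a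
  colouring of triples.

  Triples. There are \<open>2\<^bsup>c n log n\<^esup>\<close> points and a colouring of their triples with at most two
  red triples among any four points and no blue \<open>n\<close>-set (\<open>not_eh_arrow_3_explicit\<close>); the order
  of magnitude \<open>n log n\<close> was found by Fox and He. Every point \<open>a\<close> gives every other point \<open>b\<close> a
  label, a vertex of a triangle-free graph, and a triple is red if at each of its points the
  labels given to the two others are adjacent. Three red triples on four points have a common
  point, and the labels this point gives to the three others would form a triangle. The
  labels are chosen at random. The graph consists of the pairs of points in the cube
  \<open>{0,1}\<^bsup>3e\<^esup>\<close> at Hamming distance more than \<open>2e\<close>: it has \<open>m = 8\<^bsup>e\<^esup>\<close> vertices, but any two sets
  of \<open>7\<^bsup>e\<^esup>\<close> vertices are joined by an edge. A label that has to avoid the neighbourhood of such a set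
  is therefore confined to a fraction \<open>m\<^bsup>-c\<^esup>\<close> of the graph. In a blue set of \<open>n\<close> points this
  happens to a constant proportion of the \<open>n\<^sup>2\<close> pairs, unless the labels are atypical in a way
  that is equally unlikely, so that a given \<open>n\<close>-set is blue with
  probability \<open>m ^ (- c * n\<^sup>2)\<close> only (\<open>independent_card\<close>). With \<open>m\<close> a power of \<open>n\<close> this beats the
  number of \<open>n\<close>-sets. A constant number of labels would only give \<open>2\<^bsup>c n\<^esup>\<close> points; the
  factor \<open>log n\<close> is what becomes \<open>log log n\<close> in the end.

  Stepping up. Given a colouring \<open>\<chi>\<close> of the \<open>(k - 1)\<close>-sets of \<open>{..<N}\<close>, the new points are the
  \<open>2\<^bsup>N\<^esup>\<close> subsets of \<open>{..<N}\<close>. A set of new points is the set of leaves of a binary tree, whose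
  inner nodes are labelled by the coordinates at which the points branch. A \<open>k\<close>-set whose tree
  is a left or right comb has \<open>k - 1\<close> distinct labels and inherits the colour of its set of
  labels; for \<open>k = 4\<close> all other \<open>k\<close>-sets are blue. A tree with more than \<open>4\<^bsup>n\<^esup>\<close> leaves
  contains a comb with \<open>n\<close> labels, so a colouring of triples without blue \<open>n\<close>-set yields one of
  quadruples without blue \<open>2\<^bsup>O(n)\<^esup>\<close>-set (\<open>step_up_4\<close>). This loss of a logarithm turns \<open>2\<^bsup>c n log n\<^esup>\<close> into
  \<open>n\<^bsup>c log log n\<^esup>\<close>. For \<open>k \<ge> 5\<close> one further shape is coloured red, namely a pair of leaves to the
  left of the root and a left comb to the right. A tree without this shape and without long
  combs has polynomially many leaves only, so \<open>n\<close> becomes a power of \<open>n\<close>, and the tower grows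
  by one floor (\<open>step_up_5\<close>).

  The colourings have few red edges because a tree with \<open>k + 1\<close> leaves that is not a comb
  always has two leaves whose deletion leaves a tree of none of the red shapes
  (\<open>two_plain_deletions\<close>); deleting a leaf from a comb amounts to deleting a label, so
  that the property of \<open>\<chi>\<close> is passed on.
\<close>

section \<open>A triangle-free graph with small independent sets\<close>

text \<open>
  As \<open>v * w \<le> u\<^sup>2\<close>, the numbers \<open>v\<close> and \<open>w\<close> cannot both be near \<open>2 * u\<close>: by convexity their sum
  is largest when they are \<open>2 * u\<close> and \<open>u / 2\<close>.
\<close>

lemma sum_le_of_equal_products:
  fixes u p r v w :: real
  assumes "p * r = v * w" "0 \<le> p" "0 \<le> r" "0 \<le> v" "0 \<le> w"
    and "p \<le> u" "r \<le> u" "v \<le> 2 * u" "w \<le> 2 * u"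
  shows "p + r + v + w \<le> 9 / 2 * u"
proof -
  have u0: "0 \<le> u" using assms by linarith
  have vw: "v * w \<le> u * u" using assms mult_mono[of p u r u] by simp
  have "v + w \<le> 5 / 2 * u"
  proof (cases "v \<le> u / 2")
    case True then show ?thesis using assms by simp
  next
    case False
    then have v: "0 < v" using u0 by simp
    have "(v - 2 * u) * (v - u / 2) \<le> 0"
      using False assms by (intro mult_nonpos_nonneg) auto
    then have "v * (v + w) \<le> v * (5 / 2 * u)" using vw by (simp add: algebra_simps)
    then show ?thesis using v by simp
  qed
  then show ?thesis using assms by simp
qed

text \<open>
  Cutting both families by their last coordinate gives four pairs of half-families. Pairs in
  equal halves are still at distance \<open>D\<close>, pairs in opposite halves at least at distance \<open>D - 1\<close>,
  so the induction hypothesis is worse by a factor 2 for the latter; but the product of the two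
  products of sizes is the same in both cases, which is the situation of
  \<open>sum_le_of_equal_products\<close>. The bound beats the trivial \<open>4 ^ d\<close> once \<open>D\<close> exceeds about \<open>d / 6\<close>.
\<close>

lemma cross_distance_bound:
  assumes "A \<subseteq> Pow {..<d}" "B \<subseteq> Pow {..<d}"
    and "\<And>X Y. X \<in> A \<Longrightarrow> Y \<in> B \<Longrightarrow> D \<le> card (sym_diff X Y)"
  shows "real (card A) * real (card B) * 2 ^ D \<le> (9 / 2) ^ d"
  using assms
proof (induction d arbitrary: A B D)
  case 0
  then have "A = {} \<or> A = {{}}" "B = {} \<or> B = {{}}" by auto
  then show ?case using 0(3)[of "{}" "{}"] by auto
next
  case (Suc d)
  define lo where "lo = (\<lambda>A :: nat set set. {X \<in> A. d \<notin> X})"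
  define hi where "hi = (\<lambda>A :: nat set set. (\<lambda>X. X - {d}) ` {X \<in> A. d \<in> X})"
  have sub: "lo S \<subseteq> Pow {..<d}" "hi S \<subseteq> Pow {..<d}" if "S \<subseteq> Pow {..<Suc d}" for S
    using that unfolding lo_def hi_def by (fastforce simp: less_Suc_eq)+
  have crd: "card S = card (lo S) + card (hi S)" if "S \<subseteq> Pow {..<Suc d}" for S
  proof -
    have fin: "finite S" using that finite_subset by blast
    have "card (hi S) = card {X \<in> S. d \<in> X}"
      unfolding hi_def by (intro card_image inj_onI) auto
    moreover have "card S = card {X \<in> S. d \<notin> X} + card {X \<in> S. d \<in> X}"
      using fin by (subst card_Un_disjoint[symmetric]) (auto intro: arg_cong[where f = card])
    ultimately show ?thesis by (simp add: lo_def)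
  qed
  have ll: "D \<le> card (sym_diff X Y)" if "X \<in> lo A" "Y \<in> lo B" for X Y
    using Suc.prems(3) that by (auto simp: lo_def)
  have hh: "D \<le> card (sym_diff X Y)" if "X \<in> hi A" "Y \<in> hi B" for X Y
  proof -
    obtain X' Y' where *: "X' \<in> A" "Y' \<in> B" "d \<in> X'" "d \<in> Y'" "X = X' - {d}" "Y = Y' - {d}"
      using \<open>X \<in> hi A\<close> \<open>Y \<in> hi B\<close> unfolding hi_def by blast
    then have "sym_diff X Y = sym_diff X' Y'" by auto
    then show ?thesis using Suc.prems(3)[OF *(1,2)] by simp
  qed
  have ins: "D - 1 \<le> card T" if "D \<le> card (insert d T)" for T :: "nat set"
    using that card_insert_le_m1[of "card T + 1" T d] by (cases "finite T") (auto simp: card_insert_if split: if_splits)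
  have lh: "D - 1 \<le> card (sym_diff X Y)" if "X \<in> lo A" "Y \<in> hi B" for X Y
  proof -
    obtain Y' where *: "Y' \<in> B" "d \<in> Y'" "Y = Y' - {d}"
      using \<open>Y \<in> hi B\<close> unfolding hi_def by blast
    then have "sym_diff X Y' = insert d (sym_diff X Y)" using that by (auto simp: lo_def)
    then show ?thesis using Suc.prems(3)[of X Y'] * that ins by (auto simp: lo_def)
  qed
  have hl: "D - 1 \<le> card (sym_diff X Y)" if "X \<in> hi A" "Y \<in> lo B" for X Y
  proof -
    obtain X' where *: "X' \<in> A" "d \<in> X'" "X = X' - {d}"
      using \<open>X \<in> hi A\<close> unfolding hi_def by blast
    then have "sym_diff X' Y = insert d (sym_diff X Y)" using that by (auto simp: lo_def)
    then show ?thesis using Suc.prems(3)[of X' Y] * that ins by (auto simp: lo_def)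
  qed
  define a0 a1 b0 b1 where ab: "a0 = real (card (lo A))" "a1 = real (card (hi A))"
    "b0 = real (card (lo B))" "b1 = real (card (hi B))"
  define u where "u = (9 / 2 :: real) ^ d / 2 ^ D"
  have same: "x \<le> u" if "x * 2 ^ D \<le> (9 / 2) ^ d" for x
    using that by (simp add: u_def field_simps)
  have diff: "x \<le> 2 * u" if "x * 2 ^ (D - 1) \<le> (9 / 2) ^ d" "0 \<le> x" for x
  proof (cases D)
    case 0 then show ?thesis using that by (simp add: u_def)
  next
    case (Suc D') then show ?thesis using that by (simp add: u_def field_simps)
  qed
  note sA = sub[OF Suc.prems(1)] and sB = sub[OF Suc.prems(2)]
  have "a0 * b0 \<le> u" unfolding ab by (intro same Suc.IH sA sB ll)
  moreover have "a1 * b1 \<le> u" unfolding ab by (intro same Suc.IH sA sB hh)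
  moreover have "a0 * b1 \<le> 2 * u" unfolding ab by (intro diff Suc.IH sA sB lh) auto
  moreover have "a1 * b0 \<le> 2 * u" unfolding ab by (intro diff Suc.IH sA sB hl) auto
  ultimately have "a0 * b0 + a1 * b1 + a0 * b1 + a1 * b0 \<le> 9 / 2 * u"
    by (intro sum_le_of_equal_products) (auto simp: ab)
  then have "(a0 + a1) * (b0 + b1) \<le> 9 / 2 * u" by (simp add: algebra_simps)
  moreover have "real (card A) = a0 + a1" "real (card B) = b0 + b1"
    unfolding ab using crd Suc.prems by auto
  ultimately have "real (card A) * real (card B) \<le> 9 / 2 * u" by simp
  then show ?case by (simp add: u_def field_simps)
qed

text \<open>
  Adjacency in the label graph, whose vertices are the points of the cube of dimension \<open>3 * e\<close>.
\<close>

definition far :: "nat \<Rightarrow> nat set \<Rightarrow> nat set \<Rightarrow> bool" where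
  "far e X Y \<longleftrightarrow> 2 * e < card (sym_diff X Y)"

lemma far_commute: "far e X Y = far e Y X"
  by (simp add: far_def Un_commute)

text \<open>
  A coordinate separates at most two of the three pairs, so the three distances add up to at
  most \<open>6 * e\<close>.
\<close>

lemma far_triangle_free:
  assumes "X \<subseteq> {..<3 * e}" "Y \<subseteq> {..<3 * e}" "Z \<subseteq> {..<3 * e}"
    and "far e X Y" "far e X Z" "far e Y Z"
  shows False
proof -
  define c where "c = (\<lambda>S T (i :: nat). if i \<in> sym_diff S T then 1 else 0 :: nat)"
  have c: "card (sym_diff S T) = (\<Sum>i<3 * e. c S T i)"
    if "S \<subseteq> {..<3 * e}" "T \<subseteq> {..<3 * e}" for S T
  proof -
    have "sym_diff S T = {..<3 * e} \<inter> sym_diff S T" using that by auto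
    then have "card (sym_diff S T) = card ({..<3 * e} \<inter> sym_diff S T)" by (rule arg_cong)
    also have "\<dots> = (\<Sum>i<3 * e. c S T i)" unfolding c_def by (subst sum.inter_filter[symmetric]) (auto simp: Int_def)
    finally show ?thesis .
  qed
  have "(\<Sum>i<3 * e. c X Y i) + (\<Sum>i<3 * e. c X Z i) + (\<Sum>i<3 * e. c Y Z i)
      = (\<Sum>i<3 * e. c X Y i + c X Z i + c Y Z i)"
    by (simp add: sum.distrib)
  also have "\<dots> \<le> (\<Sum>i<3 * e. 2)"
    by (intro sum_mono) (auto simp: c_def)
  finally show False using assms by (simp add: far_def c)
qed

text \<open>
  Replacing the members of \<open>B\<close> by their complements turns distances of at most \<open>2 * e\<close> into
  distances of at least \<open>e\<close>. The absence of edges would thus give \<open>(7 * 7 * 2) ^ e \<le> ((9/2)\<^sup>3) ^ e\<close>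
  by \<open>cross_distance_bound\<close>, but \<open>98 > 91.125\<close>.
\<close>

lemma far_expands:
  assumes "0 < e" "A \<subseteq> Pow {..<3 * e}" "B \<subseteq> Pow {..<3 * e}" "7 ^ e \<le> card A" "7 ^ e \<le> card B"
  shows "\<exists>X\<in>A. \<exists>Y\<in>B. far e X Y"
proof (rule ccontr)
  assume no: "\<not> ?thesis"
  define co where "co = (\<lambda>Y. {..<3 * e} - Y)"
  have "e \<le> card (sym_diff X Y)" if "X \<in> A" "Y \<in> co ` B" for X Y
  proof -
    obtain Y' where Y: "Y' \<in> B" "Y = co Y'" using \<open>Y \<in> co ` B\<close> by blast
    have sub: "X \<subseteq> {..<3 * e}" "Y' \<subseteq> {..<3 * e}" using that Y assms by auto
    then have eq: "sym_diff X Y = {..<3 * e} - sym_diff X Y'" unfolding Y co_def by auto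
    have "sym_diff X Y' \<subseteq> {..<3 * e}" using sub by auto
    then have "card (sym_diff X Y) = 3 * e - card (sym_diff X Y')"
      unfolding eq by (subst card_Diff_subset) (auto intro: finite_subset)
    moreover have "card (sym_diff X Y') \<le> 2 * e"
      using no that Y unfolding far_def by (meson not_less)
    ultimately show ?thesis by simp
  qed
  then have "real (card A) * real (card (co ` B)) * 2 ^ e \<le> (9 / 2) ^ (3 * e)"
    using assms by (intro cross_distance_bound) (auto simp: co_def)
  moreover have "card (co ` B) = card B"
    using assms(3) unfolding co_def by (intro card_image inj_onI) blast
  ultimately have "real (card A) * real (card B) * 2 ^ e \<le> ((9 / 2) ^ 3) ^ e"
    by (simp add: power_mult)
  moreover have "real (7 ^ e) * real (7 ^ e) * 2 ^ e \<le> real (card A) * real (card B) * 2 ^ e"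
    using assms by (intro mult_mono) (auto simp flip: of_nat_power)
  ultimately have "(98::real) ^ e \<le> ((9 / 2) ^ 3) ^ e"
    by (simp flip: power_mult_distrib)
  moreover have "((9 / 2) ^ 3 :: real) ^ e < 98 ^ e"
    using assms by (intro power_strict_mono) (auto simp: power3_eq_cube)
  ultimately show False by simp
qed

section \<open>Counting functions with prescribed behaviour on disjoint blocks\<close>

text \<open>
  Independence, as a statement about numbers: for a uniformly random function on \<open>I\<close>, events
  of probability at most \<open>\<tau>\<close> that concern disjoint blocks of arguments occur simultaneously with
  probability at most \<open>\<tau> ^ card J\<close>. All probability estimates below have this form.
\<close>

lemma card_blocks_le:
  fixes \<tau> :: real and S :: "('i \<Rightarrow> 'l) set"
  assumes fin: "finite I" "finite L" "finite J"
    and Blk: "\<And>j. j \<in> J \<Longrightarrow> Blk j \<subseteq> I" "disjoint_family_on Blk J"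
    and S: "S \<subseteq> I \<rightarrow>\<^sub>E L"
    and T: "\<And>g j. g \<in> S \<Longrightarrow> j \<in> J \<Longrightarrow> restrict g (Blk j) \<in> T j"
    and finT: "\<And>j. j \<in> J \<Longrightarrow> finite (T j)"
    and cardT: "\<And>j. j \<in> J \<Longrightarrow> real (card (T j)) \<le> \<tau> * real (card L) ^ card (Blk j)"
    and \<tau>: "0 \<le> \<tau>"
  shows "real (card S) \<le> \<tau> ^ card J * real (card L) ^ card I"
proof -
  define U where "U = (\<Union>j\<in>J. Blk j)"
  define \<Phi> where "\<Phi> = (\<lambda>g :: 'i \<Rightarrow> 'l. (\<lambda>j\<in>J. restrict g (Blk j), restrict g (I - U)))"
  have UI: "U \<subseteq> I" using Blk(1) by (auto simp: U_def)
  have finU: "finite U" using UI fin finite_subset by blast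
  have finB: "finite (Blk j)" if "j \<in> J" for j using Blk(1)[OF that] fin finite_subset by blast
  have "inj_on \<Phi> S"
  proof (rule inj_onI)
    fix g h assume g: "g \<in> S" and h: "h \<in> S" and eq: "\<Phi> g = \<Phi> h"
    show "g = h"
    proof (rule PiE_ext)
      show "g \<in> I \<rightarrow>\<^sub>E L" "h \<in> I \<rightarrow>\<^sub>E L" using g h S by auto
      fix i assume i: "i \<in> I"
      show "g i = h i"
      proof (cases "i \<in> U")
        case True
        then obtain j where j: "j \<in> J" "i \<in> Blk j" by (auto simp: U_def)
        have "fst (\<Phi> g) j i = fst (\<Phi> h) j i" using eq by simp
        then show ?thesis using j by (simp add: \<Phi>_def)
      next
        case False
        have "snd (\<Phi> g) i = snd (\<Phi> h) i" using eq by simp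
        then show ?thesis using i False by (simp add: \<Phi>_def)
      qed
    qed
  qed
  moreover have "\<Phi> ` S \<subseteq> (\<Pi>\<^sub>E j\<in>J. T j) \<times> ((I - U) \<rightarrow>\<^sub>E L)"
  proof (rule image_subsetI)
    fix g assume g: "g \<in> S"
    then have "(\<lambda>j\<in>J. restrict g (Blk j)) \<in> (\<Pi>\<^sub>E j\<in>J. T j)" using T by auto
    moreover have "restrict g (I - U) \<in> (I - U) \<rightarrow>\<^sub>E L" using g S by auto
    ultimately show "\<Phi> g \<in> (\<Pi>\<^sub>E j\<in>J. T j) \<times> ((I - U) \<rightarrow>\<^sub>E L)" by (simp add: \<Phi>_def)
  qed
  moreover have "finite ((\<Pi>\<^sub>E j\<in>J. T j) \<times> ((I - U) \<rightarrow>\<^sub>E L))"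
    using fin finT by (intro finite_cartesian_product finite_PiE) auto
  ultimately have "card S \<le> card ((\<Pi>\<^sub>E j\<in>J. T j) \<times> ((I - U) \<rightarrow>\<^sub>E L))"
    by (rule card_inj_on_le)
  also have "\<dots> = (\<Prod>j\<in>J. card (T j)) * card L ^ card (I - U)"
    using fin by (simp add: card_cartesian_product card_PiE)
  finally have "real (card S) \<le> (\<Prod>j\<in>J. real (card (T j))) * real (card L) ^ card (I - U)"
    by (simp flip: of_nat_le_iff[where ?'a = real])
  also have "\<dots> \<le> (\<Prod>j\<in>J. \<tau> * real (card L) ^ card (Blk j)) * real (card L) ^ card (I - U)"
    using cardT by (intro mult_right_mono prod_mono) auto
  also have "(\<Prod>j\<in>J. \<tau> * real (card L) ^ card (Blk j)) = \<tau> ^ card J * real (card L) ^ (\<Sum>j\<in>J. card (Blk j))"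
    by (simp add: prod.distrib power_sum)
  also have "(\<Sum>j\<in>J. card (Blk j)) = card U"
    unfolding U_def using fin finB Blk(2) by (subst card_UN_disjoint') (auto simp: disjoint_family_on_def)
  also have "\<tau> ^ card J * real (card L) ^ card U * real (card L) ^ card (I - U)
      = \<tau> ^ card J * real (card L) ^ (card U + card (I - U))"
    by (simp add: power_add)
  also have "card U + card (I - U) = card I"
    using UI fin finU by (simp add: card_Diff_subset card_mono)
  finally show ?thesis .
qed

lemma card_le_sum_cover:
  fixes b :: real
  assumes "finite U" "S \<subseteq> (\<Union>u\<in>U. T u)"
    and "\<And>u. u \<in> U \<Longrightarrow> finite (T u)" "\<And>u. u \<in> U \<Longrightarrow> real (card (T u)) \<le> b"
  shows "real (card S) \<le> real (card U) * b"
proof -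
  have "card S \<le> card (\<Union>u\<in>U. T u)"
    using assms by (intro card_mono) auto
  also have "\<dots> \<le> (\<Sum>u\<in>U. card (T u))" using assms(1) by (rule card_UN_le)
  finally have "real (card S) \<le> (\<Sum>u\<in>U. real (card (T u)))"
    by (metis of_nat_le_iff of_nat_sum)
  also have "\<dots> \<le> (\<Sum>u\<in>U. b)" using assms by (intro sum_mono) auto
  finally show ?thesis by simp
qed

text \<open>
  There are at most \<open>2 ^ card K\<close> ways to choose \<open>t\<close> bad blocks. This factor is harmless wherever
  \<open>\<tau>\<close> is much smaller than a constant.
\<close>

lemma card_many_bad_blocks_le:
  fixes \<tau> :: real
  assumes fin: "finite I" "finite L" "finite K"
    and Blk: "\<And>j. j \<in> K \<Longrightarrow> Blk j \<subseteq> I" "disjoint_family_on Blk K"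
    and S: "S \<subseteq> I \<rightarrow>\<^sub>E L"
    and T: "\<And>g. g \<in> S \<Longrightarrow> t \<le> card {j \<in> K. restrict g (Blk j) \<in> T j}"
    and finT: "\<And>j. j \<in> K \<Longrightarrow> finite (T j)"
    and cardT: "\<And>j. j \<in> K \<Longrightarrow> real (card (T j)) \<le> \<tau> * real (card L) ^ card (Blk j)"
    and \<tau>: "0 \<le> \<tau>"
  shows "real (card S) \<le> 2 ^ card K * (\<tau> ^ t * real (card L) ^ card I)"
proof -
  define U where "U = {J. J \<subseteq> K \<and> card J = t}"
  define R where "R = (\<lambda>J. {g \<in> I \<rightarrow>\<^sub>E L. \<forall>j\<in>J. restrict g (Blk j) \<in> T j})"
  have finU: "finite U" unfolding U_def using fin by simp
  have "real (card S) \<le> real (card U) * (\<tau> ^ t * real (card L) ^ card I)"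
  proof (rule card_le_sum_cover[OF finU])
    show "S \<subseteq> (\<Union>J\<in>U. R J)"
    proof
      fix g assume g: "g \<in> S"
      obtain J where "J \<subseteq> {j \<in> K. restrict g (Blk j) \<in> T j}" "card J = t"
        using obtain_subset_with_card_n[OF T[OF g]] by metis
      then have "J \<in> U" "g \<in> R J" using g S by (auto simp: U_def R_def)
      then show "g \<in> (\<Union>J\<in>U. R J)" by blast
    qed
  next
    fix J assume J: "J \<in> U"
    show "finite (R J)"
      by (rule finite_subset[of _ "I \<rightarrow>\<^sub>E L"]) (auto simp: R_def fin intro!: finite_PiE)
    have "real (card (R J)) \<le> \<tau> ^ card J * real (card L) ^ card I"
    proof (rule card_blocks_le[where Blk = Blk and T = T, OF fin(1,2)])
      show "finite J" using J fin finite_subset by (auto simp: U_def)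
      show "disjoint_family_on Blk J" using J Blk(2) by (auto simp: U_def disjoint_family_on_def)
    qed (use J Blk finT cardT \<tau> in \<open>auto simp: U_def R_def\<close>)
    then show "real (card (R J)) \<le> \<tau> ^ t * real (card L) ^ card I" using J by (simp add: U_def)
  qed
  also have "card U \<le> card (Pow K)" unfolding U_def using fin by (intro card_mono) auto
  then have "real (card U) \<le> 2 ^ card K"
    using fin by (simp add: card_Pow flip: of_nat_le_iff)
  then have "real (card U) * (\<tau> ^ t * real (card L) ^ card I) \<le> 2 ^ card K * (\<tau> ^ t * real (card L) ^ card I)"
    using \<tau> by (intro mult_right_mono) auto
  finally show ?thesis .
qed

section \<open>Independent sets in the random triple system\<close>

text \<open>
  The random labels are drawn from \<open>V\<close>. By \<open>expands\<close>, all but fewer than \<open>k0\<close> labels are adjacent to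
  some member of any given set of \<open>k0\<close> labels.
\<close>

locale expander =
  fixes V :: "'v set" and adj :: "'v \<Rightarrow> 'v \<Rightarrow> bool" and k0 :: nat
  assumes finV [simp]: "finite V"
    and adj_sym: "adj u v \<Longrightarrow> adj v u"
    and expands: "X \<subseteq> V \<Longrightarrow> Y \<subseteq> V \<Longrightarrow> k0 \<le> card X \<Longrightarrow> k0 \<le> card Y \<Longrightarrow> \<exists>x\<in>X. \<exists>y\<in>Y. adj x y"
    and k0_pos: "0 < k0"
    and k0_le: "k0 \<le> card V"
begin

lemma few_nonneighbours:
  assumes "X \<subseteq> V" "k0 \<le> card X"
  shows "card {v \<in> V. \<forall>x\<in>X. \<not> adj v x} < k0"
proof (rule ccontr)
  assume "\<not> ?thesis"
  then have "\<exists>x\<in>X. \<exists>y\<in>{v \<in> V. \<forall>x\<in>X. \<not> adj v x}. adj x y"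
    using assms by (intro expands) auto
  then show False using adj_sym by blast
qed

text \<open>
  Each pair of points \<open>x < y\<close> carries an element of \<open>V \<times> V\<close>: the label that \<open>x\<close> gives to \<open>y\<close> and the
  label that \<open>y\<close> gives to \<open>x\<close>. If \<open>p\<close>, \<open>q\<close>, \<open>s\<close> are carried by \<open>(a, j)\<close>, \<open>(a, k)\<close>, \<open>(j, k)\<close> for
  \<open>a < j < k\<close>, then \<open>tri p q s\<close> says that the labels match at \<open>a\<close>, at \<open>j\<close> and at \<open>k\<close>.
\<close>

definition tri :: "'v \<times> 'v \<Rightarrow> 'v \<times> 'v \<Rightarrow> 'v \<times> 'v \<Rightarrow> bool" where
  "tri p q s \<longleftrightarrow> adj (fst p) (fst q) \<and> adj (snd p) (fst s) \<and> adj (snd q) (snd s)"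

text \<open>
  Suppose that many values \<open>q\<close> for the pair \<open>(a, k)\<close> complete no red triple. Then at least \<open>k0\<close>
  labels \<open>u'\<close> occur as second component of such a \<open>q\<close> together with at least \<open>k0\<close> labels \<open>u\<close>. Let \<open>Q\<close>
  be the set of labels adjacent to none of the \<open>u'\<close>, and for any other label \<open>v\<close> let \<open>F v\<close> be the
  set of labels adjacent to none of the \<open>u\<close> that belong to one fixed neighbour \<open>u'\<close> of \<open>v\<close>. All these
  sets are small by expansion. The point of passing to \<open>Q\<close> and \<open>F\<close> is that they are described by
  \<open>card V + (card V)\<^sup>2\<close> bits, however large \<open>B\<close> is, so that a union bound over them is cheap.
\<close>

lemma dead_certificate:
  assumes p: "p ` B \<subseteq> V \<times> V" and s: "s ` B \<subseteq> V \<times> V"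
    and dead: "2 * k0 * card V \<le> card {q \<in> V \<times> V. \<forall>j\<in>B. \<not> tri (p j) q (s j)}"
  shows "\<exists>Q F. Q \<subseteq> V \<and> card Q < k0 \<and> F \<in> V \<rightarrow>\<^sub>E Pow V \<and> (\<forall>v\<in>V. card (F v) < k0) \<and>
    (\<forall>j\<in>B. snd (s j) \<notin> Q \<longrightarrow> adj (snd (p j)) (fst (s j)) \<longrightarrow> fst (p j) \<in> F (snd (s j)))"
proof -
  define Dd where "Dd = {q \<in> V \<times> V. \<forall>j\<in>B. \<not> tri (p j) q (s j)}"
  define col where "col = (\<lambda>u'. {u \<in> V. (u, u') \<in> Dd})"
  define U where "U = {u' \<in> V. k0 \<le> card (col u')}"
  have "0 < card V" using k0_pos k0_le by simp
  have U: "k0 \<le> card U"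
  proof (rule ccontr)
    assume *: "\<not> ?thesis"
    have fincol: "finite (SIGMA u':V. col u')" by (intro finite_SigmaI) (auto simp: col_def)
    have "(\<lambda>(u, u'). (u', u)) ` Dd \<subseteq> (SIGMA u':V. col u')" by (auto simp: Dd_def col_def)
    moreover have "card ((\<lambda>(u, u'). (u', u)) ` Dd) = card Dd"
      by (intro card_image inj_onI) auto
    ultimately have "card Dd \<le> card (SIGMA u':V. col u')"
      by (metis card_mono fincol)
    also have "\<dots> = (\<Sum>u'\<in>V. card (col u'))" by (subst card_SigmaI) (auto simp: col_def)
    also have "\<dots> \<le> (\<Sum>u'\<in>V. k0 + (if u' \<in> U then card V else 0))"
      by (intro sum_mono) (auto simp: U_def col_def intro!: trans_le_add2 card_mono)
    also have "\<dots> = card V * k0 + (\<Sum>u'\<in>V. if u' \<in> U then card V else 0)"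
      by (simp add: sum.distrib)
    also have "(\<Sum>u'\<in>V. if u' \<in> U then card V else 0) = card U * card V"
      by (subst sum.inter_restrict[symmetric]) (auto simp: U_def Int_def)
    also have "card V * k0 + card U * card V < 2 * k0 * card V"
      using * \<open>0 < card V\<close> by (simp add: algebra_simps)
    finally show False using dead by (simp add: Dd_def)
  qed
  define Q where "Q = {v \<in> V. \<forall>u'\<in>U. \<not> adj v u'}"
  define pick where "pick = (\<lambda>v. SOME u'. u' \<in> U \<and> adj v u')"
  have pick: "pick v \<in> U \<and> adj v (pick v)" if "v \<in> V" "v \<notin> Q" for v
    unfolding pick_def by (rule someI_ex) (use that in \<open>auto simp: Q_def\<close>)
  define F where "F = (\<lambda>v\<in>V. if v \<in> Q then {} else {x \<in> V. \<forall>u\<in>col (pick v). \<not> adj x u})"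
  have "card Q < k0" unfolding Q_def using U by (intro few_nonneighbours) (auto simp: U_def)
  moreover have "F \<in> V \<rightarrow>\<^sub>E Pow V" by (auto simp: F_def)
  moreover have "card (F v) < k0" if "v \<in> V" for v
  proof (cases "v \<in> Q")
    case True then show ?thesis using that k0_pos by (simp add: F_def)
  next
    case False
    then have "card {x \<in> V. \<forall>u\<in>col (pick v). \<not> adj x u} < k0"
      using pick[OF that] by (intro few_nonneighbours) (auto simp: U_def col_def)
    then show ?thesis using False that by (simp add: F_def)
  qed
  moreover have "fst (p j) \<in> F (snd (s j))"
    if j: "j \<in> B" "snd (s j) \<notin> Q" "adj (snd (p j)) (fst (s j))" for j
  proof -
    have V: "snd (s j) \<in> V" "fst (p j) \<in> V" using s p j by (auto simp: image_subset_iff mem_Times_iff)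
    have "\<not> adj (fst (p j)) u" if "u \<in> col (pick (snd (s j)))" for u
      using that pick[OF V(1) j(2)] j adj_sym by (auto simp: col_def Dd_def tri_def)
    then show ?thesis using V j by (auto simp: F_def)
  qed
  ultimately show ?thesis by (intro exI[of _ Q] exI[of _ F]) (auto simp: Q_def)
qed

text \<open>
  For fixed certificates in the columns \<open>D\<close>, the pair \<open>p\<close> is confined to a small set: except for
  fewer than \<open>k0\<close> values, \<open>snd p\<close> is adjacent to \<open>fst (s k)\<close> for some \<open>k\<close> with \<open>snd (s k) \<notin> Q k\<close>, and
  then \<open>fst p\<close> has to lie in a set with fewer than \<open>k0\<close> elements.
\<close>

lemma allowed_card:
  assumes s: "s ` D \<subseteq> V \<times> V"
    and F: "\<And>k v. k \<in> D \<Longrightarrow> v \<in> V \<Longrightarrow> F k v \<subseteq> V \<and> card (F k v) < k0"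
    and fine: "k0 \<le> card ((\<lambda>k. fst (s k)) ` {k \<in> D. snd (s k) \<notin> Q k})"
  shows "card {p \<in> V \<times> V. \<forall>k\<in>D. snd (s k) \<notin> Q k \<longrightarrow> adj (snd p) (fst (s k)) \<longrightarrow>
    fst p \<in> F k (snd (s k))} \<le> 2 * k0 * card V" (is "card ?S \<le> _")
proof -
  define R where "R = (\<lambda>k. fst (s k)) ` {k \<in> D. snd (s k) \<notin> Q k}"
  define N where "N = {v \<in> V. \<forall>u\<in>R. \<not> adj v u}"
  have N: "card N < k0" unfolding N_def
    using s fine by (intro few_nonneighbours) (auto simp: R_def image_subset_iff mem_Times_iff)
  define G where "G = (\<lambda>v. {u \<in> V. (u, v) \<in> ?S})"
  have G: "card (G v) \<le> k0" if v: "v \<in> V" "v \<notin> N" for v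
  proof -
    obtain k where k: "k \<in> D" "snd (s k) \<notin> Q k" "adj v (fst (s k))"
      using v by (auto simp: N_def R_def)
    then have "G v \<subseteq> F k (snd (s k))" by (auto simp: G_def)
    moreover have "snd (s k) \<in> V" using s k by (auto simp: image_subset_iff mem_Times_iff)
    ultimately show ?thesis
      using F[OF k(1), of "snd (s k)"] by (meson card_mono finV finite_subset less_imp_le order_trans)
  qed
  have finG: "finite (SIGMA v:V. G v)" by (intro finite_SigmaI) (auto simp: G_def)
  have "card ?S = card ((\<lambda>(u, v). (v, u)) ` ?S)" by (intro card_image[symmetric] inj_onI) auto
  also have "\<dots> \<le> card (SIGMA v:V. G v)" by (intro card_mono finG) (auto simp: G_def)
  also have "\<dots> = (\<Sum>v\<in>V. card (G v))" by (subst card_SigmaI) (auto simp: G_def)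
  also have "\<dots> \<le> (\<Sum>v\<in>V. k0 + (if v \<in> N then card V else 0))"
    using G by (intro sum_mono) (auto simp: G_def intro!: trans_le_add2 card_mono)
  also have "\<dots> = card V * k0 + card N * card V"
    by (simp add: sum.distrib) (subst sum.inter_restrict[symmetric]; auto simp: N_def Int_def)
  also have "\<dots> \<le> 2 * k0 * card V"
    using N mult_right_mono[of "card N" k0 "card V"] by (simp add: algebra_simps)
  finally show ?thesis .
qed

lemma card_V_pos: "0 < card V"
  using k0_pos k0_le by simp

text \<open>
  Up to a factor 2, the proportion of labels in a set too small to be subject to expansion.
\<close>

definition \<theta> :: real where "\<theta> = 2 * real k0 / real (card V)"

lemma \<theta>_nonneg: "0 \<le> \<theta>"
  by (simp add: \<theta>_def)

lemma card_singleton_le: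
  assumes "card W \<le> 2 * k0 * card V"
  shows "real (card ({i} \<rightarrow>\<^sub>E W)) \<le> \<theta> * real (card (V \<times> V)) ^ card {i}"
proof -
  have "real (card W) \<le> real (2 * k0 * card V)" using assms by (simp only: of_nat_le_iff)
  moreover have "V \<noteq> {}" using card_V_pos by auto
  ultimately show ?thesis
    by (simp add: card_PiE \<theta>_def card_cartesian_product field_simps)
qed

text \<open>
  A row \<open>s\<close> is fine if \<open>allowed_card\<close> applies to it: expansion can be used for the first
  components even after the columns with second component in \<open>Q k\<close> have been discarded.
\<close>

definition fine where
  "fine D Q s \<longleftrightarrow> k0 \<le> card ((\<lambda>k. fst (s k)) ` {k \<in> D. snd (s k) \<notin> Q k})"

lemma fine_cong: "(\<And>k. k \<in> D \<Longrightarrow> s k = s' k) \<Longrightarrow> fine D Q s = fine D Q s'"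
proof -
  assume *: "\<And>k. k \<in> D \<Longrightarrow> s k = s' k"
  then have "(\<lambda>k. fst (s k)) ` {k \<in> D. snd (s k) \<notin> Q k} = (\<lambda>k. fst (s' k)) ` {k \<in> D. snd (s' k) \<notin> Q k}"
    by (intro image_cong) auto
  then show ?thesis by (simp add: fine_def)
qed

definition small where "small D Q \<longleftrightarrow> (\<forall>k\<in>D. Q k \<subseteq> V \<and> card (Q k) < k0)"

text \<open>
  If a row is not fine, then its remaining first components form a set \<open>R\<close> with fewer than \<open>k0\<close>
  elements. So each of its entries in \<open>D\<close> has its second component in \<open>Q k\<close> or its first component
  in \<open>R\<close>, which has probability at most \<open>\<theta>\<close>. There are at most \<open>2 ^ card V\<close> sets \<open>R\<close>.
\<close>

lemma nonfine_card:
  assumes fin: "finite I" "finite D" and \<iota>: "inj_on \<iota> D" "\<iota> ` D \<subseteq> I" and Q: "small D Q"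
  shows "real (card {g \<in> I \<rightarrow>\<^sub>E V \<times> V. \<not> fine D Q (\<lambda>k. g (\<iota> k))})
    \<le> 2 ^ card V * (\<theta> ^ card D * real (card (V \<times> V)) ^ card I)"
proof -
  define U where "U = {R. R \<subseteq> V \<and> card R < k0}"
  define W where "W = (\<lambda>R k. {q \<in> V \<times> V. snd q \<in> Q k \<or> fst q \<in> R})"
  define T where "T = (\<lambda>R. {g \<in> I \<rightarrow>\<^sub>E V \<times> V. \<forall>k\<in>D. g (\<iota> k) \<in> W R k})"
  have finU: "finite U" by (simp add: U_def)
  have "real (card {g \<in> I \<rightarrow>\<^sub>E V \<times> V. \<not> fine D Q (\<lambda>k. g (\<iota> k))})
    \<le> real (card U) * (\<theta> ^ card D * real (card (V \<times> V)) ^ card I)"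
  proof (rule card_le_sum_cover[where T = T, OF finU])
    show "{g \<in> I \<rightarrow>\<^sub>E V \<times> V. \<not> fine D Q (\<lambda>k. g (\<iota> k))} \<subseteq> (\<Union>R\<in>U. T R)"
    proof
      fix g assume "g \<in> {g \<in> I \<rightarrow>\<^sub>E V \<times> V. \<not> fine D Q (\<lambda>k. g (\<iota> k))}"
      then have g: "g \<in> I \<rightarrow>\<^sub>E V \<times> V" and nf: "\<not> fine D Q (\<lambda>k. g (\<iota> k))" by auto
      have gV: "g (\<iota> k) \<in> V \<times> V" if "k \<in> D" for k using g \<iota>(2) that by blast
      define R where "R = (\<lambda>k. fst (g (\<iota> k))) ` {k \<in> D. snd (g (\<iota> k)) \<notin> Q k}"
      have "R \<in> U" using nf gV by (fastforce simp: U_def R_def fine_def not_le)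
      moreover have "g \<in> T R" using g gV by (auto simp: T_def W_def R_def)
      ultimately show "g \<in> (\<Union>R\<in>U. T R)" by blast
    qed
  next
    fix R assume R: "R \<in> U"
    show "finite (T R)"
      by (rule finite_subset[of _ "I \<rightarrow>\<^sub>E V \<times> V"]) (auto simp: T_def fin intro!: finite_PiE)
    have W: "card (W R k) \<le> 2 * k0 * card V" if k: "k \<in> D" for k
    proof -
      have "W R k \<subseteq> V \<times> Q k \<union> R \<times> V" by (auto simp: W_def)
      moreover have finQ: "finite (Q k)" "finite R"
        using Q k R finite_subset[OF _ finV] by (auto simp: small_def U_def)
      ultimately have "card (W R k) \<le> card (V \<times> Q k \<union> R \<times> V)" by (intro card_mono) auto
      also have "\<dots> \<le> card V * card (Q k) + card R * card V"
        using card_Un_le[of "V \<times> Q k" "R \<times> V"] by (simp add: card_cartesian_product)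
      also have "\<dots> \<le> card V * k0 + k0 * card V"
        using Q k R by (intro add_mono mult_mono) (auto simp: small_def U_def)
      finally show ?thesis by (simp add: mult.commute mult.left_commute)
    qed
    show "real (card (T R)) \<le> \<theta> ^ card D * real (card (V \<times> V)) ^ card I"
    proof (rule card_blocks_le[where Blk = "\<lambda>k. {\<iota> k}" and T = "\<lambda>k. {\<iota> k} \<rightarrow>\<^sub>E W R k"])
      show "disjoint_family_on (\<lambda>k. {\<iota> k}) D"
        using \<iota>(1) by (auto simp: disjoint_family_on_def inj_on_def)
      show "finite ({\<iota> k} \<rightarrow>\<^sub>E W R k)" for k by (intro finite_PiE) (auto simp: W_def)
      show "real (card ({\<iota> k} \<rightarrow>\<^sub>E W R k)) \<le> \<theta> * real (card (V \<times> V)) ^ card {\<iota> k}" if "k \<in> D" for k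
        using W[OF that] by (rule card_singleton_le)
    qed (use fin \<iota> in \<open>auto simp: T_def \<theta>_nonneg\<close>)
  qed
  also have "card U \<le> card (Pow V)" unfolding U_def by (intro card_mono) auto
  then have "real (card U) \<le> 2 ^ card V"
    by (simp add: card_Pow flip: of_nat_le_iff)
  then have "real (card U) * (\<theta> ^ card D * real (card (V \<times> V)) ^ card I)
      \<le> 2 ^ card V * (\<theta> ^ card D * real (card (V \<times> V)) ^ card I)"
    using \<theta>_nonneg by (intro mult_right_mono) auto
  finally show ?thesis .
qed

text \<open>
  The block \<open>P\<close> of columns of the matrix \<open>Z\<close> is typical if almost all rows are fine, whichever
  certificates are attached to however chosen \<open>d\<close> columns. Only the parts \<open>Q\<close> of certificates matter
  here.
\<close>

definition typical where
  "typical B P d t Z \<longleftrightarrow> (\<forall>D Q. D \<subseteq> P \<longrightarrow> card D = d \<longrightarrow> small D Q \<longrightarrow>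
     card {j \<in> B. \<not> fine D Q (\<lambda>k. Z (j, k))} < t)"

lemma typical_cong:
  assumes "\<And>j k. j \<in> B \<Longrightarrow> k \<in> P \<Longrightarrow> Z (j, k) = Z' (j, k)"
  shows "typical B P d t Z = typical B P d t Z'"
proof -
  have "{j \<in> B. \<not> fine D Q (\<lambda>k. Z (j, k))} = {j \<in> B. \<not> fine D Q (\<lambda>k. Z' (j, k))}" if "D \<subseteq> P" for D Q
  proof (rule Collect_cong)
    fix j
    have "fine D Q (\<lambda>k. Z (j, k)) = fine D Q (\<lambda>k. Z' (j, k))" if "j \<in> B"
      by (rule fine_cong) (use assms that \<open>D \<subseteq> P\<close> in auto)
    then show "j \<in> B \<and> \<not> fine D Q (\<lambda>k. Z (j, k)) \<longleftrightarrow> j \<in> B \<and> \<not> fine D Q (\<lambda>k. Z' (j, k))"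
      by auto
  qed
  then show ?thesis
    unfolding typical_def by (intro iff_allI imp_cong refl) simp
qed

text \<open>
  The number of choices of \<open>D\<close> and \<open>Q\<close> is exponential in \<open>card P * card V\<close> only, while \<open>t\<close> rows that
  are not fine have probability \<open>\<theta> ^ (d * t)\<close>. This is negligible if there are many more rows than
  labels.
\<close>

lemma atypical_card:
  fixes B :: "'b set" and P :: "'c set"
  assumes fin: "finite B" "finite P"
  shows "real (card {Z \<in> B \<times> P \<rightarrow>\<^sub>E V \<times> V. \<not> typical B P d t Z})
    \<le> 2 ^ card P * (2 ^ card V) ^ card P * (2 ^ card B *
        ((2 ^ card V * \<theta> ^ d) ^ t * real (card (V \<times> V)) ^ card (B \<times> P)))"
proof -
  define U where "U = Pow P \<times> (P \<rightarrow>\<^sub>E Pow V)"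
  define T where "T = (\<lambda>(D, Q). {Z \<in> B \<times> P \<rightarrow>\<^sub>E V \<times> V. D \<subseteq> P \<and> card D = d \<and> small D Q \<and>
     t \<le> card {j \<in> B. \<not> fine D Q (\<lambda>k. Z (j, k))}})"
  have finU: "finite U" unfolding U_def
    using fin by (intro finite_cartesian_product finite_PiE) auto
  have "real (card {Z \<in> B \<times> P \<rightarrow>\<^sub>E V \<times> V. \<not> typical B P d t Z})
    \<le> real (card U) * (2 ^ card B * ((2 ^ card V * \<theta> ^ d) ^ t * real (card (V \<times> V)) ^ card (B \<times> P)))"
  proof (rule card_le_sum_cover[where T = T, OF finU])
    show "{Z \<in> B \<times> P \<rightarrow>\<^sub>E V \<times> V. \<not> typical B P d t Z} \<subseteq> (\<Union>u\<in>U. T u)"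
    proof
      fix Z assume "Z \<in> {Z \<in> B \<times> P \<rightarrow>\<^sub>E V \<times> V. \<not> typical B P d t Z}"
      then obtain D Q where Z: "Z \<in> B \<times> P \<rightarrow>\<^sub>E V \<times> V" and D: "D \<subseteq> P" "card D = d" "small D Q"
        "t \<le> card {j \<in> B. \<not> fine D Q (\<lambda>k. Z (j, k))}"
        by (auto simp: typical_def not_less)
      define Q' where "Q' = (\<lambda>k\<in>P. if k \<in> D then Q k else {})"
      have "small D Q'" using D by (auto simp: small_def Q'_def)
      moreover have "fine D Q' s = fine D Q s" for s :: "'c \<Rightarrow> 'v \<times> 'v"
      proof -
        have "{k \<in> D. snd (s k) \<notin> Q' k} = {k \<in> D. snd (s k) \<notin> Q k}" using D by (auto simp: Q'_def)
        then show ?thesis by (simp add: fine_def)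
      qed
      ultimately have "Z \<in> T (D, Q')" using Z D by (simp add: T_def)
      moreover have "(D, Q') \<in> U" using D by (auto simp: U_def Q'_def small_def)
      ultimately show "Z \<in> (\<Union>u\<in>U. T u)" by blast
    qed
  next
    fix u assume u: "u \<in> U"
    obtain D Q where uDQ: "u = (D, Q)" by fastforce
    show "finite (T u)"
      by (rule finite_subset[of _ "B \<times> P \<rightarrow>\<^sub>E V \<times> V"]) (auto simp: T_def uDQ fin intro!: finite_PiE)
    show "real (card (T u)) \<le> 2 ^ card B *
        ((2 ^ card V * \<theta> ^ d) ^ t * real (card (V \<times> V)) ^ card (B \<times> P))"
    proof (cases "D \<subseteq> P \<and> card D = d \<and> small D Q")
      case False
      then have "T u = {}" unfolding T_def uDQ by auto
      then show ?thesis using \<theta>_nonneg by simp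
    next
      case True
      define R where "R = (\<lambda>j :: 'b. {g \<in> {j} \<times> P \<rightarrow>\<^sub>E V \<times> V. \<not> fine D Q (\<lambda>k. g (j, k))})"
      show ?thesis
      proof (rule card_many_bad_blocks_le[where Blk = "\<lambda>j :: 'b. {j} \<times> P" and T = R])
        show "disjoint_family_on (\<lambda>j. {j} \<times> P) B" by (auto simp: disjoint_family_on_def)
        show "finite (R j)" for j
          by (rule finite_subset[of _ "{j} \<times> P \<rightarrow>\<^sub>E V \<times> V"]) (auto simp: R_def fin intro!: finite_PiE)
        fix j assume j: "j \<in> B"
        show "real (card (R j)) \<le> 2 ^ card V * \<theta> ^ d * real (card (V \<times> V)) ^ card ({j} \<times> P)"
        proof -
          have "inj_on (\<lambda>k. (j, k)) D" "(\<lambda>k. (j, k)) ` D \<subseteq> {j} \<times> P" "finite D"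
            using True fin finite_subset by (auto simp: inj_on_def)
          then have "real (card (R j)) \<le> 2 ^ card V * (\<theta> ^ card D * real (card (V \<times> V)) ^ card ({j} \<times> P))"
            unfolding R_def using True fin by (intro nonfine_card) auto
          then show ?thesis using True by (simp add: mult.assoc)
        qed
      next
        fix g assume g: "g \<in> T u"
        have "restrict g ({j} \<times> P) \<in> R j \<longleftrightarrow> \<not> fine D Q (\<lambda>k. g (j, k))" if "j \<in> B" for j
        proof -
          have "fine D Q (\<lambda>k. restrict g ({j} \<times> P) (j, k)) = fine D Q (\<lambda>k. g (j, k))"
            using True by (intro fine_cong) auto
          moreover have "restrict g ({j} \<times> P) \<in> {j} \<times> P \<rightarrow>\<^sub>E V \<times> V"
            using g that by (auto simp: T_def uDQ)
          ultimately show ?thesis by (simp add: R_def)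
        qed
        then have "{j \<in> B. restrict g ({j} \<times> P) \<in> R j} = {j \<in> B. \<not> fine D Q (\<lambda>k. g (j, k))}"
          by blast
        then show "t \<le> card {j \<in> B. restrict g ({j} \<times> P) \<in> R j}" using g by (simp add: T_def uDQ)
      qed (use fin \<theta>_nonneg in \<open>auto simp: T_def uDQ\<close>)
    qed
  qed
  also have "real (card U) = 2 ^ card P * (2 ^ card V) ^ card P"
    using fin by (simp add: U_def card_cartesian_product card_PiE card_Pow)
  finally show ?thesis .
qed

text \<open>
  The pair of rows \<open>p\<close>, \<open>s\<close> is blocked if a proportion of at least \<open>\<theta>\<close> of the values \<open>q\<close> completes no
  red triple with them. For pairs that are not blocked, \<open>q\<close> is confined to a proportion \<open>\<theta>\<close> of
  its values in a blue set.
\<close>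

definition blocked where
  "blocked B p s \<longleftrightarrow> 2 * k0 * card V \<le> card {q \<in> V \<times> V. \<forall>j\<in>B. \<not> tri (p j) q (s j)}"

text \<open>
  A row that is blocked in \<open>d\<close> columns of a typical block is described by certificates for these
  columns, which number \<open>2 ^ (card P * (card V)\<^sup>2)\<close> or so. For given certificates at least \<open>t\<close> of the
  positions \<open>j\<close> are fine, and at those the row has only a proportion \<open>\<theta>\<close> of the values to choose
  from. Working with blocks instead of all columns at once keeps the number of certificates
  well below \<open>\<theta> ^ (-t)\<close>.
\<close>

lemma blocked_row_card:
  assumes fin: "finite B" "finite P" and B: "2 * t \<le> card B"
    and \<iota>: "inj_on \<iota> B" and Z: "\<And>j k. j \<in> B \<Longrightarrow> k \<in> P \<Longrightarrow> Z (j, k) \<in> V \<times> V"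
    and typical_P: "typical B P d t Z"
  shows "real (card {x \<in> \<iota> ` B \<rightarrow>\<^sub>E V \<times> V. d \<le> card {k \<in> P. blocked B (\<lambda>j. x (\<iota> j)) (\<lambda>j. Z (j, k))}})
    \<le> 2 ^ card P * (2 ^ card V) ^ card P * (2 ^ (card V * card V)) ^ card P *
        (\<theta> ^ t * real (card (V \<times> V)) ^ card B)"
proof -
  define U where "U = Pow P \<times> (P \<rightarrow>\<^sub>E Pow V) \<times> (P \<rightarrow>\<^sub>E (V \<rightarrow>\<^sub>E Pow V))"
  define W where "W = (\<lambda>D Q F j. {p \<in> V \<times> V. \<forall>k\<in>D. snd (Z (j, k)) \<notin> Q k \<longrightarrow>
     adj (snd p) (fst (Z (j, k))) \<longrightarrow> fst p \<in> F k (snd (Z (j, k)))})"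
  define T where "T = (\<lambda>(D, Q, F). {x \<in> \<iota> ` B \<rightarrow>\<^sub>E V \<times> V. D \<subseteq> P \<and> card D = d \<and> small D Q \<and>
     (\<forall>k\<in>D. \<forall>v\<in>V. F k v \<subseteq> V \<and> card (F k v) < k0) \<and> (\<forall>j\<in>B. x (\<iota> j) \<in> W D Q F j)})"
  define X where "X = {x \<in> \<iota> ` B \<rightarrow>\<^sub>E V \<times> V. d \<le> card {k \<in> P. blocked B (\<lambda>j. x (\<iota> j)) (\<lambda>j. Z (j, k))}}"
  have finU: "finite U" unfolding U_def
    using fin by (intro finite_cartesian_product finite_PiE) auto
  have "real (card X) \<le> real (card U) * (\<theta> ^ t * real (card (V \<times> V)) ^ card B)"
  proof (rule card_le_sum_cover[where T = T, OF finU])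
    show "X \<subseteq> (\<Union>u\<in>U. T u)"
    proof
      fix x assume "x \<in> X"
      then have x: "x \<in> \<iota> ` B \<rightarrow>\<^sub>E V \<times> V" and dP: "d \<le> card {k \<in> P. blocked B (\<lambda>j. x (\<iota> j)) (\<lambda>j. Z (j, k))}"
        by (auto simp: X_def)
      obtain D where D: "D \<subseteq> {k \<in> P. blocked B (\<lambda>j. x (\<iota> j)) (\<lambda>j. Z (j, k))}" "card D = d"
        by (rule obtain_subset_with_card_n[OF dP]) blast
      define cert where "cert = (\<lambda>k Q F. Q \<subseteq> V \<and> card Q < k0 \<and> F \<in> V \<rightarrow>\<^sub>E Pow V \<and>
        (\<forall>v\<in>V. card (F v) < k0) \<and>
        (\<forall>j\<in>B. snd (Z (j, k)) \<notin> Q \<longrightarrow> adj (snd (x (\<iota> j))) (fst (Z (j, k))) \<longrightarrow>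
          fst (x (\<iota> j)) \<in> F (snd (Z (j, k)))))"
      have "\<exists>Q F. cert k Q F" if k: "k \<in> D" for k
        unfolding cert_def
      proof (rule dead_certificate)
        show "(\<lambda>j. x (\<iota> j)) ` B \<subseteq> V \<times> V" using x by blast
        show "(\<lambda>j. Z (j, k)) ` B \<subseteq> V \<times> V" using Z D k by blast
        show "2 * k0 * card V \<le> card {q \<in> V \<times> V. \<forall>j\<in>B. \<not> tri (x (\<iota> j)) q (Z (j, k))}"
          using D k by (auto simp: blocked_def)
      qed
      then obtain Q F where cert: "\<And>k. k \<in> D \<Longrightarrow> cert k (Q k) (F k)" by metis
      note QF = cert[unfolded cert_def]
      define Q' where "Q' = (\<lambda>k\<in>P. if k \<in> D then Q k else {})"
      define F' where "F' = (\<lambda>k\<in>P. if k \<in> D then F k else (\<lambda>v\<in>V. {}))"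
      have DP: "D \<subseteq> P" using D by auto
      have "Q' \<in> P \<rightarrow>\<^sub>E Pow V" using QF by (auto simp: Q'_def)
      moreover have "F' \<in> P \<rightarrow>\<^sub>E (V \<rightarrow>\<^sub>E Pow V)"
        unfolding F'_def by (intro restrict_PiE_iff[THEN iffD2] ballI) (use QF in auto)
      ultimately have "(D, Q', F') \<in> U" using DP by (auto simp: U_def)
      moreover have "x \<in> T (D, Q', F')"
      proof -
        have eq: "Q' k = Q k" "F' k = F k" if "k \<in> D" for k using that DP by (auto simp: Q'_def F'_def)
        have "F k v \<subseteq> V" if "k \<in> D" "v \<in> V" for k v
          using QF[OF that(1)] that(2) by blast
        moreover have "x (\<iota> j) \<in> V \<times> V" if "j \<in> B" for j using x that by blast
        ultimately show ?thesis using x DP D(2) QF by (simp add: T_def small_def eq W_def)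
      qed
      ultimately show "x \<in> (\<Union>u\<in>U. T u)" by blast
    qed
  next
    fix u assume u: "u \<in> U"
    obtain D Q F where uDQ: "u = (D, Q, F)" by (metis prod.exhaust)
    show "finite (T u)"
      by (rule finite_subset[of _ "\<iota> ` B \<rightarrow>\<^sub>E V \<times> V"]) (auto simp: T_def uDQ fin intro!: finite_PiE)
    show "real (card (T u)) \<le> \<theta> ^ t * real (card (V \<times> V)) ^ card B"
    proof (cases "D \<subseteq> P \<and> card D = d \<and> small D Q \<and> (\<forall>k\<in>D. \<forall>v\<in>V. F k v \<subseteq> V \<and> card (F k v) < k0)")
      case False
      then have "T u = {}" unfolding T_def uDQ by auto
      then show ?thesis using \<theta>_nonneg by simp
    next
      case True
      have "card {j \<in> B. \<not> fine D Q (\<lambda>k. Z (j, k))} < t" using typical_P True by (auto simp: typical_def)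
      moreover have "card B = card {j \<in> B. \<not> fine D Q (\<lambda>k. Z (j, k))} + card {j \<in> B. fine D Q (\<lambda>k. Z (j, k))}"
        using fin by (subst card_Un_disjoint[symmetric]) (auto intro: arg_cong[where f = card])
      ultimately have tJ: "t \<le> card {j \<in> B. fine D Q (\<lambda>k. Z (j, k))}" using B by linarith
      obtain J where J: "J \<subseteq> {j \<in> B. fine D Q (\<lambda>k. Z (j, k))}" "card J = t"
        by (rule obtain_subset_with_card_n[OF tJ]) blast
      have "real (card (T u)) \<le> \<theta> ^ card J * real (card (V \<times> V)) ^ card (\<iota> ` B)"
      proof (rule card_blocks_le[where Blk = "\<lambda>j. {\<iota> j}" and T = "\<lambda>j. {\<iota> j} \<rightarrow>\<^sub>E W D Q F j"])
        show "finite J" by (rule finite_subset[of _ B]) (use J fin in auto)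
        show "disjoint_family_on (\<lambda>j. {\<iota> j}) J"
          using \<iota> J by (auto simp: disjoint_family_on_def inj_on_def)
        show "finite ({\<iota> j} \<rightarrow>\<^sub>E W D Q F j)" for j by (intro finite_PiE) (auto simp: W_def)
        fix j assume j: "j \<in> J"
        have "card (W D Q F j) \<le> 2 * k0 * card V" unfolding W_def
        proof (rule allowed_card)
          show "(\<lambda>k. Z (j, k)) ` D \<subseteq> V \<times> V" using Z True J j by blast
          show "k0 \<le> card ((\<lambda>k. fst (Z (j, k))) ` {k \<in> D. snd (Z (j, k)) \<notin> Q k})"
            using J j by (auto simp: fine_def)
        qed (use True in blast)
        then show "real (card ({\<iota> j} \<rightarrow>\<^sub>E W D Q F j)) \<le> \<theta> * real (card (V \<times> V)) ^ card {\<iota> j}"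
          by (rule card_singleton_le)
      qed (use fin J in \<open>auto simp: T_def uDQ \<theta>_nonneg\<close>)
      then show ?thesis using J \<iota> by (simp add: card_image)
    qed
  qed
  also have "real (card U) = 2 ^ card P * (2 ^ card V) ^ card P * (2 ^ (card V * card V)) ^ card P"
    using fin by (simp add: U_def card_cartesian_product card_PiE card_Pow power_mult)
  finally show ?thesis by (simp add: X_def)
qed

lemma blocked_cong:
  assumes "\<And>j. j \<in> B \<Longrightarrow> p j = p' j" "\<And>j. j \<in> B \<Longrightarrow> s j = s' j"
  shows "blocked B p s = blocked B p' s'"
proof -
  have "{q \<in> V \<times> V. \<forall>j\<in>B. \<not> tri (p j) q (s j)} = {q \<in> V \<times> V. \<forall>j\<in>B. \<not> tri (p' j) q (s' j)}"
    using assms by (intro Collect_cong) auto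
  then show ?thesis by (simp add: blocked_def)
qed

text \<open>
  No red triple meets all of \<open>A\<close>, \<open>B\<close>, \<open>C\<close>, for random matrices \<open>X\<close>, \<open>Y\<close>, \<open>Z\<close> on \<open>A \<times> B\<close>, \<open>A \<times> C\<close>,
  \<open>B \<times> C\<close>.
\<close>

definition edgeless where
  "edgeless A B C X Y Z \<longleftrightarrow> (\<forall>a\<in>A. \<forall>j\<in>B. \<forall>k\<in>C. \<not> tri (X (a, j)) (Y (a, k)) (Z (j, k)))"

lemma many_atypical_card:
  fixes B :: "'b set" and P :: "nat \<Rightarrow> 'c set"
  assumes fin: "finite B" "finite C" and P: "\<And>i. i < g \<Longrightarrow> P i \<subseteq> C \<and> card (P i) = l"
    and dis: "disjoint_family_on P {..<g}"
  shows "real (card {Z \<in> B \<times> C \<rightarrow>\<^sub>E V \<times> V. b \<le> card {i \<in> {..<g}. \<not> typical B (P i) d t Z}})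
    \<le> 2 ^ g * ((2 ^ l * (2 ^ card V) ^ l * (2 ^ card B * (2 ^ card V * \<theta> ^ d) ^ t)) ^ b *
        real (card (V \<times> V)) ^ card (B \<times> C))" (is "real (card ?S) \<le> _ * (?\<tau> ^ b * _)")
proof -
  define T where "T = (\<lambda>i. {Z \<in> B \<times> P i \<rightarrow>\<^sub>E V \<times> V. \<not> typical B (P i) d t Z})"
  have finP: "finite (P i)" if "i < g" for i using P[OF that] fin finite_subset by blast
  have "real (card ?S) \<le> 2 ^ card {..<g} * (?\<tau> ^ b * real (card (V \<times> V)) ^ card (B \<times> C))"
  proof (rule card_many_bad_blocks_le[where Blk = "\<lambda>i. B \<times> P i" and T = T])
    show "disjoint_family_on (\<lambda>i. B \<times> P i) {..<g}" using dis unfolding disjoint_family_on_def by blast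
    show "finite (T i)" if "i \<in> {..<g}" for i
      by (rule finite_subset[of _ "B \<times> P i \<rightarrow>\<^sub>E V \<times> V"])
        (use finP that in \<open>auto simp: T_def fin intro!: finite_PiE\<close>)
    show "real (card (T i)) \<le> ?\<tau> * real (card (V \<times> V)) ^ card (B \<times> P i)" if "i \<in> {..<g}" for i
      using atypical_card[of B "P i" d t] P finP fin that by (simp add: T_def mult.assoc)
  next
    fix Z assume Z: "Z \<in> ?S"
    have "restrict Z (B \<times> P i) \<in> T i \<longleftrightarrow> \<not> typical B (P i) d t Z" if "i < g" for i
    proof -
      have "typical B (P i) d t (restrict Z (B \<times> P i)) = typical B (P i) d t Z"
        by (rule typical_cong) auto
      moreover have "restrict Z (B \<times> P i) \<in> B \<times> P i \<rightarrow>\<^sub>E V \<times> V"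
      proof (rule restrict_PiE_iff[THEN iffD2], rule ballI)
        fix x assume "x \<in> B \<times> P i"
        then have "x \<in> B \<times> C" using P[OF that] by blast
        then show "Z x \<in> V \<times> V" by (rule PiE_mem[rotated]) (use Z in simp)
      qed
      ultimately show ?thesis by (simp add: T_def)
    qed
    then have "{i \<in> {..<g}. restrict Z (B \<times> P i) \<in> T i} = {i \<in> {..<g}. \<not> typical B (P i) d t Z}" by auto
    then show "b \<le> card {i \<in> {..<g}. restrict Z (B \<times> P i) \<in> T i}" using Z by simp
  qed (use fin P \<theta>_nonneg in \<open>auto intro!: finite_cartesian_product\<close>)
  then show ?thesis by simp
qed

text \<open>
  Row \<open>p\<close> of \<open>X\<close> is bad if it is blocked in at least \<open>d\<close> columns of some typical block.
\<close>

definition bad_row where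
  "bad_row B P g d t Z p \<longleftrightarrow> (\<exists>i<g. typical B (P i) d t Z \<and>
     d \<le> card {k \<in> P i. blocked B p (\<lambda>j. Z (j, k))})"

lemma bad_row_cong:
  assumes "\<And>j. j \<in> B \<Longrightarrow> p j = p' j"
  shows "bad_row B P g d t Z p = bad_row B P g d t Z p'"
  using blocked_cong[of B p p' "\<lambda>j. Z (j, _)" "\<lambda>j. Z (j, _)"] assms
  unfolding bad_row_def by (simp cong: conj_cong)

lemma many_bad_rows_card:
  fixes A :: "'a set" and B :: "'b set" and P :: "nat \<Rightarrow> 'c set"
  assumes fin: "finite A" "finite B" "finite C" and P: "\<And>i. i < g \<Longrightarrow> P i \<subseteq> C \<and> card (P i) = l"
    and B: "2 * t \<le> card B" and Z: "Z \<in> B \<times> C \<rightarrow>\<^sub>E V \<times> V"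
  shows "real (card {X \<in> A \<times> B \<rightarrow>\<^sub>E V \<times> V. t \<le> card {a \<in> A. bad_row B P g d t Z (\<lambda>j. X (a, j))}})
    \<le> 2 ^ card A * ((real g * (2 ^ l * (2 ^ card V) ^ l * (2 ^ (card V * card V)) ^ l * \<theta> ^ t)) ^ t *
        real (card (V \<times> V)) ^ card (A \<times> B))" (is "real (card ?S) \<le> _ * (?\<tau> ^ t * _)")
proof (rule card_many_bad_blocks_le)
  define T where "T = (\<lambda>a :: 'a. {x \<in> {a} \<times> B \<rightarrow>\<^sub>E V \<times> V. bad_row B P g d t Z (\<lambda>j. x (a, j))})"
  have finP: "finite (P i)" if "i < g" for i using P[OF that] fin finite_subset by blast
  show "disjoint_family_on (\<lambda>a :: 'a. {a} \<times> B) A" by (auto simp: disjoint_family_on_def)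
  show "finite (T a)" for a
    by (rule finite_subset[of _ "{a} \<times> B \<rightarrow>\<^sub>E V \<times> V"]) (auto simp: T_def fin intro!: finite_PiE)
  show "real (card (T a)) \<le> ?\<tau> * real (card (V \<times> V)) ^ card ({a} \<times> B)" for a
  proof -
    define U where "U = {i \<in> {..<g}. typical B (P i) d t Z}"
    define R where "R = (\<lambda>i. {x \<in> Pair a ` B \<rightarrow>\<^sub>E V \<times> V.
       d \<le> card {k \<in> P i. blocked B (\<lambda>j. x (a, j)) (\<lambda>j. Z (j, k))}})"
    have im: "Pair a ` B = {a} \<times> B" by auto
    let ?c = "2 ^ l * (2 ^ card V) ^ l * (2 ^ (card V * card V)) ^ l * (\<theta> ^ t * real (card (V \<times> V)) ^ card B)"
    have "real (card (T a)) \<le> real (card U) * ?c"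
    proof (rule card_le_sum_cover[where T = R])
      show "T a \<subseteq> (\<Union>i\<in>U. R i)" by (auto simp: T_def U_def R_def bad_row_def im)
      show "finite (R i)" for i
        by (rule finite_subset[of _ "{a} \<times> B \<rightarrow>\<^sub>E V \<times> V"]) (auto simp: R_def im fin intro!: finite_PiE)
      show "real (card (R i)) \<le> ?c" if "i \<in> U" for i
      proof -
        have "i < g" and typical_P: "typical B (P i) d t Z" using that by (auto simp: U_def)
        then have "Z (j, k) \<in> V \<times> V" if "j \<in> B" "k \<in> P i" for j k using Z P that by blast
        then have "real (card (R i)) \<le> 2 ^ card (P i) * (2 ^ card V) ^ card (P i) *
           (2 ^ (card V * card V)) ^ card (P i) * (\<theta> ^ t * real (card (V \<times> V)) ^ card B)"
          unfolding R_def
          by (intro blocked_row_card fin finP \<open>i < g\<close> B typical_P) (auto simp: inj_on_def)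
        then show ?thesis using P \<open>i < g\<close> by simp
      qed
    qed (simp add: U_def)
    also have "\<dots> \<le> real g * ?c"
    proof (rule mult_right_mono)
      have "card U \<le> card {..<g}" unfolding U_def by (intro card_mono) auto
      then show "real (card U) \<le> real g" by simp
    qed (use \<theta>_nonneg in auto)
    finally show ?thesis by (simp add: card_cartesian_product mult_ac)
  qed
  fix X assume X: "X \<in> ?S"
  have "restrict X ({a} \<times> B) \<in> T a \<longleftrightarrow> bad_row B P g d t Z (\<lambda>j. X (a, j))" if "a \<in> A" for a
  proof -
    have "bad_row B P g d t Z (\<lambda>j. restrict X ({a} \<times> B) (a, j)) = bad_row B P g d t Z (\<lambda>j. X (a, j))"
      by (rule bad_row_cong) auto
    moreover have "restrict X ({a} \<times> B) \<in> {a} \<times> B \<rightarrow>\<^sub>E V \<times> V"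
    proof (rule restrict_PiE_iff[THEN iffD2], rule ballI)
      fix x assume "x \<in> {a} \<times> B"
      then have "x \<in> A \<times> B" using that by blast
      then show "X x \<in> V \<times> V" by (rule PiE_mem[rotated]) (use X in simp)
    qed
    ultimately show ?thesis by (simp add: T_def)
  qed
  then have "{a \<in> A. restrict X ({a} \<times> B) \<in> T a} = {a \<in> A. bad_row B P g d t Z (\<lambda>j. X (a, j))}" by auto
  then show "t \<le> card {a \<in> A. restrict X ({a} \<times> B) \<in> T a}" using X by simp
qed (use fin \<theta>_nonneg in auto)

text \<open>
  After \<open>Z\<close> and \<open>X\<close> have been chosen, the pairs \<open>(a, k)\<close> that are not blocked are determined. If half
  of the blocks are typical and half of the rows are not bad, there are at least \<open>t * (b * d)\<close>
  of them, and each confines an entry of \<open>Y\<close> to a proportion \<open>\<theta>\<close> of its values.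
\<close>

lemma edgeless_column_card:
  fixes A :: "'a set" and B :: "'b set" and P :: "nat \<Rightarrow> 'c set"
  assumes fin: "finite A" "finite B" "finite C"
    and P: "\<And>i. i < 2 * b \<Longrightarrow> P i \<subseteq> C \<and> card (P i) = 2 * d" and dis: "disjoint_family_on P {..<2 * b}"
    and A: "2 * t \<le> card A"
    and Z: "card {i \<in> {..<2 * b}. \<not> typical B (P i) d t Z} < b"
    and X: "card {a \<in> A. bad_row B P (2 * b) d t Z (\<lambda>j. X (a, j))} < t"
  shows "real (card {Y \<in> A \<times> C \<rightarrow>\<^sub>E V \<times> V. edgeless A B C X Y Z})
    \<le> \<theta> ^ (t * (b * d)) * real (card (V \<times> V)) ^ card (A \<times> C)"
proof -
  define A' where "A' = {a \<in> A. \<not> bad_row B P (2 * b) d t Z (\<lambda>j. X (a, j))}"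
  define I where "I = {i \<in> {..<2 * b}. typical B (P i) d t Z}"
  define K where "K = (\<lambda>a i. {k \<in> P i. \<not> blocked B (\<lambda>j. X (a, j)) (\<lambda>j. Z (j, k))})"
  have split: "card {x \<in> S. Q x} + card {x \<in> S. \<not> Q x} = card S" if "finite S" for S :: "'x set" and Q
    using that by (subst card_Un_disjoint[symmetric]) (auto intro: arg_cong[where f = card])
  have finP: "finite (P i)" if "i \<in> I" for i using P[of i] that fin finite_subset by (auto simp: I_def)
  have A': "t \<le> card A'" using split[OF fin(1), of "\<lambda>a. bad_row B P (2 * b) d t Z (\<lambda>j. X (a, j))"] A X
    by (simp add: A'_def)
  have I: "b \<le> card I" using split[of "{..<2 * b}" "\<lambda>i. typical B (P i) d t Z"] Z by (simp add: I_def)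
  have K: "d \<le> card (K a i)" if "a \<in> A'" "i \<in> I" for a i
  proof -
    have "\<not> d \<le> card {k \<in> P i. blocked B (\<lambda>j. X (a, j)) (\<lambda>j. Z (j, k))}"
      using that by (auto simp: A'_def I_def bad_row_def)
    then show ?thesis
      using split[OF finP[OF that(2)], of "\<lambda>k. blocked B (\<lambda>j. X (a, j)) (\<lambda>j. Z (j, k))"] P that
      by (simp add: K_def I_def)
  qed
  have KU: "b * d \<le> card (\<Union>i\<in>I. K a i)" if a: "a \<in> A'" for a
  proof -
    have "b * d \<le> card I * d" using I by simp
    also have "\<dots> = (\<Sum>i\<in>I. d)" by simp
    also have "\<dots> \<le> (\<Sum>i\<in>I. card (K a i))" using K[OF a] by (intro sum_mono) auto
    also have "\<dots> = card (\<Union>i\<in>I. K a i)"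
    proof (rule card_UN_disjoint[symmetric])
      show "\<forall>i\<in>I. \<forall>j\<in>I. i \<noteq> j \<longrightarrow> K a i \<inter> K a j = {}"
        using dis unfolding disjoint_family_on_def K_def I_def by blast
    qed (use finP in \<open>auto simp: I_def K_def\<close>)
    finally show ?thesis .
  qed
  define J where "J = (SIGMA a:A'. \<Union>i\<in>I. K a i)"
  have "t * (b * d) \<le> card A' * (b * d)" using A' by simp
  also have "\<dots> = (\<Sum>a\<in>A'. b * d)" by simp
  also have "\<dots> \<le> (\<Sum>a\<in>A'. card (\<Union>i\<in>I. K a i))" using KU by (intro sum_mono) auto
  also have "\<dots> = card J"
    unfolding J_def by (rule card_SigmaI[symmetric]) (use fin finP in \<open>auto simp: A'_def I_def K_def\<close>)
  finally have tJ: "t * (b * d) \<le> card J" .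
  obtain J' where J': "J' \<subseteq> J" "card J' = t * (b * d)"
    by (rule obtain_subset_with_card_n[OF tJ]) blast
  have J'sub: "J' \<subseteq> A \<times> C" using J' P by (fastforce simp: J_def A'_def K_def I_def)
  define W where "W = (\<lambda>(a, k). {q \<in> V \<times> V. \<forall>j\<in>B. \<not> tri (X (a, j)) q (Z (j, k))})"
  have "real (card {Y \<in> A \<times> C \<rightarrow>\<^sub>E V \<times> V. edgeless A B C X Y Z})
    \<le> \<theta> ^ card J' * real (card (V \<times> V)) ^ card (A \<times> C)"
  proof (rule card_blocks_le[where Blk = "\<lambda>x. {x}" and T = "\<lambda>x. {x} \<rightarrow>\<^sub>E W x"])
    show "finite J'" using J'sub fin finite_subset by blast
    show "disjoint_family_on (\<lambda>x. {x}) J'" by (auto simp: disjoint_family_on_def)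
    show "finite ({x} \<rightarrow>\<^sub>E W x)" for x by (intro finite_PiE) (auto simp: W_def split: prod.splits)
    show "real (card ({x} \<rightarrow>\<^sub>E W x)) \<le> \<theta> * real (card (V \<times> V)) ^ card {x}" if "x \<in> J'" for x
    proof (rule card_singleton_le)
      have "x \<in> J" using that J' by blast
      then show "card (W x) \<le> 2 * k0 * card V"
        by (auto simp: J_def K_def W_def blocked_def not_le)
    qed
    fix Y x assume Y: "Y \<in> {Y \<in> A \<times> C \<rightarrow>\<^sub>E V \<times> V. edgeless A B C X Y Z}" and x: "x \<in> J'"
    obtain a k where xak: "x = (a, k)" "a \<in> A" "k \<in> C" using x J'sub by blast
    then have "Y x \<in> V \<times> V" using Y by blast
    then have "Y x \<in> W x" using Y xak by (simp add: W_def edgeless_def)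
    then show "restrict Y {x} \<in> {x} \<rightarrow>\<^sub>E W x" by auto
  qed (use fin J'sub \<theta>_nonneg in auto)
  then show ?thesis using J' by simp
qed

text \<open>
  The summands bound the probabilities that \<open>b\<close> of the \<open>2 * b\<close> blocks are atypical, that \<open>t\<close> of the
  rows are bad although only typical blocks are considered, and that there is no red triple
  although neither of this happens.
\<close>

definition \<delta> :: "nat \<Rightarrow> nat \<Rightarrow> nat \<Rightarrow> nat \<Rightarrow> real" where
  "\<delta> r t b d =
     2 ^ (2 * b) * (2 ^ (2 * d) * (2 ^ card V) ^ (2 * d) * (2 ^ r * (2 ^ card V * \<theta> ^ d) ^ t)) ^ b +
     2 ^ r * (real (2 * b) * (2 ^ (2 * d) * (2 ^ card V) ^ (2 * d) * (2 ^ (card V * card V)) ^ (2 * d) * \<theta> ^ t)) ^ t +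
     \<theta> ^ (t * (b * d))"

lemma edgeless_card:
  fixes A :: "'a set" and B :: "'b set" and P :: "nat \<Rightarrow> 'c set"
  assumes fin: "finite A" "finite B" "finite C"
    and P: "\<And>i. i < 2 * b \<Longrightarrow> P i \<subseteq> C \<and> card (P i) = 2 * d" and dis: "disjoint_family_on P {..<2 * b}"
    and A: "card A = r" "card B = r" "2 * t \<le> r"
  shows "real (card {(Z, X, Y). Z \<in> B \<times> C \<rightarrow>\<^sub>E V \<times> V \<and> X \<in> A \<times> B \<rightarrow>\<^sub>E V \<times> V \<and>
      Y \<in> A \<times> C \<rightarrow>\<^sub>E V \<times> V \<and> edgeless A B C X Y Z})
    \<le> \<delta> r t b d * real (card (V \<times> V)) ^ (card (B \<times> C) + card (A \<times> B) + card (A \<times> C))"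
proof -
  define FZ where "FZ = (B \<times> C \<rightarrow>\<^sub>E V \<times> V)"
  define FX where "FX = (A \<times> B \<rightarrow>\<^sub>E V \<times> V)"
  define FY where "FY = (A \<times> C \<rightarrow>\<^sub>E V \<times> V)"
  define M where "M = real (card (V \<times> V))"
  have finF: "finite FZ" "finite FX" "finite FY"
    unfolding FZ_def FX_def FY_def using fin by (auto intro!: finite_PiE)
  have cardF: "real (card FZ) = M ^ card (B \<times> C)" "real (card FX) = M ^ card (A \<times> B)"
    "real (card FY) = M ^ card (A \<times> C)"
    unfolding FZ_def FX_def FY_def M_def using fin by (simp_all add: card_PiE)
  define W1 where "W1 = {Z \<in> FZ. b \<le> card {i \<in> {..<2 * b}. \<not> typical B (P i) d t Z}}"
  define W2 where "W2 = (\<lambda>Z. {X \<in> FX. t \<le> card {a \<in> A. bad_row B P (2 * b) d t Z (\<lambda>j. X (a, j))}})"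
  define W3 where "W3 = (\<lambda>Z X. {Y \<in> FY. edgeless A B C X Y Z})"
  define \<delta>1 where "\<delta>1 = 2 ^ (2 * b) * (2 ^ (2 * d) * (2 ^ card V) ^ (2 * d) * (2 ^ r * (2 ^ card V * \<theta> ^ d) ^ t)) ^ b"
  define \<delta>2 where "\<delta>2 = 2 ^ r * (real (2 * b) * (2 ^ (2 * d) * (2 ^ card V) ^ (2 * d) * (2 ^ (card V * card V)) ^ (2 * d) * \<theta> ^ t)) ^ t"
  define \<delta>3 where "\<delta>3 = \<theta> ^ (t * (b * d))"
  have b1: "real (card W1) \<le> \<delta>1 * M ^ card (B \<times> C)"
    using many_atypical_card[where b = b and d = d and t = t and P = P and g = "2 * b" and l = "2 * d", OF fin(2,3)] P dis A
    unfolding W1_def FZ_def \<delta>1_def M_def by (simp add: mult.assoc)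
  have b2: "real (card (W2 Z)) \<le> \<delta>2 * M ^ card (A \<times> B)" if "Z \<in> FZ" for Z
    using many_bad_rows_card[where t = t and d = d and P = P and g = "2 * b" and l = "2 * d" and Z = Z, OF fin] P A that
    unfolding W2_def FX_def FZ_def \<delta>2_def M_def by (simp add: mult.assoc)
  have b3: "real (card (W3 Z X)) \<le> \<delta>3 * M ^ card (A \<times> C)" if "Z \<in> FZ - W1" "X \<in> FX - W2 Z" for Z X
    using edgeless_column_card[where t = t and d = d and b = b and P = P and Z = Z and X = X, OF fin P dis] A that
    unfolding W1_def W2_def W3_def FY_def \<delta>3_def M_def by (simp add: not_le)
  have \<delta>pos: "0 \<le> \<delta>2" "0 \<le> \<delta>3" using \<theta>_nonneg by (auto simp: \<delta>2_def \<delta>3_def)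
  \<comment> \<open>The matrices are exposed in the order \<open>Z\<close>, \<open>X\<close>, \<open>Y\<close>.\<close>
  define S1 where "S1 = W1 \<times> FX \<times> FY"
  define S2 where "S2 = (SIGMA Z:FZ. W2 Z \<times> FY)"
  define S3 where "S3 = (SIGMA Z:FZ - W1. SIGMA X:FX - W2 Z. W3 Z X)"
  have fin123: "finite S1" "finite S2" "finite S3"
    unfolding S1_def S2_def S3_def using finF by (auto simp: W1_def W2_def W3_def)
  have "real (card S1) = real (card W1) * (M ^ card (A \<times> B) * M ^ card (A \<times> C))"
    unfolding S1_def by (simp add: card_cartesian_product cardF)
  also have "\<dots> \<le> (\<delta>1 * M ^ card (B \<times> C)) * (M ^ card (A \<times> B) * M ^ card (A \<times> C))"
    using b1 by (intro mult_right_mono) (auto simp: M_def)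
  finally have c1: "real (card S1) \<le> \<delta>1 * (M ^ card (B \<times> C) * M ^ card (A \<times> B) * M ^ card (A \<times> C))"
    by (simp add: mult_ac)
  have "real (card S2) = (\<Sum>Z\<in>FZ. real (card (W2 Z)) * M ^ card (A \<times> C))"
    unfolding S2_def using finF by (subst card_SigmaI) (auto simp: W2_def card_cartesian_product cardF)
  also have "\<dots> \<le> (\<Sum>Z\<in>FZ. (\<delta>2 * M ^ card (A \<times> B)) * M ^ card (A \<times> C))"
    using b2 by (intro sum_mono mult_right_mono) (auto simp: M_def)
  finally have c2: "real (card S2) \<le> \<delta>2 * (M ^ card (B \<times> C) * M ^ card (A \<times> B) * M ^ card (A \<times> C))"
    by (simp add: cardF mult_ac)
  have "real (card S3) = (\<Sum>Z\<in>FZ - W1. \<Sum>X\<in>FX - W2 Z. real (card (W3 Z X)))"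
    unfolding S3_def using finF by (subst card_SigmaI; simp add: W3_def card_SigmaI)
  also have "\<dots> \<le> (\<Sum>Z\<in>FZ - W1. \<Sum>X\<in>FX - W2 Z. \<delta>3 * M ^ card (A \<times> C))"
    using b3 by (intro sum_mono) auto
  also have "\<dots> \<le> (\<Sum>Z\<in>FZ - W1. \<Sum>X\<in>FX. \<delta>3 * M ^ card (A \<times> C))"
    using finF \<delta>pos by (intro sum_mono sum_mono2) (auto simp: M_def)
  also have "\<dots> \<le> (\<Sum>Z\<in>FZ. \<Sum>X\<in>FX. \<delta>3 * M ^ card (A \<times> C))"
    using finF \<delta>pos by (intro sum_mono2) (auto simp: M_def intro!: sum_nonneg)
  finally have c3: "real (card S3) \<le> \<delta>3 * (M ^ card (B \<times> C) * M ^ card (A \<times> B) * M ^ card (A \<times> C))"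
    by (simp add: cardF mult_ac)
  have "{(Z, X, Y). Z \<in> B \<times> C \<rightarrow>\<^sub>E V \<times> V \<and> X \<in> A \<times> B \<rightarrow>\<^sub>E V \<times> V \<and>
      Y \<in> A \<times> C \<rightarrow>\<^sub>E V \<times> V \<and> edgeless A B C X Y Z} \<subseteq> S1 \<union> S2 \<union> S3" (is "?S \<subseteq> _")
    unfolding S1_def S2_def S3_def W3_def FX_def[symmetric] FY_def[symmetric] FZ_def[symmetric]
    by auto
  then have "card ?S \<le> card (S1 \<union> S2 \<union> S3)" using fin123 by (intro card_mono) auto
  also have "\<dots> \<le> card S1 + card S2 + card S3"
    using card_Un_le[of "S1 \<union> S2" S3] card_Un_le[of S1 S2] by linarith
  finally have "real (card ?S) \<le> real (card S1) + real (card S2) + real (card S3)" by linarith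
  also have "\<dots> \<le> (\<delta>1 + \<delta>2 + \<delta>3) * (M ^ card (B \<times> C) * M ^ card (A \<times> B) * M ^ card (A \<times> C))"
    using c1 c2 c3 by (simp add: distrib_right)
  finally show ?thesis by (simp add: \<delta>_def \<delta>1_def \<delta>2_def \<delta>3_def M_def power_add mult.assoc)
qed

end

section \<open>A colouring of triples\<close>

lemma card_nsets_delete:
  assumes "finite S" "card S = Suc k"
  shows "card {e \<in> [S]\<^bsup>k\<^esup>. R e} = card {x \<in> S. R (S - {x})}"
proof -
  have "{e \<in> [S]\<^bsup>k\<^esup>. R e} = (\<lambda>x. S - {x}) ` {x \<in> S. R (S - {x})}"
  proof (intro subset_antisym subsetI)
    fix e assume "e \<in> {e \<in> [S]\<^bsup>k\<^esup>. R e}"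
    then have e: "e \<subseteq> S" "finite e" "card e = k" "R e" by (auto simp: nsets_def)
    then have "card (S - e) = 1" using assms by (simp add: card_Diff_subset)
    then obtain x where "S - e = {x}" by (auto simp: card_1_singleton_iff)
    then have "x \<in> S" "e = S - {x}" using e by auto
    then show "e \<in> (\<lambda>x. S - {x}) ` {x \<in> S. R (S - {x})}" using e by auto
  qed (use assms in \<open>auto simp: nsets_def\<close>)
  also have "card \<dots> = card {x \<in> S. R (S - {x})}"
    by (intro card_image inj_onI) blast
  finally show ?thesis .
qed

lemma obtain_smallest_elements:
  fixes S :: "nat set"
  assumes "finite S" "r \<le> card S"
  shows "\<exists>A\<subseteq>S. card A = r \<and> (\<forall>a\<in>A. \<forall>s\<in>S - A. a < s)"
  using assms(2)
proof (induction r)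
  case 0 then show ?case by (intro exI[of _ "{}"]) auto
next
  case (Suc r)
  then obtain A where A: "A \<subseteq> S" "card A = r" "\<forall>a\<in>A. \<forall>s\<in>S - A. a < s" by auto
  have finA: "finite A" using A assms finite_subset by blast
  have ne: "S - A \<noteq> {}" using Suc.prems A finA by (metis Diff_eq_empty_iff card_mono not_less_eq_eq)
  define x where "x = Min (S - A)"
  have x: "x \<in> S - A" "\<And>s. s \<in> S - A \<Longrightarrow> x \<le> s"
    using ne assms Min_in[of "S - A"] by (auto simp: x_def)
  have "x < s" if "s \<in> S - insert x A" for s using x(2)[of s] that by (auto simp: le_less)
  then show ?case using A x finA by (intro exI[of _ "insert x A"]) auto
qed

lemma obtain_equal_blocks:
  assumes "finite C" "card C = g * l"
  shows "\<exists>P. (\<forall>i<g. P i \<subseteq> C \<and> card (P i) = l) \<and> disjoint_family_on P {..<g :: nat}"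
proof -
  obtain h where h: "bij_betw h {0..<g * l} C"
    using ex_bij_betw_nat_finite[OF assms(1)] assms(2) by auto
  define P where "P = (\<lambda>i. h ` {i * l..<Suc i * l})"
  have sub: "{i * l..<Suc i * l} \<subseteq> {0..<g * l}" if "i < g" for i
    using mult_le_mono1[of "Suc i" g l] that by auto
  have inj: "inj_on h {0..<g * l}" "h ` {0..<g * l} = C" using h by (auto simp: bij_betw_def)
  have "P i \<subseteq> C \<and> card (P i) = l" if "i < g" for i
  proof
    show "P i \<subseteq> C" unfolding P_def inj(2)[symmetric] by (intro image_mono sub that)
    show "card (P i) = l" unfolding P_def using inj_on_subset[OF inj(1) sub[OF that]] by (simp add: card_image)
  qed
  moreover have "P i \<inter> P j = {}" if "i < g" "j < g" "i < j" for i j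
  proof -
    have "{i * l..<Suc i * l} \<inter> {j * l..<Suc j * l} = {}"
      using mult_le_mono1[of "Suc i" j l] that by auto
    moreover have "P i \<inter> P j = h ` ({i * l..<Suc i * l} \<inter> {j * l..<Suc j * l})"
      unfolding P_def by (rule inj_on_image_Int[OF inj(1) sub[OF that(1)] sub[OF that(2)], symmetric])
    ultimately show ?thesis by (simp only: image_empty)
  qed
  ultimately show ?thesis
    unfolding disjoint_family_on_def by (metis Int_commute lessThan_iff linorder_neqE_nat)
qed

context expander begin

text \<open>
  The set \<open>S\<close> is cut into three consecutive parts \<open>A\<close>, \<open>B\<close>, \<open>C\<close> of equal size, and only triples with
  one point in each part are used. The labels involved form three independent matrices.
\<close>

lemma independent_card:
  assumes S: "S \<subseteq> {..<N}" "card S = 3 * r" and r: "r = 2 * t" "r = (2 * b) * (2 * d)"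
  shows "real (card {f \<in> {..<N} \<times> {..<N} \<rightarrow>\<^sub>E V \<times> V.
      \<not> (\<exists>a\<in>S. \<exists>j\<in>S. \<exists>k\<in>S. a < j \<and> j < k \<and> tri (f (a, j)) (f (a, k)) (f (j, k)))})
    \<le> \<delta> r t b d * real (card (V \<times> V)) ^ (N * N)" (is "real (card ?F) \<le> _")
proof -
  have finS: "finite S" using S finite_subset by blast
  obtain A where A: "A \<subseteq> S" "card A = r" "\<forall>a\<in>A. \<forall>s\<in>S - A. a < s"
    using obtain_smallest_elements[OF finS, of r] S by auto
  have finA: "finite A" using A finS finite_subset by blast
  then have "card (S - A) = 2 * r" using A S by (simp add: card_Diff_subset)
  then obtain B where B: "B \<subseteq> S - A" "card B = r" "\<forall>a\<in>B. \<forall>s\<in>S - A - B. a < s"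
    using obtain_smallest_elements[of "S - A" r] finS by auto
  have finB: "finite B" using B finS finite_subset by blast
  define C where "C = S - A - B"
  have finC: "finite C" and cardC: "card C = (2 * b) * (2 * d)"
    using \<open>card (S - A) = 2 * r\<close> B finB finS r by (auto simp: C_def card_Diff_subset)
  obtain P where P: "\<And>i. i < 2 * b \<Longrightarrow> P i \<subseteq> C \<and> card (P i) = 2 * d" "disjoint_family_on P {..<2 * b}"
    using obtain_equal_blocks[OF finC cardC] by blast
  have sub: "A \<subseteq> {..<N}" "B \<subseteq> {..<N}" "C \<subseteq> {..<N}" using A B S by (auto simp: C_def)
  have dis: "A \<inter> B = {}" "A \<inter> C = {}" "B \<inter> C = {}" using B by (auto simp: C_def)
  define I where "I = B \<times> C \<union> A \<times> B \<union> A \<times> C"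
  define N2 where "N2 = {..<N} \<times> {..<N}"
  define M where "M = real (card (V \<times> V))"
  define E where "E = {(Z, X, Y). Z \<in> B \<times> C \<rightarrow>\<^sub>E V \<times> V \<and> X \<in> A \<times> B \<rightarrow>\<^sub>E V \<times> V \<and>
      Y \<in> A \<times> C \<rightarrow>\<^sub>E V \<times> V \<and> edgeless A B C X Y Z}"
  define \<Phi> where "\<Phi> = (\<lambda>f :: nat \<times> nat \<Rightarrow> 'v \<times> 'v. ((restrict f (B \<times> C), restrict f (A \<times> B), restrict f (A \<times> C)),
     restrict f (N2 - I)))"
  have IN: "I \<subseteq> N2" using sub by (auto simp: I_def N2_def)
  have cardI: "card I = card (B \<times> C) + card (A \<times> B) + card (A \<times> C)"
  proof -
    have "card I = card (B \<times> C \<union> A \<times> B) + card (A \<times> C)"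
      unfolding I_def using finA finB finC dis by (intro card_Un_disjoint) auto
    also have "card (B \<times> C \<union> A \<times> B) = card (B \<times> C) + card (A \<times> B)"
      using finA finB finC dis by (intro card_Un_disjoint) auto
    finally show ?thesis .
  qed
  have finE: "finite E"
    by (rule finite_subset[of _ "(B \<times> C \<rightarrow>\<^sub>E V \<times> V) \<times> (A \<times> B \<rightarrow>\<^sub>E V \<times> V) \<times> (A \<times> C \<rightarrow>\<^sub>E V \<times> V)"])
      (use finA finB finC in \<open>auto simp: E_def intro!: finite_cartesian_product finite_PiE\<close>)
  have finN2: "finite N2" by (simp add: N2_def)
  have "inj_on \<Phi> ?F"
  proof (rule inj_onI)
    fix f h assume f: "f \<in> ?F" and h: "h \<in> ?F" and eq: "\<Phi> f = \<Phi> h"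
    show "f = h"
    proof (rule PiE_ext)
      show "f \<in> N2 \<rightarrow>\<^sub>E V \<times> V" "h \<in> N2 \<rightarrow>\<^sub>E V \<times> V" using f h by (auto simp: N2_def)
      fix x assume "x \<in> N2"
      then consider "x \<in> B \<times> C" | "x \<in> A \<times> B" | "x \<in> A \<times> C" | "x \<in> N2 - I"
        by (auto simp: I_def)
      then show "f x = h x"
      proof cases
        case 1
        have "fst (fst (\<Phi> f)) x = fst (fst (\<Phi> h)) x" using eq by simp
        then show ?thesis using 1 by (simp add: \<Phi>_def)
      next
        case 2
        have "fst (snd (fst (\<Phi> f))) x = fst (snd (fst (\<Phi> h))) x" using eq by simp
        then show ?thesis using 2 by (simp add: \<Phi>_def)
      next
        case 3
        have "snd (snd (fst (\<Phi> f))) x = snd (snd (fst (\<Phi> h))) x" using eq by simp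
        then show ?thesis using 3 by (simp add: \<Phi>_def)
      next
        case 4
        have "snd (\<Phi> f) x = snd (\<Phi> h) x" using eq by simp
        then show ?thesis using 4 by (simp add: \<Phi>_def)
      qed
    qed
  qed
  moreover have "\<Phi> ` ?F \<subseteq> E \<times> (N2 - I \<rightarrow>\<^sub>E V \<times> V)"
  proof (rule image_subsetI)
    fix f assume f: "f \<in> ?F"
    have fPi: "f \<in> N2 \<rightarrow>\<^sub>E V \<times> V" using f by (auto simp: N2_def)
    have res: "restrict f J \<in> J \<rightarrow>\<^sub>E V \<times> V" if "J \<subseteq> N2" for J
      using fPi that by (auto intro!: restrict_PiE_iff[THEN iffD2])
    have ABC: "a \<in> S \<and> j \<in> S \<and> k \<in> S \<and> a < j \<and> j < k" if "a \<in> A" "j \<in> B" "k \<in> C" for a j k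
      using that A B by (auto simp: C_def)
    have "edgeless A B C (restrict f (A \<times> B)) (restrict f (A \<times> C)) (restrict f (B \<times> C))"
      unfolding edgeless_def
    proof (intro ballI)
      fix a j k assume "a \<in> A" "j \<in> B" "k \<in> C"
      then show "\<not> tri (restrict f (A \<times> B) (a, j)) (restrict f (A \<times> C) (a, k)) (restrict f (B \<times> C) (j, k))"
        using f ABC[of a j k] by auto
    qed
    then show "\<Phi> f \<in> E \<times> (N2 - I \<rightarrow>\<^sub>E V \<times> V)"
      using res IN by (simp add: \<Phi>_def E_def I_def)
  qed
  moreover have "finite (E \<times> (N2 - I \<rightarrow>\<^sub>E V \<times> V))"
    using finE finN2 by (intro finite_cartesian_product finite_PiE) auto
  ultimately have "card ?F \<le> card (E \<times> (N2 - I \<rightarrow>\<^sub>E V \<times> V))" by (rule card_inj_on_le)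
  also have "\<dots> = card E * card (V \<times> V) ^ card (N2 - I)"
    using finN2 by (simp only: card_cartesian_product[of E]) (simp add: card_PiE)
  finally have "real (card ?F) \<le> real (card E) * M ^ card (N2 - I)"
    by (simp add: M_def flip: of_nat_le_iff[where ?'a = real])
  also have "\<dots> \<le> (\<delta> r t b d * M ^ card I) * M ^ card (N2 - I)"
  proof (rule mult_right_mono)
    show "real (card E) \<le> \<delta> r t b d * M ^ card I"
      unfolding cardI E_def M_def using A(2) B(2) r(1)
      by (intro edgeless_card[where P = P] finA finB finC P) simp_all
  qed (simp add: M_def)
  also have "\<dots> = \<delta> r t b d * M ^ (card I + card (N2 - I))" by (simp add: power_add)
  also have "card I + card (N2 - I) = N * N"
    using card_mono[OF finN2 IN] finite_subset[OF IN finN2] IN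
    by (simp add: card_Diff_subset) (simp add: N2_def card_cartesian_product)
  finally show ?thesis by (simp add: M_def)
qed

lemma exists_labelling:
  assumes r: "r = 2 * t" "r = (2 * b) * (2 * d)" and \<delta>: "real N ^ (3 * r) * \<delta> r t b d < 1"
  shows "\<exists>f \<in> {..<N} \<times> {..<N} \<rightarrow> V \<times> V. \<forall>S \<subseteq> {..<N}. card S = 3 * r \<longrightarrow>
     (\<exists>a\<in>S. \<exists>j\<in>S. \<exists>k\<in>S. a < j \<and> j < k \<and> tri (f (a, j)) (f (a, k)) (f (j, k)))"
proof -
  define hit where "hit = (\<lambda>(f :: nat \<times> nat \<Rightarrow> 'v \<times> 'v) S.
     \<exists>a\<in>S. \<exists>j\<in>S. \<exists>k\<in>S. a < j \<and> j < k \<and> tri (f (a, j)) (f (a, k)) (f (j, k)))"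
  define F where "F = {..<N} \<times> {..<N} \<rightarrow>\<^sub>E V \<times> V"
  define U where "U = {S. S \<subseteq> {..<N} \<and> card S = 3 * r}"
  define T where "T = (\<lambda>S. {f \<in> F. \<not> hit f S})"
  have "\<exists>f\<in>F. \<forall>S\<in>U. hit f S"
  proof (rule ccontr)
    assume "\<not> ?thesis"
    then have cover: "F \<subseteq> (\<Union>S\<in>U. T S)" unfolding T_def by blast
    have finF: "finite F" by (auto simp: F_def intro!: finite_PiE)
    have \<delta>0: "0 \<le> \<delta> r t b d" using \<theta>_nonneg by (simp add: \<delta>_def)
    from cover have "real (card F) \<le> real (card U) * (\<delta> r t b d * real (card (V \<times> V)) ^ (N * N))"
    proof (rule card_le_sum_cover[rotated])
      fix S assume "S \<in> U"
      then show "real (card (T S)) \<le> \<delta> r t b d * real (card (V \<times> V)) ^ (N * N)"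
        unfolding T_def F_def hit_def using r by (intro independent_card) (auto simp: U_def)
    qed (use finF in \<open>auto simp: U_def T_def\<close>)
    also have "card U = N choose (3 * r)" using n_subsets[of "{..<N}" "3 * r"] by (simp add: U_def)
    also have "real (N choose (3 * r)) * (\<delta> r t b d * real (card (V \<times> V)) ^ (N * N))
       \<le> real N ^ (3 * r) * (\<delta> r t b d * real (card (V \<times> V)) ^ (N * N))"
    proof (rule mult_right_mono)
      have "N choose (3 * r) \<le> N ^ (3 * r)" using binomial_le_pow[of "3 * r" N] by (cases "3 * r \<le> N") (auto simp: binomial_eq_0)
      then show "real (N choose (3 * r)) \<le> real N ^ (3 * r)" by (simp flip: of_nat_power)
    qed (use \<delta>0 in auto)
    also have "\<dots> < real (card (V \<times> V)) ^ (N * N)"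
      using mult_strict_right_mono[OF \<delta>, of "real (card (V \<times> V)) ^ (N * N)"] card_V_pos
      by (simp add: card_cartesian_product mult.assoc)
    finally show False by (simp add: F_def card_PiE card_cartesian_product)
  qed
  then obtain f where f: "f \<in> F" "\<And>S. S \<in> U \<Longrightarrow> hit f S" by blast
  show ?thesis
  proof (intro bexI[of _ f] allI impI)
    show "f \<in> {..<N} \<times> {..<N} \<rightarrow> V \<times> V" using f(1) by (simp add: F_def PiE_def)
    fix S assume "S \<subseteq> {..<N}" "card S = 3 * r"
    then have "hit f S" by (intro f(2)) (simp add: U_def)
    then show "\<exists>a\<in>S. \<exists>j\<in>S. \<exists>k\<in>S. a < j \<and> j < k \<and> tri (f (a, j)) (f (a, k)) (f (j, k))"
      by (simp only: hit_def)
  qed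
qed

text \<open>
  Three red triples among four points have a point \<open>w\<close> in common, and the labels that \<open>w\<close> gives to
  the three others are pairwise adjacent.
\<close>

lemma not_eh_arrow_3:
  assumes r: "r = 2 * t" "r = (2 * b) * (2 * d)" and \<delta>: "real N ^ (3 * r) * \<delta> r t b d < 1"
    and triangle_free: "\<And>x y z. x \<in> V \<Longrightarrow> y \<in> V \<Longrightarrow> z \<in> V \<Longrightarrow> adj x y \<Longrightarrow> adj x z \<Longrightarrow> adj y z \<Longrightarrow> False"
  shows "\<not> eh_arrow 3 3 (3 * r) N"
proof
  assume arrow: "eh_arrow 3 3 (3 * r) N"
  obtain f where f: "f \<in> {..<N} \<times> {..<N} \<rightarrow> V \<times> V"
    and edge: "\<And>S. S \<subseteq> {..<N} \<Longrightarrow> card S = 3 * r \<Longrightarrow>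
     (\<exists>a\<in>S. \<exists>j\<in>S. \<exists>k\<in>S. a < j \<and> j < k \<and> tri (f (a, j)) (f (a, k)) (f (j, k)))"
    using exists_labelling[OF r \<delta>] by blast
  define lab where "lab = (\<lambda>u v. if u < v then fst (f (u, v)) else snd (f (v, u)))"
  define \<chi> where "\<chi> = (\<lambda>e. if \<forall>u\<in>e. \<forall>v\<in>e. \<forall>w\<in>e. u \<noteq> v \<and> u \<noteq> w \<and> v \<noteq> w \<longrightarrow> adj (lab u v) (lab u w)
     then Red else Blue)"
  have labV: "lab u v \<in> V" if "u < N" "v < N" for u v
    using f that by (fastforce simp: lab_def Pi_iff mem_Times_iff)
  consider S where "S \<in> [{..<N}]\<^bsup>(3 + 1)\<^esup>" "3 \<le> card {e \<in> [S]\<^bsup>3\<^esup>. \<chi> e = Red}"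
    | T where "T \<in> [{..<N}]\<^bsup>(3 * r)\<^esup>" "\<forall>e \<in> [T]\<^bsup>3\<^esup>. \<chi> e = Blue"
    using arrow unfolding eh_arrow_def by blast
  then show False
  proof cases
    case (1 S)
    then have S: "S \<subseteq> {..<N}" "finite S" "card S = Suc 3" by (auto simp: nsets_def)
    have "3 \<le> card {x \<in> S. \<chi> (S - {x}) = Red}"
      using 1(2) card_nsets_delete[OF S(2,3), of "\<lambda>e. \<chi> e = Red"] by simp
    then obtain R where R: "R \<subseteq> {x \<in> S. \<chi> (S - {x}) = Red}" "card R = 3" by (rule obtain_subset_with_card_n)
    then obtain p q s where pqs: "R = {p, q, s}" "p \<noteq> q" "p \<noteq> s" "q \<noteq> s" by (auto simp: card_3_iff)
    have "card (S - R) = 1" using R S finite_subset[of R S] by (subst card_Diff_subset) auto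
    then obtain w where "S - R = {w}" by (auto simp: card_1_singleton_iff)
    then have w: "w \<in> S" "w \<notin> R" by auto
    have red: "adj (lab w x) (lab w y)" if "x \<in> R" "y \<in> R" "z \<in> R" "x \<noteq> y" "x \<noteq> z" "y \<noteq> z" for x y z
    proof -
      have "\<chi> (S - {z}) = Red" using R that by auto
      moreover have "w \<in> S - {z}" "x \<in> S - {z}" "y \<in> S - {z}" "w \<noteq> x" "w \<noteq> y" using w R that by auto
      ultimately show ?thesis using that(4) unfolding \<chi>_def by (metis colour.distinct(1))
    qed
    have "p < N" "q < N" "s < N" "w < N" using R S w pqs by auto
    then show False
      using triangle_free[of "lab w p" "lab w q" "lab w s"] labV
        red[of p q s] red[of p s q] red[of q s p] pqs by auto
  next
    case (2 T)
    then have T: "T \<subseteq> {..<N}" "card T = 3 * r" by (auto simp: nsets_def)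
    then obtain a j k where ajk: "a \<in> T" "j \<in> T" "k \<in> T" "a < j" "j < k"
      and tri: "tri (f (a, j)) (f (a, k)) (f (j, k))"
      using edge by blast
    have lab: "lab a j = fst (f (a, j))" "lab j a = snd (f (a, j))" "lab a k = fst (f (a, k))"
      "lab k a = snd (f (a, k))" "lab j k = fst (f (j, k))" "lab k j = snd (f (j, k))"
      using ajk by (simp_all add: lab_def)
    have adj: "adj (lab a j) (lab a k)" "adj (lab j a) (lab j k)" "adj (lab k a) (lab k j)"
      using tri by (simp_all add: lab tri_def)
    have "\<forall>u\<in>{a, j, k}. \<forall>v\<in>{a, j, k}. \<forall>w\<in>{a, j, k}. u \<noteq> v \<and> u \<noteq> w \<and> v \<noteq> w \<longrightarrow>
        adj (lab u v) (lab u w)"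
      using adj adj[THEN adj_sym] by simp
    then have "\<chi> {a, j, k} = Red" unfolding \<chi>_def by (rule if_P)
    moreover have "{a, j, k} \<in> [T]\<^bsup>3\<^esup>" using ajk by (auto simp: nsets_def)
    ultimately show False using 2 by auto
  qed
qed

end

lemma two_power_half_power_le:
  assumes "i + 2 \<le> j"
  shows "(2::real) ^ i * (1 / 2) ^ j \<le> 1 / 4"
proof -
  have "(2::real) ^ i * (1 / 2) ^ j = (1 / 2) ^ (j - i)"
    using assms by (simp add: power_one_over power_diff field_simps)
  also have "\<dots> \<le> (1 / 2) ^ 2" using assms by (intro power_decreasing) auto
  finally show ?thesis by (simp add: power2_eq_square)
qed

lemma collect_powers_of_two:
  fixes t :: real
  shows "2 ^ a * (2 ^ b * (2 ^ v) ^ c * (2 ^ d * (2 ^ v * t ^ x) ^ y)) ^ z =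
      2 ^ (a + (b + v * c + d + v * y) * z) * t ^ (y * (z * x))"
    and "2 ^ a * (2 ^ g * (2 ^ b * (2 ^ v) ^ c * (2 ^ w) ^ c * t)) ^ z =
      2 ^ (a + (g + b + v * c + w * c) * z) * t ^ z"
  by (simp_all add: power_mult_distrib power_add algebra_simps flip: power_mult)

context expander begin

text \<open>
  Each third of the blue set has \<open>r = 128 * m\<^sup>3\<close> points; the third that serves as set of columns
  falls into \<open>8 * m\<^sup>2\<close> blocks of \<open>16 * m\<close> columns. With \<open>16 * m\<close> columns, the exponent \<open>h * d * t\<close> of
  an atypical block exceeds the \<open>m * t\<close> bits for the sets of labels missed by its rows; with \<open>128 * m\<^sup>3\<close> rows, the exponent
  \<open>h * t\<close> of a bad row exceeds the \<open>16 * m * m\<^sup>2\<close> bits or so for certificates. All three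
  probabilities are then at most \<open>2\<close> to the power \<open>- 2048 * h * m ^ 6\<close>, up to exponents without the
  factor \<open>h\<close>, against \<open>2 ^ (768 * h * m ^ 6)\<close> choices of the set.
\<close>

lemma \<delta>_small:
  assumes V: "card V = m" and \<theta>: "\<theta> \<le> (1 / 2) ^ h" and h: "2 \<le> h" and m: "200 \<le> m"
  shows "real (2 ^ (2 * h * m ^ 3)) ^ (3 * (128 * m ^ 3)) * \<delta> (128 * m ^ 3) (64 * m ^ 3) (4 * m ^ 2) (8 * m) < 1"
proof -
  define N where "N = (2::real) ^ (768 * (h * m ^ 6))"
  have N: "real (2 ^ (2 * h * m ^ 3)) ^ (3 * (128 * m ^ 3)) = N"
  proof -
    have "(2 * h * m ^ 3) * (3 * (128 * m ^ 3)) = 768 * (h * m ^ 6)"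
      by (simp add: algebra_simps flip: power_add)
    then show ?thesis by (simp add: N_def flip: power_mult)
  qed
  have \<theta>p: "\<theta> ^ x \<le> (1 / 2) ^ (h * x)" for x
    using power_mono[OF \<theta> \<theta>_nonneg, of x] by (simp add: power_mult)
  have mm: "m ^ 2 \<le> m ^ 5" "m ^ 3 \<le> m ^ 5" "m ^ 4 \<le> m ^ 5" "1 \<le> m ^ 2" "200 * m ^ 5 \<le> m ^ 6" "2 * m ^ 6 \<le> h * m ^ 6"
    using m h by (auto intro!: power_increasing simp: power_add[of m 5 1, simplified])
  \<comment> \<open>The three summands of \<open>\<delta>\<close>, of which the last occurs in the estimate of the first.\<close>
  have t3: "\<theta> ^ (64 * m ^ 3 * (4 * m ^ 2 * (8 * m))) \<le> (1 / 2) ^ (2048 * (h * m ^ 6))"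
  proof -
    have "64 * m ^ 3 * (4 * m ^ 2 * (8 * m)) = 2048 * m ^ 6"
      by (simp add: power_numeral_reduce)
    moreover have "h * (2048 * m ^ 6) = 2048 * (h * m ^ 6)" by simp
    ultimately show ?thesis using \<theta>p[of "2048 * m ^ 6"] by (simp only:)
  qed
  have t1: "2 ^ (2 * (4 * m ^ 2)) * (2 ^ (2 * (8 * m)) * (2 ^ m) ^ (2 * (8 * m)) *
      (2 ^ (128 * m ^ 3) * (2 ^ m * \<theta> ^ (8 * m)) ^ (64 * m ^ 3))) ^ (4 * m ^ 2)
    \<le> 2 ^ (262 * m ^ 6) * (1 / 2) ^ (2048 * (h * m ^ 6))"
  proof -
    have "2 ^ (2 * (4 * m ^ 2)) * (2 ^ (2 * (8 * m)) * (2 ^ m) ^ (2 * (8 * m)) *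
      (2 ^ (128 * m ^ 3) * (2 ^ m * \<theta> ^ (8 * m)) ^ (64 * m ^ 3))) ^ (4 * m ^ 2)
      = 2 ^ (2 * (4 * m ^ 2) + (2 * (8 * m) + m * (2 * (8 * m)) + 128 * m ^ 3 + m * (64 * m ^ 3)) * (4 * m ^ 2)) *
        \<theta> ^ (64 * m ^ 3 * (4 * m ^ 2 * (8 * m)))"
      by (rule collect_powers_of_two(1))
    also have "\<dots> \<le> 2 ^ (2 * (4 * m ^ 2) + (2 * (8 * m) + m * (2 * (8 * m)) + 128 * m ^ 3 + m * (64 * m ^ 3)) * (4 * m ^ 2)) *
        (1 / 2) ^ (2048 * (h * m ^ 6))"
      by (intro mult_left_mono t3) auto
    also have "2 * (4 * m ^ 2) + (2 * (8 * m) + m * (2 * (8 * m)) + 128 * m ^ 3 + m * (64 * m ^ 3)) * (4 * m ^ 2)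
       = 8 * m ^ 2 + 64 * m ^ 3 + 64 * m ^ 4 + 512 * m ^ 5 + 256 * m ^ 6"
      by (simp add: power_numeral_reduce algebra_simps)
    also have "(2::real) ^ (8 * m ^ 2 + 64 * m ^ 3 + 64 * m ^ 4 + 512 * m ^ 5 + 256 * m ^ 6) \<le> 2 ^ (262 * m ^ 6)"
      using mm by (intro power_increasing) linarith+
    finally show ?thesis by simp
  qed
  have t2: "2 ^ (128 * m ^ 3) * (real (2 * (4 * m ^ 2)) * (2 ^ (2 * (8 * m)) * (2 ^ m) ^ (2 * (8 * m)) *
      (2 ^ (m * m)) ^ (2 * (8 * m)) * \<theta> ^ (64 * m ^ 3))) ^ (64 * m ^ 3)
    \<le> 2 ^ (1040 * m ^ 6) * (1 / 2) ^ (4096 * (h * m ^ 6))"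
  proof -
    have lt: "real (2 * (4 * m ^ 2)) \<le> 2 ^ (8 * m ^ 2)"
    proof -
      have "real (8 * m ^ 2) \<le> real (2 ^ (8 * m ^ 2))"
        unfolding of_nat_le_iff by (rule less_imp_le[OF less_exp])
      then show ?thesis by simp
    qed
    have "2 ^ (128 * m ^ 3) * (real (2 * (4 * m ^ 2)) * (2 ^ (2 * (8 * m)) * (2 ^ m) ^ (2 * (8 * m)) *
      (2 ^ (m * m)) ^ (2 * (8 * m)) * \<theta> ^ (64 * m ^ 3))) ^ (64 * m ^ 3)
      \<le> 2 ^ (128 * m ^ 3) * (2 ^ (8 * m ^ 2) * (2 ^ (2 * (8 * m)) * (2 ^ m) ^ (2 * (8 * m)) *
      (2 ^ (m * m)) ^ (2 * (8 * m)) * (1 / 2) ^ (h * (64 * m ^ 3)))) ^ (64 * m ^ 3)"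
      using \<theta>p[of "64 * m ^ 3"] lt \<theta>_nonneg
      by (intro mult_left_mono power_mono mult_mono) auto
    also have "\<dots> = 2 ^ (128 * m ^ 3 + (8 * m ^ 2 + 2 * (8 * m) + m * (2 * (8 * m)) + m * m * (2 * (8 * m))) * (64 * m ^ 3)) *
        ((1 / 2) ^ (h * (64 * m ^ 3))) ^ (64 * m ^ 3)"
      by (rule collect_powers_of_two(2))
    also have "((1 / 2 :: real) ^ (h * (64 * m ^ 3))) ^ (64 * m ^ 3) = (1 / 2) ^ (h * (64 * m ^ 3) * (64 * m ^ 3))"
      by (rule power_mult[symmetric])
    also have "h * (64 * m ^ 3) * (64 * m ^ 3) = 4096 * (h * m ^ 6)"
      by (simp add: power_numeral_reduce)
    also have "128 * m ^ 3 + (8 * m ^ 2 + 2 * (8 * m) + m * (2 * (8 * m)) + m * m * (2 * (8 * m))) * (64 * m ^ 3)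
       = 128 * m ^ 3 + 1536 * m ^ 5 + 1024 * m ^ 4 + 1024 * m ^ 6"
      by (simp add: power_numeral_reduce algebra_simps)
    also have "(2::real) ^ (128 * m ^ 3 + 1536 * m ^ 5 + 1024 * m ^ 4 + 1024 * m ^ 6) \<le> 2 ^ (1040 * m ^ 6)"
      using mm by (intro power_increasing) linarith+
    finally show ?thesis by simp
  qed
  have "N * \<delta> (128 * m ^ 3) (64 * m ^ 3) (4 * m ^ 2) (8 * m) \<le>
    N * (2 ^ (262 * m ^ 6) * (1 / 2) ^ (2048 * (h * m ^ 6)) +
     2 ^ (1040 * m ^ 6) * (1 / 2) ^ (4096 * (h * m ^ 6)) + (1 / 2) ^ (2048 * (h * m ^ 6)))"
    unfolding \<delta>_def V using t1 t2 t3 by (intro mult_left_mono add_mono) (auto simp: N_def)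
  also have "\<dots> = 2 ^ (768 * (h * m ^ 6) + 262 * m ^ 6) * (1 / 2) ^ (2048 * (h * m ^ 6)) +
     2 ^ (768 * (h * m ^ 6) + 1040 * m ^ 6) * (1 / 2) ^ (4096 * (h * m ^ 6)) +
     2 ^ (768 * (h * m ^ 6)) * (1 / 2) ^ (2048 * (h * m ^ 6))"
    by (simp add: N_def power_add algebra_simps)
  also have "\<dots> \<le> 1 / 4 + 1 / 4 + 1 / 4"
    using mm by (intro add_mono two_power_half_power_le) linarith+
  finally show ?thesis unfolding N by simp
qed

end

text \<open>
  As \<open>2 * 7 ^ 6 \<le> 8 ^ 6\<close>, the dimension \<open>18 * (h + 1)\<close> makes \<open>\<theta>\<close> at most \<open>2 ^ (-h)\<close>. For
  \<open>n = 384 * m\<^sup>3\<close>, the logarithm of \<open>n\<close> is of order \<open>h\<close>, so that there are \<open>2 ^ (c * n * log n)\<close> points.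
\<close>

lemma not_eh_arrow_3_explicit:
  fixes h :: nat
  assumes h: "2 \<le> h"
  defines "m \<equiv> 2 ^ (18 * (h + 1)) :: nat"
  shows "\<not> eh_arrow 3 3 (384 * m ^ 3) (2 ^ (2 * h * m ^ 3))"
proof -
  define e where "e = 6 * (h + 1)"
  have m8: "m = 8 ^ e"
  proof -
    have "(8::nat) ^ e = (2 ^ 3) ^ e" by simp
    also have "\<dots> = m" by (simp only: power_mult[symmetric] m_def e_def) (simp add: algebra_simps)
    finally show ?thesis by simp
  qed
  have cardV: "card (Pow {..<3 * e}) = m" by (simp add: card_Pow m8 power_mult)
  interpret expander "Pow {..<3 * e}" "far e" "7 ^ e"
  proof
    show "7 ^ e \<le> card (Pow {..<3 * e})" unfolding cardV m8 by (intro power_mono) auto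
    show "\<exists>x\<in>X. \<exists>y\<in>Y. far e x y"
      if "X \<subseteq> Pow {..<3 * e}" "Y \<subseteq> Pow {..<3 * e}" "7 ^ e \<le> card X" "7 ^ e \<le> card Y" for X Y
      using that by (intro far_expands) (auto simp: e_def)
  qed (auto simp: far_commute)
  \<comment> \<open>\<open>\<theta> = 2 * (7 / 8) ^ (6 * (h + 1))\<close>\<close>
  have "\<theta> \<le> (1 / 2) ^ h"
  proof -
    have "(7 :: real) ^ e = (7 ^ 6) ^ (h + 1)" by (simp only: e_def power_mult)
    then have "(2 * 7 ^ e) * 2 ^ h = (7 ^ 6 :: real) ^ (h + 1) * 2 ^ (h + 1)" by simp
    also have "\<dots> = (7 ^ 6 * 2) ^ (h + 1)" by (simp only: power_mult_distrib)
    also have "\<dots> \<le> (8 ^ 6) ^ (h + 1)" by (intro power_mono) auto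
    also have "\<dots> = real m" by (simp only: m8 e_def power_mult of_nat_power of_nat_numeral)
    finally have "(2 * 7 ^ e) * 2 ^ h \<le> real m" .
    moreover have "0 < m" by (simp add: m_def)
    ultimately show ?thesis unfolding \<theta>_def cardV by (simp add: power_one_over field_simps)
  qed
  moreover have "200 \<le> m"
  proof -
    have "(200::nat) \<le> 2 ^ 18" by simp
    also have "\<dots> \<le> m" unfolding m_def using h by (intro power_increasing) auto
    finally show ?thesis .
  qed
  ultimately have \<delta>: "real (2 ^ (2 * h * m ^ 3)) ^ (3 * (128 * m ^ 3)) *
      \<delta> (128 * m ^ 3) (64 * m ^ 3) (4 * m ^ 2) (8 * m) < 1"
    using \<delta>_small[OF cardV] h by blast
  have "\<not> eh_arrow 3 3 (3 * (128 * m ^ 3)) (2 ^ (2 * h * m ^ 3))"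
  proof (rule not_eh_arrow_3[OF _ _ \<delta>])
    show "128 * m ^ 3 = 2 * (4 * m ^ 2) * (2 * (8 * m))" by (simp add: power_numeral_reduce)
    show False if "x \<in> Pow {..<3 * e}" "y \<in> Pow {..<3 * e}" "z \<in> Pow {..<3 * e}"
      "far e x y" "far e x z" "far e y z" for x y z
      using far_triangle_free[of x e y z] that by auto
  qed simp
  then show ?thesis by simp
qed

section \<open>Binary trees of sets\<close>

text \<open>
  The sets \<open>X\<close> and \<open>Y\<close> differ at \<open>w\<close> but not above, and \<open>X\<close> comes before \<open>Y\<close> in the order of the numbers
  that they are the binary representations of.
\<close>

definition splits :: "nat \<Rightarrow> nat set \<Rightarrow> nat set \<Rightarrow> bool" where
  "splits w X Y \<longleftrightarrow> w \<notin> X \<and> w \<in> Y \<and> (\<forall>i>w. i \<in> X \<longleftrightarrow> i \<in> Y)"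

lemma splitsD:
  assumes "splits w X Y"
  shows "w \<notin> X" "w \<in> Y" "w < i \<Longrightarrow> i \<in> X \<longleftrightarrow> i \<in> Y"
  using assms by (auto simp: splits_def)

lemma splits_unique:
  assumes "splits w X Y" "splits w' X Y"
  shows "w = w'"
proof -
  have "\<not> w < w'" "\<not> w' < w" using assms unfolding splits_def by blast+
  then show ?thesis by simp
qed

lemma splits_asym:
  assumes "splits w X Y"
  shows "\<not> splits w' Y X"
proof
  assume "splits w' Y X"
  then have "\<not> w < w'" "\<not> w' < w" "w \<noteq> w'" using assms unfolding splits_def by blast+
  then show False by simp
qed

lemma splits_exists:
  assumes "finite X" "finite Y" "X \<noteq> Y"
  shows "\<exists>w. splits w X Y \<or> splits w Y X"
proof -
  define w where "w = Max (sym_diff X Y)"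
  have "w \<in> sym_diff X Y" unfolding w_def using assms by (intro Max_in) auto
  moreover have "i \<in> X \<longleftrightarrow> i \<in> Y" if "w < i" for i
  proof (rule ccontr)
    assume "\<not> ?thesis"
    then have "i \<in> sym_diff X Y" by blast
    then have "i \<le> w" unfolding w_def using assms by (intro Max_ge) auto
    then show False using that by simp
  qed
  ultimately show ?thesis unfolding splits_def by (intro exI[of _ w]) blast
qed

text \<open>
  The root of the tree with leaf set \<open>A \<union> B\<close> has label \<open>w\<close>, left subtree \<open>A\<close> and right subtree \<open>B\<close>. That
  the elements of \<open>A\<close> agree from \<open>w\<close> on upwards, and those of \<open>B\<close> too, follows because they split from the
  same element of the other part at \<open>w\<close>.
\<close>

definition node :: "nat \<Rightarrow> nat set set \<Rightarrow> nat set set \<Rightarrow> bool" where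
  "node w A B \<longleftrightarrow> A \<noteq> {} \<and> B \<noteq> {} \<and> (\<forall>X\<in>A. \<forall>Y\<in>B. splits w X Y)"

definition labels :: "nat set set \<Rightarrow> nat set" where
  "labels e = {w. \<exists>X\<in>e. \<exists>Y\<in>e. splits w X Y}"

text \<open>
  A right comb is a tree in which every left subtree is a leaf. It is convenient to express this by
  subtrees with three leaves, so that it is obviously inherited by subsets; \<open>rcomb_node\<close> recovers
  the recursive description. Sets with at most two elements are both left and right combs.
\<close>

definition rcomb :: "nat set set \<Rightarrow> bool" where
  "rcomb e \<longleftrightarrow> (\<forall>X\<in>e. \<forall>Y\<in>e. \<forall>Z\<in>e. \<forall>u w. splits u X Y \<longrightarrow> splits w Y Z \<longrightarrow> w < u)"

definition lcomb :: "nat set set \<Rightarrow> bool" where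
  "lcomb e \<longleftrightarrow> (\<forall>X\<in>e. \<forall>Y\<in>e. \<forall>Z\<in>e. \<forall>u w. splits u X Y \<longrightarrow> splits w Y Z \<longrightarrow> u < w)"

text \<open>
  The additional red shape. With fewer than three leaves on the right, the left comb there would be a
  right comb as well, and deleting a leaf on the left could produce a right comb.
\<close>

definition cherry_comb :: "nat set set \<Rightarrow> bool" where
  "cherry_comb e \<longleftrightarrow> (\<exists>w A B. node w A B \<and> e = A \<union> B \<and> card A = 2 \<and> 3 \<le> card B \<and> lcomb B)"

lemma nodeD: "node w A B \<Longrightarrow> X \<in> A \<Longrightarrow> Y \<in> B \<Longrightarrow> splits w X Y"
  by (simp add: node_def)

lemma node_disjoint: "node w A B \<Longrightarrow> A \<inter> B = {}"
  using nodeD splitsD(1,2) by blast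

lemma node_agree:
  assumes "node w A B" "X \<in> A \<union> B" "Y \<in> A \<union> B" "w < i"
  shows "i \<in> X \<longleftrightarrow> i \<in> Y"
proof -
  obtain X0 Y0 where XY0: "X0 \<in> A" "Y0 \<in> B" using assms(1) by (auto simp: node_def)
  have n: "splits w S R" if "S \<in> A" "R \<in> B" for S R using assms(1) that by (auto simp: node_def)
  have "i \<in> Z \<longleftrightarrow> i \<in> X0" if Z: "Z \<in> A \<union> B" for Z
  proof (cases "Z \<in> A")
    case True
    then show ?thesis
      using splitsD(3)[OF n[OF True XY0(2)] assms(4)] splitsD(3)[OF n[OF XY0] assms(4)] by simp
  next
    case False
    then have "Z \<in> B" using Z by simp
    then show ?thesis using splitsD(3)[OF n[OF XY0(1)] assms(4)] by simp
  qed
  then show ?thesis using assms(2,3) by simp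
qed

lemma node_label_le:
  assumes "node w A B" "X \<in> A \<union> B" "Y \<in> A \<union> B" "splits u X Y"
  shows "u \<le> w"
proof (rule ccontr)
  assume "\<not> u \<le> w"
  then have "u \<in> X \<longleftrightarrow> u \<in> Y" by (intro node_agree[OF assms(1-3)]) simp
  then show False using assms(4) by (auto simp: splits_def)
qed

lemma node_label_less:
  assumes "node w A B" "X \<in> A \<and> Y \<in> A \<or> X \<in> B \<and> Y \<in> B" "splits u X Y"
  shows "u < w"
proof -
  have "u \<le> w" using node_label_le[OF assms(1) _ _ assms(3)] assms(2) by blast
  moreover have "u \<noteq> w"
  proof
    assume uw: "u = w"
    obtain X0 Y0 where "X0 \<in> A" "Y0 \<in> B" using assms(1) by (auto simp: node_def)
    then have "w \<notin> S" if "S \<in> A" for S using assms(1) that by (auto simp: node_def splits_def)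
    moreover have "w \<in> S" if "S \<in> B" for S
      using assms(1) that \<open>X0 \<in> A\<close> by (auto simp: node_def splits_def)
    ultimately show False using assms(2,3) uw unfolding splits_def by blast
  qed
  ultimately show ?thesis by simp
qed

lemma node_unique:
  assumes "node w A B" "node w' A' B'" "A \<union> B = A' \<union> B'"
  shows "A = A'" "B = B'"
proof -
  have le: "v' \<le> v" if 1: "node v C D" and 2: "node v' C' D'" and 3: "C \<union> D = C' \<union> D'" for v v' C D C' D'
  proof -
    obtain X Y where "X \<in> C'" "Y \<in> D'" "splits v' X Y" using 2 by (auto simp: node_def)
    then show ?thesis using node_label_le[OF 1, of X Y v'] 3 by auto
  qed
  have "w = w'" using le[OF assms] le[OF assms(2,1) assms(3)[symmetric]] by simp
  have parts: "{X \<in> C \<union> D. v \<notin> X} = C" "{X \<in> C \<union> D. v \<in> X} = D" if n: "node v C D" for v C D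
  proof -
    have "v \<notin> S \<and> v \<in> R" if "S \<in> C" "R \<in> D" for S R
      using splitsD(1,2)[OF nodeD[OF n that]] by simp
    moreover have "C \<noteq> {}" "D \<noteq> {}" using n by (auto simp: node_def)
    ultimately show "{X \<in> C \<union> D. v \<notin> X} = C" "{X \<in> C \<union> D. v \<in> X} = D" by blast+
  qed
  show "A = A'" "B = B'"
    using parts[OF assms(1)] parts[OF assms(2)] unfolding assms(3) \<open>w = w'\<close> by simp_all
qed

lemma node_exists:
  assumes "finite e" "2 \<le> card e" "\<And>X. X \<in> e \<Longrightarrow> finite X"
  shows "\<exists>w A B. node w A B \<and> e = A \<union> B"
proof -
  obtain X Y where XY: "X \<in> e" "Y \<in> e" "X \<noteq> Y"
    using assms(1,2) card_le_Suc0_iff_eq[of e] by auto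
  have fin: "finite (labels e)"
    by (rule finite_subset[of _ "\<Union> e"]) (use assms in \<open>auto simp: labels_def splits_def\<close>)
  have ne: "labels e \<noteq> {}" using splits_exists[of X Y] XY assms(3) by (auto simp: labels_def)
  define w where "w = Max (labels e)"
  define A where "A = {X \<in> e. w \<notin> X}"
  define B where "B = {X \<in> e. w \<in> X}"
  have "w \<in> labels e" unfolding w_def using fin ne by (rule Max_in)
  then obtain X0 Y0 where "X0 \<in> e" "Y0 \<in> e" "splits w X0 Y0" by (auto simp: labels_def)
  then have "X0 \<in> A" "Y0 \<in> B" using splitsD(1,2)[of w X0 Y0] by (auto simp: A_def B_def)
  then have "A \<noteq> {}" "B \<noteq> {}" by auto
  moreover have "splits w X Y" if "X \<in> A" "Y \<in> B" for X Y
  proof -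
    have XY: "X \<in> e" "Y \<in> e" "w \<notin> X" "w \<in> Y" using that by (auto simp: A_def B_def)
    then obtain u where u: "splits u X Y \<or> splits u Y X"
      using splits_exists[of X Y] assms(3) by auto
    then have "u \<in> labels e" using XY by (auto simp: labels_def)
    then have "u \<le> w" unfolding w_def using fin by simp
    moreover have "\<not> u < w" using u XY(3,4) splitsD(3)[of u X Y w] splitsD(3)[of u Y X w] by blast
    ultimately have "u = w" by simp
    then show ?thesis using u XY(3,4) splitsD(1)[of u Y X] by blast
  qed
  ultimately have "node w A B" by (simp add: node_def)
  moreover have "e = A \<union> B" by (auto simp: A_def B_def)
  ultimately show ?thesis by blast
qed

lemma labels_node:
  assumes "node w A B"
  shows "labels (A \<union> B) = insert w (labels A \<union> labels B)"
proof (intro subset_antisym subsetI)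
  fix u assume "u \<in> labels (A \<union> B)"
  then obtain X Y where XY: "X \<in> A \<union> B" "Y \<in> A \<union> B" "splits u X Y" by (auto simp: labels_def)
  have "u = w" if "X \<in> A" "Y \<in> B" using nodeD[OF assms that] XY(3) splits_unique by blast
  moreover have False if "Y \<in> A" "X \<in> B" using nodeD[OF assms that] XY(3) splits_asym by blast
  ultimately show "u \<in> insert w (labels A \<union> labels B)" using XY by (auto simp: labels_def)
next
  fix u assume "u \<in> insert w (labels A \<union> labels B)"
  moreover have "w \<in> labels (A \<union> B)"
    using assms by (fastforce simp: labels_def node_def)
  moreover have "labels A \<subseteq> labels (A \<union> B)" "labels B \<subseteq> labels (A \<union> B)"
    unfolding labels_def by blast+
  ultimately show "u \<in> labels (A \<union> B)" by blast
qed

lemma node_label_notin: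
  assumes "node w A B"
  shows "w \<notin> labels A" "w \<notin> labels B"
  using node_label_less[OF assms] by (auto simp: labels_def)

lemma card_1_eq: "card A = 1 \<Longrightarrow> X \<in> A \<Longrightarrow> A = {X}"
  by (metis card_1_singletonE singletonD)

lemma labels_single: "card A = 1 \<Longrightarrow> labels A = {}"
  by (auto simp: labels_def splits_def card_1_singleton_iff)

lemma rcombD: "rcomb e \<Longrightarrow> X \<in> e \<Longrightarrow> Y \<in> e \<Longrightarrow> Z \<in> e \<Longrightarrow> splits u X Y \<Longrightarrow> splits w Y Z \<Longrightarrow> w < u"
  unfolding rcomb_def by blast

lemma rcombI: "(\<And>X Y Z u w. X \<in> e \<Longrightarrow> Y \<in> e \<Longrightarrow> Z \<in> e \<Longrightarrow> splits u X Y \<Longrightarrow> splits w Y Z \<Longrightarrow> w < u) \<Longrightarrow> rcomb e"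
  unfolding rcomb_def by blast

lemma lcombD: "lcomb e \<Longrightarrow> X \<in> e \<Longrightarrow> Y \<in> e \<Longrightarrow> Z \<in> e \<Longrightarrow> splits u X Y \<Longrightarrow> splits w Y Z \<Longrightarrow> u < w"
  unfolding lcomb_def by blast

lemma lcombI: "(\<And>X Y Z u w. X \<in> e \<Longrightarrow> Y \<in> e \<Longrightarrow> Z \<in> e \<Longrightarrow> splits u X Y \<Longrightarrow> splits w Y Z \<Longrightarrow> u < w) \<Longrightarrow> lcomb e"
  unfolding lcomb_def by blast

lemma rcomb_mono: "rcomb e \<Longrightarrow> d \<subseteq> e \<Longrightarrow> rcomb d"
  by (rule rcombI) (meson rcombD subsetD)

lemma lcomb_mono: "lcomb e \<Longrightarrow> d \<subseteq> e \<Longrightarrow> lcomb d"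
  by (rule lcombI) (meson lcombD subsetD)

lemma rcomb_single: "card A = 1 \<Longrightarrow> rcomb A"
  by (auto simp: rcomb_def splits_def card_1_singleton_iff)

lemma lcomb_single: "card A = 1 \<Longrightarrow> lcomb A"
  by (auto simp: lcomb_def splits_def card_1_singleton_iff)

lemma two_elements_split:
  assumes "card A \<noteq> 1" "A \<noteq> {}" "finite A" "\<And>X. X \<in> A \<Longrightarrow> finite X"
  shows "\<exists>X\<in>A. \<exists>Y\<in>A. \<exists>u. splits u X Y"
proof -
  have "2 \<le> card A" using assms card_0_eq[of A] by linarith
  then obtain X Y where "X \<in> A" "Y \<in> A" "X \<noteq> Y"
    using assms(3) card_le_Suc0_iff_eq[of A] by auto
  then show ?thesis using splits_exists[of X Y] assms(4) by blast
qed

lemma rcomb_node: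
  assumes n: "node w A B" and fin: "finite A" "\<And>X. X \<in> A \<Longrightarrow> finite X"
  shows "rcomb (A \<union> B) \<longleftrightarrow> card A = 1 \<and> rcomb B"
proof
  assume r: "rcomb (A \<union> B)"
  have "card A = 1"
  proof (rule ccontr)
    assume *: "card A \<noteq> 1"
    have ne: "A \<noteq> {}" "B \<noteq> {}" using n by (auto simp: node_def)
    obtain X Y u where XY: "X \<in> A" "Y \<in> A" "splits u X Y"
      using two_elements_split[OF * ne(1) fin] by blast
    obtain Z where Z: "Z \<in> B" using ne by blast
    have "u < w" using node_label_less[OF n _ XY(3)] XY by blast
    moreover have "w < u"
      by (rule rcombD[OF r _ _ _ XY(3) nodeD[OF n XY(2) Z]]) (use XY Z in auto)
    ultimately show False by simp
  qed
  then show "card A = 1 \<and> rcomb B" using rcomb_mono[OF r] by blast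
next
  assume a: "card A = 1 \<and> rcomb B"
  show "rcomb (A \<union> B)"
  proof (rule rcombI)
    fix X Y Z u v assume XYZ: "X \<in> A \<union> B" "Y \<in> A \<union> B" "Z \<in> A \<union> B" and s: "splits u X Y" "splits v Y Z"
    have nA: "S \<in> B" if "R \<in> A \<union> B" "S \<in> A \<union> B" and x: "splits x R S" for R S x
    proof (rule ccontr)
      assume "S \<notin> B"
      then have S: "S \<in> A" using that by blast
      show False
      proof (cases "R \<in> A")
        case True
        then have "R = S" using a S card_1_eq[of A R] by blast
        then show False using splitsD(1,2)[OF x] by simp
      next
        case False
        then have "R \<in> B" using that by blast
        then show False using splits_asym[OF x] nodeD[OF n S] by blast
      qed
    qed
    have YZ: "Y \<in> B" "Z \<in> B" using nA[OF XYZ(1,2) s(1)] nA[OF XYZ(2,3) s(2)] by auto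
    show "v < u"
    proof (cases "X \<in> A")
      case True
      then have "u = w" using splits_unique[OF s(1) nodeD[OF n True YZ(1)]] by simp
      then show ?thesis using node_label_less[OF n _ s(2)] YZ by blast
    next
      case False
      then have "X \<in> B" using XYZ by blast
      then show ?thesis using rcombD[of B, OF _ _ YZ s] a by blast
    qed
  qed
qed

lemma lcomb_node:
  assumes n: "node w A B" and fin: "finite B" "\<And>X. X \<in> B \<Longrightarrow> finite X"
  shows "lcomb (A \<union> B) \<longleftrightarrow> card B = 1 \<and> lcomb A"
proof
  assume r: "lcomb (A \<union> B)"
  have "card B = 1"
  proof (rule ccontr)
    assume *: "card B \<noteq> 1"
    have ne: "A \<noteq> {}" "B \<noteq> {}" using n by (auto simp: node_def)
    obtain X Y u where XY: "X \<in> B" "Y \<in> B" "splits u X Y"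
      using two_elements_split[OF * ne(2) fin] by blast
    obtain Z where Z: "Z \<in> A" using ne by blast
    have "u < w" using node_label_less[OF n _ XY(3)] XY by blast
    moreover have "w < u"
      by (rule lcombD[OF r _ _ _ nodeD[OF n Z XY(1)] XY(3)]) (use XY Z in auto)
    ultimately show False by simp
  qed
  then show "card B = 1 \<and> lcomb A" using lcomb_mono[OF r] by blast
next
  assume a: "card B = 1 \<and> lcomb A"
  show "lcomb (A \<union> B)"
  proof (rule lcombI)
    fix X Y Z u v assume XYZ: "X \<in> A \<union> B" "Y \<in> A \<union> B" "Z \<in> A \<union> B" and s: "splits u X Y" "splits v Y Z"
    have nB: "R \<in> A" if "R \<in> A \<union> B" "S \<in> A \<union> B" and x: "splits x R S" for R S x
    proof (rule ccontr)
      assume "R \<notin> A"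
      then have R: "R \<in> B" using that by blast
      show False
      proof (cases "S \<in> B")
        case True
        then have "R = S" using a R card_1_eq[of B S] by blast
        then show False using splitsD(1,2)[OF x] by simp
      next
        case False
        then have "S \<in> A" using that by blast
        then show False using splits_asym[OF x] nodeD[OF n _ R] by blast
      qed
    qed
    have XY: "X \<in> A" "Y \<in> A" using nB[OF XYZ(1,2) s(1)] nB[OF XYZ(2,3) s(2)] by auto
    show "u < v"
    proof (cases "Z \<in> B")
      case True
      then have "v = w" using splits_unique[OF s(2) nodeD[OF n XY(2) True]] by simp
      then show ?thesis using node_label_less[OF n _ s(1)] XY by blast
    next
      case False
      then have "Z \<in> A" using XYZ by blast
      then show ?thesis using lcombD[of A, OF _ XY _ s] a by blast
    qed
  qed
qed

lemma cherry_comb_node: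
  assumes "node w A B"
  shows "cherry_comb (A \<union> B) \<longleftrightarrow> card A = 2 \<and> 3 \<le> card B \<and> lcomb B"
proof
  assume "cherry_comb (A \<union> B)"
  then obtain w' A' B' where *: "node w' A' B'" "A \<union> B = A' \<union> B'" "card A' = 2" "3 \<le> card B'" "lcomb B'"
    unfolding cherry_comb_def by blast
  then show "card A = 2 \<and> 3 \<le> card B \<and> lcomb B" using node_unique[OF assms *(1,2)] by simp
next
  assume "card A = 2 \<and> 3 \<le> card B \<and> lcomb B"
  then show "cherry_comb (A \<union> B)" unfolding cherry_comb_def using assms by (intro exI conjI) auto
qed

lemma rcomb_lcomb_card:
  assumes fin: "finite e" "\<And>X. X \<in> e \<Longrightarrow> finite X" and "rcomb e" "lcomb e"
  shows "card e \<le> 2"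
proof (rule ccontr)
  assume *: "\<not> ?thesis"
  then obtain w A B where n: "node w A B" and e: "e = A \<union> B" using node_exists[OF fin(1)] fin(2) by force
  have "finite A" "finite B" using fin e by auto
  moreover have "card A = 1" "card B = 1"
    using rcomb_node[OF n] lcomb_node[OF n] assms e by auto
  ultimately show False using * e card_Un_le[of A B] by simp
qed

text \<open>
  Plain trees are coloured blue, whatever the labels.
\<close>

definition plain :: "nat set set \<Rightarrow> bool" where
  "plain e \<longleftrightarrow> \<not> rcomb e \<and> \<not> lcomb e \<and> \<not> cherry_comb e"

lemma plain_node:
  assumes "node w A B" "finite A" "finite B" "\<And>X. X \<in> A \<union> B \<Longrightarrow> finite X"
  shows "plain (A \<union> B) \<longleftrightarrow> \<not> (card A = 1 \<and> rcomb B) \<and> \<not> (card B = 1 \<and> lcomb A) \<and>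
    \<not> (card A = 2 \<and> 3 \<le> card B \<and> lcomb B)"
  using assms by (simp add: plain_def rcomb_node lcomb_node cherry_comb_node)

lemma two_elements:
  assumes "2 \<le> card S" "\<And>x. x \<in> S \<Longrightarrow> Q x"
  shows "\<exists>x\<in>S. \<exists>y\<in>S. x \<noteq> y \<and> Q x \<and> Q y"
proof -
  have "finite S" using assms(1) by (intro card_ge_0_finite) linarith
  then obtain x y where "x \<in> S" "y \<in> S" "x \<noteq> y"
    using assms(1) card_le_Suc0_iff_eq[of S] by auto
  then show ?thesis using assms(2) by blast
qed

text \<open>
  That a tree is not a right comb is already visible in a subtree with three leaves, which survives
  the deletion of any other leaf.
\<close>

lemma not_rcomb_delete:
  assumes "finite e" "\<not> rcomb e"
  shows "\<exists>S\<subseteq>e. card e \<le> card S + 3 \<and> (\<forall>x\<in>S. \<not> rcomb (e - {x}))"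
proof -
  obtain X Y Z u w where t: "X \<in> e" "Y \<in> e" "Z \<in> e" "splits u X Y" "splits w Y Z" "\<not> w < u"
    using assms(2) rcombI[of e] by blast
  have "\<not> rcomb (e - {x})" if "x \<in> e - {X, Y, Z}" for x
    using rcombD[of "e - {x}" X Y Z u w] t that by blast
  moreover have "card e \<le> card (e - {X, Y, Z}) + 3"
    using card_Diff_subset[of "{X, Y, Z}" e] t card_insert_le_m1[of 3 "{Y, Z}" X] card_insert_le_m1[of 2 "{Z}" Y]
    by (auto simp: card_insert_if split: if_splits)
  ultimately show ?thesis by (intro exI[of _ "e - {X, Y, Z}"]) auto
qed

lemma not_lcomb_delete:
  assumes "finite e" "\<not> lcomb e"
  shows "\<exists>S\<subseteq>e. card e \<le> card S + 3 \<and> (\<forall>x\<in>S. \<not> lcomb (e - {x}))"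
proof -
  obtain X Y Z u w where t: "X \<in> e" "Y \<in> e" "Z \<in> e" "splits u X Y" "splits w Y Z" "\<not> u < w"
    using assms(2) lcombI[of e] by blast
  have "\<not> lcomb (e - {x})" if "x \<in> e - {X, Y, Z}" for x
    using lcombD[of "e - {x}" X Y Z u w] t that by blast
  moreover have "card e \<le> card (e - {X, Y, Z}) + 3"
    using card_Diff_subset[of "{X, Y, Z}" e] t card_insert_le_m1[of 3 "{Y, Z}" X] card_insert_le_m1[of 2 "{Z}" Y]
    by (auto simp: card_insert_if split: if_splits)
  ultimately show ?thesis by (intro exI[of _ "e - {X, Y, Z}"]) auto
qed

lemma cherry_comb_card: "cherry_comb e \<Longrightarrow> finite e \<Longrightarrow> 5 \<le> card e"
  unfolding cherry_comb_def using node_disjoint by (auto simp: card_Un_disjoint)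

text \<open>
  In each of the red shapes, one subtree of the root has one or two leaves. If both subtrees have
  more, two leaves can be deleted from the larger one. If one has two leaves, it may depend on
  whether the other is a comb from which of them leaves should be deleted. If one subtree is a leaf,
  the other, with \<open>k\<close> leaves, is not a comb of the kind that would make the whole tree a comb;
  three of its leaves witness this, and the others can be deleted. For \<open>k = 4\<close> only one
  such leaf may be left. If the subtree is a comb of the other kind, then any of its leaves will do; if
  not, the second leaf is the one at the root.
\<close>

lemma two_plain_deletions:
  assumes fin: "finite T" "\<And>X. X \<in> T \<Longrightarrow> finite X" and card: "5 \<le> card T"
    and nc: "\<not> rcomb T" "\<not> lcomb T"
  shows "\<exists>x\<in>T. \<exists>y\<in>T. x \<noteq> y \<and> plain (T - {x}) \<and> plain (T - {y})"
proof -
  obtain w A B where n: "node w A B" and T: "T = A \<union> B" using node_exists[OF fin(1)] card fin(2) by force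
  have finAB: "finite A" "finite B" using fin T by auto
  have sum: "card A + card B = card T" using card_Un_disjoint[OF finAB node_disjoint[OF n]] T by simp
  have ne: "card A \<noteq> 0" "card B \<noteq> 0" using n finAB by (auto simp: node_def)
  have delA: "plain (T - {x}) \<longleftrightarrow> \<not> (card A = 2 \<and> rcomb B) \<and> \<not> (card B = 1 \<and> lcomb (A - {x})) \<and>
      \<not> (card A = 3 \<and> 3 \<le> card B \<and> lcomb B)" if x: "x \<in> A" "card A \<noteq> 1" for x
  proof -
    have eq: "T - {x} = (A - {x}) \<union> B" using x node_disjoint[OF n] T by auto
    have "A - {x} \<noteq> {}"
    proof
      assume "A - {x} = {}"
      then have "A = {x}" using x(1) by auto
      then show False using x(2) by simp
    qed
    then have "node w (A - {x}) B" using n by (auto simp: node_def)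
    then show ?thesis unfolding eq using finAB fin T x by (subst plain_node) auto
  qed
  have delB: "plain (T - {x}) \<longleftrightarrow> \<not> (card A = 1 \<and> rcomb (B - {x})) \<and> \<not> (card B = 2 \<and> lcomb A) \<and>
      \<not> (card A = 2 \<and> 4 \<le> card B \<and> lcomb (B - {x}))" if x: "x \<in> B" "card B \<noteq> 1" for x
  proof -
    have eq: "T - {x} = A \<union> (B - {x})" using x node_disjoint[OF n] T by auto
    have "B - {x} \<noteq> {}"
    proof
      assume "B - {x} = {}"
      then have "B = {x}" using x(1) by auto
      then show False using x(2) by simp
    qed
    then have "node w A (B - {x})" using n by (auto simp: node_def)
    then show ?thesis unfolding eq using finAB fin T x by (subst plain_node) auto
  qed
  have ncAB: "\<not> (card A = 1 \<and> rcomb B)" "\<not> (card B = 1 \<and> lcomb A)"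
    using nc rcomb_node[OF n] lcomb_node[OF n] finAB fin T by auto
  have fromA: ?thesis if "S \<subseteq> A" "2 \<le> card S" "\<And>x. x \<in> S \<Longrightarrow> plain (T - {x})" for S
    using two_elements[of S "\<lambda>x. plain (T - {x})"] that T by blast
  have fromB: ?thesis if "S \<subseteq> B" "2 \<le> card S" "\<And>x. x \<in> S \<Longrightarrow> plain (T - {x})" for S
    using two_elements[of S "\<lambda>x. plain (T - {x})"] that T by blast
  consider (A4) "4 \<le> card A" "2 \<le> card B" | (A3) "card A = 3" "3 \<le> card B" | (A3') "card A = 3" "card B = 2"
    | (A2) "card A = 2" "3 \<le> card B" | (A1) "card A = 1" "4 \<le> card B" | (B1) "card B = 1" "4 \<le> card A"
    using sum card ne by linarith
  then show ?thesis
  proof cases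
    case A4
    then show ?thesis by (intro fromA[of A]) (auto simp: delA)
  next
    case A3
    then show ?thesis by (intro fromB[of B]) (auto simp: delB)
  next
    case A3'
    then show ?thesis by (intro fromA[of A]) (auto simp: delA)
  next
    case A2
    show ?thesis
    proof (cases "rcomb B")
      case False
      then show ?thesis using A2 by (intro fromA[of A]) (auto simp: delA)
    next
      case True
      have "\<not> lcomb (B - {x})" if "x \<in> B" "4 \<le> card B" for x
        using rcomb_lcomb_card[of "B - {x}"] rcomb_mono[OF True, of "B - {x}"] that finAB fin T by fastforce
      then show ?thesis using A2 by (intro fromB[of B]) (auto simp: delB)
    qed
  next
    case A1
    then have nr: "\<not> rcomb B" using ncAB by simp
    obtain S where S: "S \<subseteq> B" "card B \<le> card S + 3" "\<And>x. x \<in> S \<Longrightarrow> \<not> rcomb (B - {x})"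
      using not_rcomb_delete[OF finAB(2) nr] by blast
    have plS: "plain (T - {x})" if "x \<in> S" for x using S that A1 delB[of x] by auto
    obtain a where a: "A = {a}" using A1 by (auto simp: card_1_singleton_iff)
    have Ta: "T - {a} = B" using a node_disjoint[OF n] T by auto
    consider "5 \<le> card B" | "card B = 4" "lcomb B" | "card B = 4" "\<not> lcomb B" using A1 by linarith
    then show ?thesis
    proof cases
      case 1
      then show ?thesis using S plS by (intro fromB[of S]) auto
    next
      case 2
      have "\<not> rcomb (B - {x})" if "x \<in> B" for x
        using rcomb_lcomb_card[of "B - {x}"] lcomb_mono[OF 2(2), of "B - {x}"] that finAB fin T 2(1) by fastforce
      then show ?thesis using 2 A1 by (intro fromB[of B]) (auto simp: delB)
    next
      case 3
      have "plain B" using 3 nr cherry_comb_card[of B] finAB by (auto simp: plain_def)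
      moreover obtain x where "x \<in> S" using S(2) 3 by (cases "S = {}") auto
      ultimately show ?thesis using plS[of x] S(1) T a Ta node_disjoint[OF n] by (intro bexI[of _ x] bexI[of _ a]) auto
    qed
  next
    case B1
    then have nr: "\<not> lcomb A" using ncAB by simp
    obtain S where S: "S \<subseteq> A" "card A \<le> card S + 3" "\<And>x. x \<in> S \<Longrightarrow> \<not> lcomb (A - {x})"
      using not_lcomb_delete[OF finAB(1) nr] by blast
    have plS: "plain (T - {x})" if "x \<in> S" for x using S that B1 delA[of x] by auto
    obtain b where b: "B = {b}" using B1 by (auto simp: card_1_singleton_iff)
    have Tb: "T - {b} = A" using b node_disjoint[OF n] T by auto
    consider "5 \<le> card A" | "card A = 4" "rcomb A" | "card A = 4" "\<not> rcomb A" using B1 by linarith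
    then show ?thesis
    proof cases
      case 1
      then show ?thesis using S plS by (intro fromA[of S]) auto
    next
      case 2
      have "\<not> lcomb (A - {x})" if "x \<in> A" for x
        using rcomb_lcomb_card[of "A - {x}"] rcomb_mono[OF 2(2), of "A - {x}"] that finAB fin T 2(1) by fastforce
      then show ?thesis using 2 B1 by (intro fromA[of A]) (auto simp: delA)
    next
      case 3
      have "plain A" using 3 nr cherry_comb_card[of A] finAB by (auto simp: plain_def)
      moreover obtain x where "x \<in> S" using S(2) 3 by (cases "S = {}") auto
      ultimately show ?thesis using plS[of x] S(1) T b Tb node_disjoint[OF n] by (intro bexI[of _ x] bexI[of _ b]) auto
    qed
  qed
qed

section \<open>The stepping-up colouring\<close>

text \<open>
  What left and right combs have in common: one leaf hangs at the root, and what remains is a comb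
  of the same kind. The relation between leaves and labels depends on this only.
\<close>

definition peels :: "(nat set set \<Rightarrow> bool) \<Rightarrow> bool" where
  "peels P \<longleftrightarrow> (\<forall>e. finite e \<longrightarrow> (\<forall>X\<in>e. finite X) \<longrightarrow> 2 \<le> card e \<longrightarrow> P e \<longrightarrow>
     (\<exists>w X B. (node w {X} B \<or> node w B {X}) \<and> e = insert X B \<and> P B))"

lemma peels_rcomb: "peels rcomb"
  unfolding peels_def
proof (intro allI impI)
  fix e :: "nat set set" assume e: "finite e" "\<forall>X\<in>e. finite X" "2 \<le> card e" "rcomb e"
  then obtain w A B where n: "node w A B" "e = A \<union> B" using node_exists[of e] by blast
  then have "card A = 1 \<and> rcomb B" using rcomb_node[OF n(1)] e by auto
  then show "\<exists>w X B. (node w {X} B \<or> node w B {X}) \<and> e = insert X B \<and> rcomb B"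
    using n by (auto simp: card_1_singleton_iff)
qed

lemma peels_lcomb: "peels lcomb"
  unfolding peels_def
proof (intro allI impI)
  fix e :: "nat set set" assume e: "finite e" "\<forall>X\<in>e. finite X" "2 \<le> card e" "lcomb e"
  then obtain w A B where n: "node w A B" "e = A \<union> B" using node_exists[of e] by blast
  then have "card B = 1 \<and> lcomb A" using lcomb_node[OF n(1)] e by auto
  then show "\<exists>w X B. (node w {X} B \<or> node w B {X}) \<and> e = insert X B \<and> lcomb B"
    using n by (auto simp: card_1_singleton_iff)
qed

lemma labels_peel:
  assumes "node w {X} B \<or> node w B {X}"
  shows "labels (insert X B) = insert w (labels B)" "w \<notin> labels B" "X \<notin> B" "B \<noteq> {}"
proof -
  have "labels {X} = {}" by (rule labels_single) simp
  then show "labels (insert X B) = insert w (labels B)"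
    using assms labels_node[of w "{X}" B] labels_node[of w B "{X}"] by auto
  show "w \<notin> labels B" using assms node_label_notin by blast
  show "X \<notin> B" using assms node_disjoint by blast
  show "B \<noteq> {}" using assms by (auto simp: node_def)
qed

lemma node_subset:
  assumes "node w {X} B \<or> node w B {X}" "B' \<subseteq> B" "B' \<noteq> {}"
  shows "node w {X} B' \<or> node w B' {X}"
  using assms unfolding node_def by blast

lemma comb_labels:
  assumes "peels P" "finite e" "\<And>X. X \<in> e \<Longrightarrow> finite X" "P e" "e \<noteq> {}"
  shows "finite (labels e) \<and> card (labels e) + 1 = card e"
  using assms(2-)
proof (induction "card e" arbitrary: e rule: less_induct)
  case less
  show ?case
  proof (cases "card e = 1")
    case True then show ?thesis by (simp add: labels_single)
  next
    case False
    then have "2 \<le> card e" using less.prems card_0_eq[of e] by linarith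
    then obtain w X B where *: "node w {X} B \<or> node w B {X}" "e = insert X B" "P B"
      using assms(1) less.prems unfolding peels_def by meson
    note l = labels_peel[OF *(1)]
    have "card e = Suc (card B)" using less.prems * l by simp
    then have "finite (labels B) \<and> card (labels B) + 1 = card B"
      using less.prems * l by (intro less.hyps) auto
    then show ?thesis using * l \<open>card e = Suc (card B)\<close> by simp
  qed
qed

text \<open>
  The leaf that hangs at the node with label \<open>d\<close> is the one to delete.
\<close>

lemma comb_delete_label:
  assumes "peels P" "finite e" "\<And>X. X \<in> e \<Longrightarrow> finite X" "P e" "d \<in> labels e"
  shows "\<exists>x\<in>e. labels (e - {x}) = labels e - {d}"
  using assms(2-)
proof (induction "card e" arbitrary: e rule: less_induct)
  case less
  have "e \<noteq> {}" "card e \<noteq> 1" using less.prems(4) labels_single[of e] by (auto simp: labels_def)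
  then have "2 \<le> card e" using less.prems card_0_eq[of e] by linarith
  then obtain w X B where *: "node w {X} B \<or> node w B {X}" "e = insert X B" "P B"
    using assms(1) less.prems unfolding peels_def by meson
  note l = labels_peel[OF *(1)]
  have "card e = Suc (card B)" using less.prems * l by simp
  show ?case
  proof (cases "d = w")
    case True
    have "e - {X} = B" using *(2) l(3) by auto
    then have "labels (e - {X}) = labels e - {d}" using *(2) l(1,2) True by auto
    then show ?thesis using *(2) by blast
  next
    case False
    then have d: "d \<in> labels B" using less.prems(4) *(2) l(1) by auto
    have "\<exists>x\<in>B. labels (B - {x}) = labels B - {d}"
      by (rule less.hyps) (use \<open>card e = Suc (card B)\<close> less.prems *(2,3) d in auto)
    then obtain x where x: "x \<in> B" "labels (B - {x}) = labels B - {d}" by blast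
    have ne: "B - {x} \<noteq> {}" using d x(1) labels_single[of B] by (auto simp: card_1_singleton_iff)
    then have "labels (insert X (B - {x})) = insert w (labels (B - {x}))"
      by (intro labels_peel(1) node_subset[OF *(1) _ ne]) auto
    moreover have "e - {x} = insert X (B - {x})" using *(2) l(3) x(1) by auto
    moreover have "labels e - {d} = insert w (labels B - {d})" using *(2) l(1) False by auto
    ultimately have "labels (e - {x}) = labels e - {d}" using x(2) by simp
    then show ?thesis using *(2) x(1) by blast
  qed
qed

lemma comb_sub_labels:
  assumes P: "peels P" "\<And>e d. P e \<Longrightarrow> d \<subseteq> e \<Longrightarrow> P d"
    and "finite e" "\<And>X. X \<in> e \<Longrightarrow> finite X" "P e" "D \<subseteq> labels e" "e \<noteq> {}"
  shows "\<exists>e'\<subseteq>e. e' \<noteq> {} \<and> labels e' = D"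
  using assms(3-)
proof (induction "card e" arbitrary: e rule: less_induct)
  case less
  show ?case
  proof (cases "D = labels e")
    case True then show ?thesis using less.prems by blast
  next
    case False
    then obtain d where d: "d \<in> labels e" "d \<notin> D" using less.prems by blast
    then obtain x where x: "x \<in> e" "labels (e - {x}) = labels e - {d}"
      using comb_delete_label[OF P(1) less.prems(1,2,3)] by blast
    have ne: "e - {x} \<noteq> {}" using d x labels_single[of e] by (auto simp: card_1_singleton_iff)
    have "\<exists>e'\<subseteq>e - {x}. e' \<noteq> {} \<and> labels e' = D"
      using less.prems d x ne P(2)[OF less.prems(3), of "e - {x}"]
      by (intro less.hyps) (auto simp: card_gt_0_iff)
    then show ?thesis by blast
  qed
qed

text \<open>
  Cherry combs have at least five leaves by \<open>cherry_comb_card\<close>. So this one definition colours only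
  combs red for \<open>k = 4\<close>, and cherry combs too for \<open>k \<ge> 5\<close>.
\<close>

definition step_up :: "(nat set \<Rightarrow> colour) \<Rightarrow> nat set set \<Rightarrow> colour" where
  "step_up \<chi> e = (if cherry_comb e \<or> (rcomb e \<or> lcomb e) \<and> \<chi> (labels e) = Red then Red else Blue)"

lemma cherry_comb_not_comb:
  assumes "finite e" "\<And>X. X \<in> e \<Longrightarrow> finite X" "cherry_comb e"
  shows "\<not> rcomb e" "\<not> lcomb e"
proof -
  obtain w A B where *: "node w A B" "e = A \<union> B" "card A = 2" "3 \<le> card B"
    using assms(3) unfolding cherry_comb_def by blast
  show "\<not> rcomb e" "\<not> lcomb e"
    using rcomb_node[OF *(1)] lcomb_node[OF *(1)] * assms by auto
qed

lemma labels_subset: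
  assumes "e \<subseteq> Pow {..<N}"
  shows "labels e \<subseteq> {..<N}"
  using assms splitsD(2) unfolding labels_def by fastforce

text \<open>
  Two of the \<open>k + 1\<close> deletions have to be blue. For combs they come from two labels whose deletion from
  the set of labels leaves a blue set. One of the labels of a comb can be removed by deleting
  either of two leaves, but this does no harm: it is enough that different labels require different leaves.
\<close>

lemma step_up_few_red:
  assumes k: "4 \<le> k"
    and \<chi>: "\<And>S. S \<subseteq> {..<N} \<Longrightarrow> card S = k \<Longrightarrow> card {x \<in> S. \<chi> (S - {x}) = Red} < k - 1"
    and T: "T \<subseteq> Pow {..<N}" "card T = Suc k"
  shows "card {x \<in> T. step_up \<chi> (T - {x}) = Red} < k"
proof -
  have finT: "finite T" using T by (intro card_ge_0_finite) simp
  have finX: "finite X" if "X \<in> T" for X using T that finite_subset by blast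
  have two: ?thesis if "x \<in> T" "y \<in> T" "x \<noteq> y" "step_up \<chi> (T - {x}) \<noteq> Red" "step_up \<chi> (T - {y}) \<noteq> Red" for x y
  proof -
    have "card {x \<in> T. step_up \<chi> (T - {x}) = Red} \<le> card (T - {x, y})"
      using finT that by (intro card_mono) auto
    also have "card (T - {x, y}) = Suc k - 2"
      using that T finT by (subst card_Diff_subset) auto
    finally show ?thesis using k by linarith
  qed
  have comb: ?thesis if P: "peels P" "P T" and Pc: "\<And>x. rcomb (T - {x}) \<or> lcomb (T - {x})" for P
  proof -
    define D where "D = labels T"
    have neT: "T \<noteq> {}" using T(2) by auto
    have D: "finite D" "card D = k" "D \<subseteq> {..<N}"
      using comb_labels[OF P(1) finT finX P(2) neT] T(2) labels_subset[OF T(1)] by (auto simp: D_def)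
    have "card {x \<in> D. \<chi> (D - {x}) = Red} + card {x \<in> D. \<chi> (D - {x}) \<noteq> Red} = k"
      using D by (subst card_Un_disjoint[symmetric]) (auto intro: arg_cong[where f = card])
    then have "2 \<le> card {x \<in> D. \<chi> (D - {x}) \<noteq> Red}" using \<chi>[OF D(3,2)] by linarith
    then obtain d d' where d: "d \<in> D" "d' \<in> D" "d \<noteq> d'" "\<chi> (D - {d}) \<noteq> Red" "\<chi> (D - {d'}) \<noteq> Red"
      using two_elements[of "{x \<in> D. \<chi> (D - {x}) \<noteq> Red}" "\<lambda>x. \<chi> (D - {x}) \<noteq> Red"] by blast
    obtain x where x: "x \<in> T" "labels (T - {x}) = D - {d}"
      using comb_delete_label[OF P(1) finT finX P(2), of d] d by (auto simp: D_def)
    obtain y where y: "y \<in> T" "labels (T - {y}) = D - {d'}"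
      using comb_delete_label[OF P(1) finT finX P(2), of d'] d by (auto simp: D_def)
    have nc: "\<not> cherry_comb (T - {z})" for z
      using cherry_comb_not_comb[of "T - {z}"] finT finX Pc[of z] by blast
    have "x \<noteq> y" using x y d by auto
    then show ?thesis using two[of x y] x y d nc by (simp add: step_up_def)
  qed
  show ?thesis
  proof (cases "rcomb T \<or> lcomb T")
    case True
    then show ?thesis
    proof
      assume "rcomb T"
      then show ?thesis using comb[OF peels_rcomb] rcomb_mono[of T] by blast
    next
      assume "lcomb T"
      then show ?thesis using comb[OF peels_lcomb] lcomb_mono[of T] by blast
    qed
  next
    case False
    then obtain x y where "x \<in> T" "y \<in> T" "x \<noteq> y" "plain (T - {x})" "plain (T - {y})"
      using two_plain_deletions[OF finT finX] T k by auto
    then show ?thesis using two[of x y] by (simp add: step_up_def plain_def)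
  qed
qed

text \<open>
  A comb with \<open>n + 1\<close> leaves has \<open>n\<close> labels. They include a red \<open>(k - 1)\<close>-set, which is the set of
  labels of a smaller comb.
\<close>

lemma step_up_blue_combs:
  assumes k: "2 \<le> k"
    and \<chi>: "\<And>S. S \<subseteq> {..<N} \<Longrightarrow> card S = n \<Longrightarrow> \<exists>e\<subseteq>S. card e = k - 1 \<and> \<chi> e = Red"
    and H: "H \<subseteq> Pow {..<N}" and blue: "\<And>e. e \<subseteq> H \<Longrightarrow> card e = k \<Longrightarrow> step_up \<chi> e = Blue"
    and T: "T \<subseteq> H" "rcomb T \<or> lcomb T"
  shows "card T \<le> n"
proof (rule ccontr)
  assume "\<not> ?thesis"
  then have "Suc n \<le> card T" by simp
  then obtain T' where T': "T' \<subseteq> T" "card T' = Suc n" by (rule obtain_subset_with_card_n)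
  have finT: "finite T'" using T' by (intro card_ge_0_finite) simp
  have finX: "finite X" if "X \<in> T'" for X 
  proof -
    have "X \<in> Pow {..<N}" using that T'(1) T(1) H by blast
    then show ?thesis using finite_subset by blast
  qed
  have neT: "T' \<noteq> {}" using T' by auto
  have key: False if P: "peels P" "\<And>e d. P e \<Longrightarrow> d \<subseteq> e \<Longrightarrow> P d" and PT: "P T'"
    and Pc: "\<And>e. P e \<Longrightarrow> rcomb e \<or> lcomb e" for P
  proof -
    have "card (labels T') = n" using comb_labels[OF P(1) finT finX PT neT] T' by simp
    moreover have "labels T' \<subseteq> {..<N}" using T' T H by (intro labels_subset) auto
    ultimately have "\<exists>D\<subseteq>labels T'. card D = k - 1 \<and> \<chi> D = Red" by (intro \<chi>)
    then obtain D where D: "D \<subseteq> labels T'" "card D = k - 1" "\<chi> D = Red" by blast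
    have "\<exists>e\<subseteq>T'. e \<noteq> {} \<and> labels e = D"
      using P(1) P(2) finT finX PT D(1) neT by (rule comb_sub_labels)
    then obtain e where e: "e \<subseteq> T'" "e \<noteq> {}" "labels e = D" by blast
    have fe: "finite e" using finite_subset[OF e(1) finT] .
    have "card (labels e) + 1 = card e"
    proof -
      have "finite (labels e) \<and> card (labels e) + 1 = card e"
        by (rule comb_labels[OF P(1) fe _ P(2)[OF PT e(1)] e(2)]) (use finX e(1) in blast)
      then show ?thesis by simp
    qed
    then have "card e = k" using e(3) D(2) k by simp
    moreover have "step_up \<chi> e = Red" using Pc[OF P(2)[OF PT e(1)]] e(3) D(3) by (simp add: step_up_def)
    moreover have "e \<subseteq> H" using e(1) T'(1) T(1) by blast
    ultimately show False using blue[of e] by simp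
  qed
  show False
  proof (cases "rcomb T'")
    case True
    show False by (rule key[OF peels_rcomb rcomb_mono True]) simp_all
  next
    case False
    then have l: "lcomb T'" using T(2) rcomb_mono[OF _ T'(1)] lcomb_mono[OF _ T'(1)] by blast
    show False by (rule key[OF peels_lcomb lcomb_mono l]) simp_all
  qed
qed

section \<open>Trees without long combs\<close>

lemma card_le_1_or_node:
  assumes "finite H" "\<And>X. X \<in> H \<Longrightarrow> finite X"
  obtains "card H \<le> 1" | w A B where "node w A B" "H = A \<union> B"
  using node_exists[OF assms(1)] assms(2) by (metis not_less_eq_eq numeral_2_eq_2 One_nat_def)

lemma node_insert:
  assumes n: "node w A B" and fin: "finite A" "finite B" "\<And>X. X \<in> A \<union> B \<Longrightarrow> finite X"
  shows "X \<in> A \<Longrightarrow> T \<subseteq> B \<Longrightarrow> rcomb T \<Longrightarrow> T \<noteq> {} \<Longrightarrow> rcomb (insert X T) \<and> X \<notin> T"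
    and "Y \<in> B \<Longrightarrow> T \<subseteq> A \<Longrightarrow> lcomb T \<Longrightarrow> T \<noteq> {} \<Longrightarrow> lcomb (insert Y T) \<and> Y \<notin> T"
proof -
  assume *: "X \<in> A" "T \<subseteq> B" "rcomb T" "T \<noteq> {}"
  then have n': "node w {X} T" using n unfolding node_def by blast
  have "rcomb ({X} \<union> T)" using rcomb_node[OF n'] * fin by simp
  then show "rcomb (insert X T) \<and> X \<notin> T" using node_disjoint[OF n'] by simp
next
  assume *: "Y \<in> B" "T \<subseteq> A" "lcomb T" "T \<noteq> {}"
  then have n': "node w T {Y}" using n unfolding node_def by blast
  have "lcomb (T \<union> {Y})" using lcomb_node[OF n'] * fin by simp
  then show "lcomb (insert Y T) \<and> Y \<notin> T" using node_disjoint[OF n'] by simp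
qed

text \<open>
  A leaf of the left subtree can be added to right combs in the right subtree, and vice versa. So the
  bound for right combs is smaller by one on the right, that for left combs on the left, which is
  the recursion of binomial coefficients.
\<close>

lemma card_le_binomial:
  assumes "finite H" "\<And>X. X \<in> H \<Longrightarrow> finite X"
    and "\<And>T. T \<subseteq> H \<Longrightarrow> rcomb T \<Longrightarrow> card T \<le> p" "\<And>T. T \<subseteq> H \<Longrightarrow> lcomb T \<Longrightarrow> card T \<le> q"
  shows "card H \<le> (p + q) choose q"
  using assms
proof (induction "card H" arbitrary: H p q rule: less_induct)
  case less
  show ?case
  proof (rule card_le_1_or_node[of H])
    assume "card H \<le> 1"
    also have "1 \<le> (p + q) choose q" by (simp add: Suc_leI)
    finally show ?thesis .
  next
    fix w A B assume n: "node w A B" and H: "H = A \<union> B"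
    have fin: "finite A" "finite B" "\<And>X. X \<in> A \<union> B \<Longrightarrow> finite X" using less.prems H by auto
    obtain X Y where XY: "X \<in> A" "Y \<in> B" using n by (auto simp: node_def)
    have cardH: "card H = card A + card B"
      unfolding H using fin node_disjoint[OF n] by (intro card_Un_disjoint)
    have pos: "0 < card A" "0 < card B" using XY fin by (auto simp: card_gt_0_iff)
    have p1: "1 \<le> p" using less.prems(3)[of "{X}"] rcomb_single[of "{X}"] XY H by simp
    have q1: "1 \<le> q" using less.prems(4)[of "{X}"] lcomb_single[of "{X}"] XY H by simp
    have "card B \<le> ((p - 1) + q) choose q"
    proof (rule less.hyps)
      show "card T \<le> p - 1" if "T \<subseteq> B" "rcomb T" for T
      proof (cases "T = {}")
        case False
        have "finite T" using that fin finite_subset by blast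
        moreover have "insert X T \<subseteq> H" using that(1) XY H by blast
        ultimately show ?thesis
          using node_insert(1)[OF n fin XY(1) that False] less.prems(3)[of "insert X T"] by simp
      qed simp
      show "card T \<le> q" if "T \<subseteq> B" "lcomb T" for T using less.prems(4)[of T] that H by blast
    qed (use fin cardH pos in auto)
    moreover have "card A \<le> (p + (q - 1)) choose (q - 1)"
    proof (rule less.hyps)
      show "card T \<le> q - 1" if "T \<subseteq> A" "lcomb T" for T
      proof (cases "T = {}")
        case False
        have "finite T" using that fin finite_subset by blast
        moreover have "insert Y T \<subseteq> H" using that(1) XY H by blast
        ultimately show ?thesis
          using node_insert(2)[OF n fin XY(2) that False] less.prems(4)[of "insert Y T"] by simp
      qed simp
      show "card T \<le> p" if "T \<subseteq> A" "rcomb T" for T using less.prems(3)[of T] that H by blast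
    qed (use fin cardH pos in auto)
    moreover have "(p + q) choose q = (((p - 1) + q) choose q) + ((p + (q - 1)) choose (q - 1))"
      using p1 q1 by (cases p; cases q) (auto simp: add.commute)
    ultimately show ?thesis using cardH by simp
  qed (use less.prems in auto)
qed

text \<open>
  If the left subtree of the root has at least two leaves, then the right subtree contains no left comb
  with \<open>k - 2\<close> leaves and has size polynomial in \<open>n\<close> by \<open>card_le_binomial\<close>; one continues with the left
  subtree, in which left combs are shorter. If the left subtree is a leaf, one continues with the
  right subtree, in which right combs are shorter. This stops after \<open>p + q\<close> steps.
\<close>

lemma card_le_without_cherry_comb:
  assumes "finite H" "\<And>X. X \<in> H \<Longrightarrow> finite X"
    and "\<And>T. T \<subseteq> H \<Longrightarrow> rcomb T \<Longrightarrow> card T \<le> p" "\<And>T. T \<subseteq> H \<Longrightarrow> lcomb T \<Longrightarrow> card T \<le> q"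
    and "p \<le> n" and k: "5 \<le> k"
    and "\<And>e. e \<subseteq> H \<Longrightarrow> card e = k \<Longrightarrow> \<not> cherry_comb e"
  shows "card H \<le> (p + q) * ((n + (k - 3)) choose (k - 3))"
  using assms(1-5,7)
proof (induction "card H" arbitrary: H p q rule: less_induct)
  case less
  define G where "G = (n + (k - 3)) choose (k - 3)"
  have G: "1 \<le> G" unfolding G_def by (simp add: Suc_leI)
  show ?case
  proof (rule card_le_1_or_node[of H])
    assume H1: "card H \<le> 1"
    show ?thesis
    proof (cases "card H = 0")
      case False
      then have "card H = 1" using H1 by simp
      then have "1 \<le> p" using less.prems(3)[of H] rcomb_single[of H] by simp
      then have "1 * 1 \<le> (p + q) * G" using G by (intro mult_le_mono) auto
      then show ?thesis using \<open>card H = 1\<close> by (simp add: G_def)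
    qed simp
  next
    fix w A B assume n: "node w A B" and H: "H = A \<union> B"
    have fin: "finite A" "finite B" "\<And>X. X \<in> A \<union> B \<Longrightarrow> finite X" using less.prems H by auto
    obtain X Y where XY: "X \<in> A" "Y \<in> B" using n by (auto simp: node_def)
    have cardH: "card H = card A + card B"
      unfolding H using fin node_disjoint[OF n] by (intro card_Un_disjoint)
    have pos: "0 < card A" "0 < card B" using XY fin by (auto simp: card_gt_0_iff)
    have p1: "1 \<le> p" using less.prems(3)[of "{X}"] rcomb_single[of "{X}"] XY H by simp
    have q1: "1 \<le> q" using less.prems(4)[of "{X}"] lcomb_single[of "{X}"] XY H by simp
    show ?thesis
    proof (cases "card A = 1")
      case True
      \<comment> \<open>Descend to the right subtree; the single leaf on the left is paid for by \<open>G \<ge> 1\<close>.\<close>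
      have "card B \<le> ((p - 1) + q) * G" unfolding G_def
      proof (rule less.hyps)
        show "card T \<le> p - 1" if "T \<subseteq> B" "rcomb T" for T
        proof (cases "T = {}")
          case False
          have "finite T" using that fin finite_subset by blast
          moreover have "insert X T \<subseteq> H" using that(1) XY H by blast
          ultimately show ?thesis
            using node_insert(1)[OF n fin XY(1) that False] less.prems(3)[of "insert X T"] by simp
        qed simp
        show "card T \<le> q" if "T \<subseteq> B" "lcomb T" for T using less.prems(4)[of T] that H by blast
        show "\<not> cherry_comb e" if "e \<subseteq> B" "card e = k" for e using less.prems(6)[of e] that H by blast
      qed (use fin cardH pos less.prems(5) in auto)
      moreover have "(p + q) * G = ((p - 1) + q) * G + G" using p1 by (cases p) auto
      ultimately show ?thesis using True cardH G by (simp add: G_def)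
    next
      case False
      then have "2 \<le> card A" using pos by simp
      then obtain A2 where A2: "A2 \<subseteq> A" "card A2 = 2" by (rule obtain_subset_with_card_n)
      \<comment> \<open>Descend to the left subtree; the right one has at most \<open>G\<close> leaves.\<close>
      have "card A \<le> (p + (q - 1)) * G" unfolding G_def
      proof (rule less.hyps)
        show "card T \<le> q - 1" if "T \<subseteq> A" "lcomb T" for T
        proof (cases "T = {}")
          case False
          have "finite T" using that fin finite_subset by blast
          moreover have "insert Y T \<subseteq> H" using that(1) XY H by blast
          ultimately show ?thesis
            using node_insert(2)[OF n fin XY(2) that False] less.prems(4)[of "insert Y T"] by simp
        qed simp
        show "card T \<le> p" if "T \<subseteq> A" "rcomb T" for T using less.prems(3)[of T] that H by blast
        show "\<not> cherry_comb e" if "e \<subseteq> A" "card e = k" for e using less.prems(6)[of e] that H by blast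
      qed (use fin cardH pos less.prems(5) in auto)
      moreover have "card B \<le> G" unfolding G_def
      proof (rule card_le_binomial[OF fin(2)])
        show "card T \<le> n" if "T \<subseteq> B" "rcomb T" for T
          using less.prems(3)[of T] less.prems(5) that H by fastforce
        show "card T \<le> k - 3" if T: "T \<subseteq> B" "lcomb T" for T
        proof (rule ccontr)
          assume "\<not> ?thesis"
          then have "k - 2 \<le> card T" using k by linarith
          then obtain B2 where B2: "B2 \<subseteq> T" "card B2 = k - 2" by (rule obtain_subset_with_card_n)
          have "A2 \<noteq> {}" "B2 \<noteq> {}" using A2 B2 k by auto
          then have n2: "node w A2 B2" using n A2(1) B2(1) T(1) unfolding node_def by blast
          have "card (A2 \<union> B2) = k"
            using card_Un_disjoint[OF _ _ node_disjoint[OF n2]] A2 B2 T k fin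
              finite_subset[OF A2(1)] finite_subset[of B2 B] by simp
          moreover have "cherry_comb (A2 \<union> B2)"
            using cherry_comb_node[OF n2] A2 B2 k lcomb_mono[OF T(2) B2(1)] by simp
          ultimately show False using less.prems(6)[of "A2 \<union> B2"] A2 B2 T H by blast
        qed
      qed (use fin in auto)
      moreover have "(p + q) * G = (p + (q - 1)) * G + G" using q1 by (cases q) auto
      ultimately show ?thesis using cardH by (simp add: G_def)
    qed
  qed (use less.prems in auto)
qed

section \<open>Stepping up\<close>

text \<open>
  For stepping up, colourings of an arbitrary set of points are needed, and it is more convenient to
  count the points whose deletion leaves a red set than to count red sets.
\<close>

lemma not_eh_arrowI:
  assumes V: "finite V" "card V = M"
    and red: "\<And>T. T \<subseteq> V \<Longrightarrow> card T = Suc k \<Longrightarrow> card {x \<in> T. c (T - {x}) = Red} < t"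
    and blue: "\<And>H. H \<subseteq> V \<Longrightarrow> card H = n \<Longrightarrow> \<exists>e\<subseteq>H. card e = k \<and> c e = Red"
  shows "\<not> eh_arrow k t n M"
proof
  assume arrow: "eh_arrow k t n M"
  obtain g where g: "bij_betw g {0..<M} V" using ex_bij_betw_nat_finite[OF V(1)] V(2) by auto
  then have inj: "inj_on g {..<M}" and im: "g ` {..<M} = V" by (auto simp: bij_betw_def lessThan_atLeast0)
  consider S where "S \<in> [{..<M}]\<^bsup>(k + 1)\<^esup>" "t \<le> card {e \<in> [S]\<^bsup>k\<^esup>. c (g ` e) = Red}"
    | H where "H \<in> [{..<M}]\<^bsup>n\<^esup>" "\<forall>e \<in> [H]\<^bsup>k\<^esup>. c (g ` e) = Blue"
    using arrow[unfolded eh_arrow_def, rule_format, of "\<lambda>e. c (g ` e)"] by blast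
  then show False
  proof cases
    case (1 S)
    then have S: "S \<subseteq> {..<M}" "finite S" "card S = Suc k" by (auto simp: nsets_def)
    have injS: "inj_on g S" using inj_on_subset[OF inj S(1)] .
    have eq: "g ` (S - {x}) = g ` S - {g x}" if "x \<in> S" for x
      using injS that by (auto simp: inj_on_def)
    have "t \<le> card {x \<in> S. c (g ` (S - {x})) = Red}"
      using 1(2) card_nsets_delete[OF S(2,3), of "\<lambda>e. c (g ` e) = Red"] by simp
    also have "\<dots> = card (g ` {x \<in> S. c (g ` (S - {x})) = Red})"
      using inj_on_subset[OF injS] by (intro card_image[symmetric]) auto
    also have "g ` {x \<in> S. c (g ` (S - {x})) = Red} = {y \<in> g ` S. c (g ` S - {y}) = Red}"
      using eq by auto
    also have "card \<dots> < t" using S im injS by (intro red) (auto simp: card_image)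
    finally show False by simp
  next
    case (2 H)
    then have H: "H \<subseteq> {..<M}" "finite H" "card H = n" by (auto simp: nsets_def)
    have injH: "inj_on g H" using inj_on_subset[OF inj H(1)] .
    obtain e where e: "e \<subseteq> g ` H" "card e = k" "c e = Red"
      using blue[of "g ` H"] H im injH by (auto simp: card_image)
    then obtain e' where e': "e' \<subseteq> H" "e = g ` e'" by (meson subset_imageE)
    have "card e' = k" using e e' inj_on_subset[OF injH e'(1)] by (simp add: card_image)
    then have "e' \<in> [H]\<^bsup>k\<^esup>" using e' H finite_subset by (auto simp: nsets_def)
    then show False using 2 e e' by auto
  qed
qed

lemma not_eh_arrowE:
  assumes "\<not> eh_arrow k t n N"
  obtains \<chi> where "\<And>S. S \<subseteq> {..<N} \<Longrightarrow> card S = Suc k \<Longrightarrow> card {x \<in> S. \<chi> (S - {x}) = Red} < t"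
    "\<And>H. H \<subseteq> {..<N} \<Longrightarrow> card H = n \<Longrightarrow> \<exists>e\<subseteq>H. card e = k \<and> \<chi> e = Red"
proof -
  obtain \<chi> where \<chi>: "\<And>S. S \<in> [{..<N}]\<^bsup>(k + 1)\<^esup> \<Longrightarrow> \<not> t \<le> card {e \<in> [S]\<^bsup>k\<^esup>. \<chi> e = Red}"
    "\<And>T. T \<in> [{..<N}]\<^bsup>n\<^esup> \<Longrightarrow> \<exists>e \<in> [T]\<^bsup>k\<^esup>. \<chi> e \<noteq> Blue"
    using assms unfolding eh_arrow_def by blast
  show ?thesis
  proof (rule that[of \<chi>])
    fix S assume S: "S \<subseteq> {..<N}" "card S = Suc k"
    then have "finite S" using finite_subset by blast
    then show "card {x \<in> S. \<chi> (S - {x}) = Red} < t"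
      using \<chi>(1)[of S] S card_nsets_delete[of S k "\<lambda>e. \<chi> e = Red"] by (simp add: nsets_def)
  next
    fix H assume H: "H \<subseteq> {..<N}" "card H = n"
    then have "finite H" using finite_subset by blast
    then obtain e where e: "e \<in> [H]\<^bsup>k\<^esup>" "\<chi> e \<noteq> Blue" using \<chi>(2)[of H] H by (auto simp: nsets_def)
    then show "\<exists>e\<subseteq>H. card e = k \<and> \<chi> e = Red" by (cases "\<chi> e") (auto simp: nsets_def)
  qed
qed

lemma step_up_not_eh_arrow:
  assumes k: "4 \<le> k" and "\<not> eh_arrow (k - 1) (k - 1) n N"
    and size: "\<And>H. H \<subseteq> Pow {..<N} \<Longrightarrow> (\<And>T. T \<subseteq> H \<Longrightarrow> rcomb T \<or> lcomb T \<Longrightarrow> card T \<le> n) \<Longrightarrow>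
      (\<And>e. e \<subseteq> H \<Longrightarrow> card e = k \<Longrightarrow> \<not> cherry_comb e) \<Longrightarrow> card H < m"
  shows "\<not> eh_arrow k k m (2 ^ N)"
proof -
  obtain \<chi> where \<chi>: "\<And>S. S \<subseteq> {..<N} \<Longrightarrow> card S = Suc (k - 1) \<Longrightarrow> card {x \<in> S. \<chi> (S - {x}) = Red} < k - 1"
    "\<And>H. H \<subseteq> {..<N} \<Longrightarrow> card H = n \<Longrightarrow> \<exists>e\<subseteq>H. card e = k - 1 \<and> \<chi> e = Red"
    using not_eh_arrowE[OF assms(2)] by blast
  show ?thesis
  proof (rule not_eh_arrowI[where V = "Pow {..<N}" and c = "step_up \<chi>"])
    show "card {x \<in> T. step_up \<chi> (T - {x}) = Red} < k" if "T \<subseteq> Pow {..<N}" "card T = Suc k" for T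
      using k that by (intro step_up_few_red[where N = N] \<chi>(1)) auto
    show "\<exists>e\<subseteq>H. card e = k \<and> step_up \<chi> e = Red" if H: "H \<subseteq> Pow {..<N}" "card H = m" for H
    proof (rule ccontr)
      assume no: "\<not> ?thesis"
      have blue: "step_up \<chi> e = Blue" if "e \<subseteq> H" "card e = k" for e
        using no that by (cases "step_up \<chi> e") auto
      have "card H < m"
      proof (rule size[OF H(1)])
        show "card T \<le> n" if "T \<subseteq> H" "rcomb T \<or> lcomb T" for T
          using k by (intro step_up_blue_combs[OF _ \<chi>(2) H(1) blue that]) auto
        show "\<not> cherry_comb e" if "e \<subseteq> H" "card e = k" for e
          using blue[OF that] by (auto simp: step_up_def split: if_splits)
      qed
      then show False using H by simp
    qed
  qed (auto simp: card_Pow)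
qed

lemma step_up_4:
  assumes "\<not> eh_arrow 3 3 n N"
  shows "\<not> eh_arrow 4 4 (2 ^ (2 * n) + 1) (2 ^ N)"
proof (rule step_up_not_eh_arrow[where n = n])
  fix H assume H: "H \<subseteq> Pow {..<N}" and T: "\<And>T. T \<subseteq> H \<Longrightarrow> rcomb T \<or> lcomb T \<Longrightarrow> card T \<le> n"
  have "card H \<le> (n + n) choose n"
  proof (rule card_le_binomial)
    show "finite H" using H finite_subset by blast
    show "finite X" if "X \<in> H" for X using H that finite_subset by blast
  qed (use T in auto)
  also have "\<dots> \<le> 2 ^ (n + n)" by (rule binomial_le_pow2)
  finally show "card H < 2 ^ (2 * n) + 1" by (simp add: mult_2)
qed (use assms in auto)

lemma step_up_5:
  assumes "5 \<le> k" "\<not> eh_arrow (k - 1) (k - 1) n N"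
  shows "\<not> eh_arrow k k (2 * n * ((n + (k - 3)) choose (k - 3)) + 1) (2 ^ N)"
proof (rule step_up_not_eh_arrow[where n = n])
  fix H assume H: "H \<subseteq> Pow {..<N}" and T: "\<And>T. T \<subseteq> H \<Longrightarrow> rcomb T \<or> lcomb T \<Longrightarrow> card T \<le> n"
    and e: "\<And>e. e \<subseteq> H \<Longrightarrow> card e = k \<Longrightarrow> \<not> cherry_comb e"
  have "card H \<le> (n + n) * ((n + (k - 3)) choose (k - 3))"
  proof (rule card_le_without_cherry_comb)
    show "finite H" using H finite_subset by blast
    show "finite X" if "X \<in> H" for X using H that finite_subset by blast
  qed (use T e assms in auto)
  then show "card H < 2 * n * ((n + (k - 3)) choose (k - 3)) + 1" by (simp add: mult_2)
qed (use assms in auto)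

section \<open>Growth of the tower\<close>

lemma not_eh_arrow_mono:
  assumes "\<not> eh_arrow k t m N" "m \<le> n"
  shows "\<not> eh_arrow k t n N"
proof
  assume arrow: "eh_arrow k t n N"
  have "eh_arrow k t m N"
    unfolding eh_arrow_def
  proof (intro allI disjCI)
    fix \<chi> :: "nat set \<Rightarrow> colour"
    assume no: "\<not> (\<exists>T\<in>[{..<N}]\<^bsup>m\<^esup>. \<forall>e\<in>[T]\<^bsup>k\<^esup>. \<chi> e = Blue)"
    have False if "T \<in> [{..<N}]\<^bsup>n\<^esup>" "\<forall>e\<in>[T]\<^bsup>k\<^esup>. \<chi> e = Blue" for T
    proof -
      have "m \<le> card T" using that assms(2) by (auto simp: nsets_def)
      then obtain T' where T': "T' \<subseteq> T" "card T' = m" by (rule obtain_subset_with_card_n)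
      then have "T' \<in> [{..<N}]\<^bsup>m\<^esup>" using that(1) finite_subset by (auto simp: nsets_def)
      moreover have "\<forall>e\<in>[T']\<^bsup>k\<^esup>. \<chi> e = Blue" using that(2) T' by (auto simp: nsets_def)
      ultimately show False using no by blast
    qed
    then show "\<exists>S\<in>[{..<N}]\<^bsup>(k + 1)\<^esup>. t \<le> card {e \<in> [S]\<^bsup>k\<^esup>. \<chi> e = Red}"
      using arrow[unfolded eh_arrow_def, rule_format, of \<chi>] by blast
  qed
  then show False using assms by simp
qed

lemma less_erdos_hajnal:
  assumes "\<not> eh_arrow k t n N" "t \<le> k + 1"
  shows "N < erdos_hajnal k t n"
proof (rule ccontr)
  assume "\<not> ?thesis"
  then have le: "[{..<erdos_hajnal k t n}]\<^bsup>i\<^esup> \<subseteq> [{..<N}]\<^bsup>i\<^esup>" for i by (intro nsets_mono) auto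
  have "eh_arrow k t n N"
    unfolding eh_arrow_def
  proof
    fix \<chi> :: "nat set \<Rightarrow> colour"
    show "(\<exists>S \<in> [{..<N}]\<^bsup>(k + 1)\<^esup>. t \<le> card {e \<in> [S]\<^bsup>k\<^esup>. \<chi> e = Red}) \<or>
        (\<exists>T \<in> [{..<N}]\<^bsup>n\<^esup>. \<forall>e \<in> [T]\<^bsup>k\<^esup>. \<chi> e = Blue)"
      using eh_arrow_erdos_hajnal[OF assms(2), unfolded eh_arrow_def, rule_format, of n \<chi>] le by blast
  qed
  then show False using assms by simp
qed

lemma tw_mono: "x \<le> y \<Longrightarrow> tw (Suc i) x \<le> tw (Suc i) y"
  by (induction i) auto

definition tower_bound :: "nat \<Rightarrow> real \<Rightarrow> nat \<Rightarrow> real" where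
  "tower_bound k c n = tw (k - 2) (real n powr (c * log 2 (log 2 (real n))))"

lemma powr_log_log_le:
  assumes n: "4 \<le> n" and m: "2 \<le> m"
    and le: "c * (log 2 (real n) * log 2 (log 2 (real n))) \<le> d * (log 2 (real m) * log 2 (log 2 (real m)))"
  shows "real n powr (c * log 2 (log 2 (real n))) \<le> real m powr (d * log 2 (log 2 (real m)))"
proof -
  have eq: "real i powr (b * log 2 (log 2 (real i))) = 2 powr (b * (log 2 (real i) * log 2 (log 2 (real i))))"
    if "0 < i" for i b
  proof -
    have "real i powr (b * log 2 (log 2 (real i))) = (2 powr log 2 (real i)) powr (b * log 2 (log 2 (real i)))"
      using that by simp
    also have "\<dots> = 2 powr (b * (log 2 (real i) * log 2 (log 2 (real i))))"
      by (simp add: powr_powr mult_ac)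
    finally show ?thesis .
  qed
  show ?thesis using eq[of n c] eq[of m d] n m le by simp
qed

text \<open>
  The colouring of triples is available for the special sizes \<open>f h\<close> only. Between consecutive sizes
  \<open>g h\<close> for quadruples, \<open>log n\<close> changes by a constant factor, which is absorbed in the constant:
  \<open>log n\<close> is at most \<open>2 ^ (54 * h + 118)\<close>, its logarithm at most \<open>128 * h\<close>, and the colouring has
  \<open>2 ^ 2 ^ (2 * h * 2 ^ (54 * (h + 1)))\<close> points.
\<close>

lemma lower_bound_4:
  "\<forall>\<^sub>F n in sequentially. \<exists>N. \<not> eh_arrow 4 4 n N \<and> tower_bound 4 (1 / 2 ^ 71) n \<le> real N"
proof -
  define f where "f = (\<lambda>h. 384 * 2 ^ (54 * (h + 1)) :: nat)"
  define g where "g = (\<lambda>h. 2 ^ (2 * f h) + 1 :: nat)"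
  have hg: "h < g h" for h
  proof -
    have "h < 2 ^ h" by (rule less_exp)
    also have "(2::nat) ^ h \<le> f h"
    proof -
      have "(2::nat) ^ h \<le> 2 ^ (54 * (h + 1))" by (intro power_increasing) auto
      also have "\<dots> \<le> f h" by (simp add: f_def)
      finally show ?thesis .
    qed
    also have "\<dots> < 2 ^ f h" by (rule less_exp)
    also have "\<dots> \<le> 2 ^ (2 * f h)" by (intro power_increasing) auto
    finally show ?thesis by (simp add: g_def)
  qed
  have "\<exists>N. \<not> eh_arrow 4 4 n N \<and> tower_bound 4 (1 / 2 ^ 71) n \<le> real N" if n: "g 2 \<le> n" for n
  proof -
    define A where "A = {h. 2 \<le> h \<and> g h \<le> n}"
    have finA: "finite A"
      by (rule finite_subset[of _ "{..n}"]) (use hg in \<open>auto simp: A_def dest: less_imp_le order_trans\<close>)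
    define h where "h = Max A"
    have "h \<in> A" unfolding h_def using finA n by (intro Max_in) (auto simp: A_def)
    then have h: "2 \<le> h" "g h \<le> n" by (auto simp: A_def)
    have up: "n < g (Suc h)"
    proof (rule ccontr)
      assume "\<not> ?thesis"
      then have "Suc h \<in> A" using h by (simp add: A_def)
      then show False using Max_ge[OF finA, of "Suc h"] by (simp add: h_def)
    qed
    define m where "m = (2::nat) ^ (18 * (h + 1))"
    have m3: "m ^ 3 = 2 ^ (54 * (h + 1))"
    proof -
      have "m ^ 3 = 2 ^ (18 * (h + 1) * 3)" unfolding m_def by (rule power_mult[symmetric])
      then show ?thesis by (simp add: algebra_simps)
    qed
    define E where "E = 2 * h * m ^ 3"
    have "\<not> eh_arrow 3 3 (f h) (2 ^ E)"
      using not_eh_arrow_3_explicit[OF h(1)] unfolding m_def[symmetric] E_def f_def m3 .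
    then have "\<not> eh_arrow 4 4 (g h) (2 ^ (2 ^ E))" unfolding g_def by (rule step_up_4)
    then have no: "\<not> eh_arrow 4 4 n (2 ^ (2 ^ E))" using h(2) by (rule not_eh_arrow_mono)
    define L where "L = log 2 (real n)"
    have n5: "2 < n" using h(2) hg[of h] h(1) by linarith
    have "real n \<le> 2 ^ (2 * f (Suc h))"
    proof -
      have "n \<le> 2 ^ (2 * f (Suc h))" using up by (simp add: g_def)
      then have "real n \<le> real (2 ^ (2 * f (Suc h)))" by (simp only: of_nat_le_iff)
      then show ?thesis by simp
    qed
    then have "L \<le> log 2 (2 ^ (2 * f (Suc h)))" unfolding L_def using n5 by (intro log_mono) auto
    then have "L \<le> real (2 * f (Suc h))" by (simp add: log_nat_power)
    also have "\<dots> \<le> real (2 ^ (54 * h + 118))"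
    proof -
      have "2 * f (Suc h) = 768 * 2 ^ (54 * h + 108)" by (simp add: f_def algebra_simps)
      also have "\<dots> \<le> 2 ^ 10 * 2 ^ (54 * h + 108)" by (intro mult_right_mono) auto
      also have "\<dots> = 2 ^ (54 * h + 118)" by (simp add: power_add)
      finally show ?thesis by (simp only: of_nat_le_iff)
    qed
    finally have L: "L \<le> 2 ^ (54 * h + 118)" by simp
    have L1: "1 < L" using n5 unfolding L_def by (simp add: less_log_iff)
    have LL0: "0 \<le> log 2 L" using L1 by simp
    have "log 2 L \<le> log 2 (2 ^ (54 * h + 118))" using L L1 by (intro log_mono) auto
    also have "\<dots> = real (54 * h + 118)" by (simp add: log_nat_power)
    also have "\<dots> \<le> 128 * real h" using h(1) by simp
    finally have LL: "log 2 L \<le> 128 * real h" .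
    have "L * log 2 L \<le> 2 ^ (54 * h + 118) * (128 * real h)"
      using L LL L1 LL0 by (intro mult_mono) auto
    also have "\<dots> = 2 ^ 71 * (2 ^ (54 * (h + 1)) * real h)"
      by (simp add: power_add algebra_simps)
    also have "\<dots> \<le> 2 ^ 71 * real E"
      by (simp add: E_def m3)
    finally have "1 / 2 ^ 71 * (L * log 2 L) \<le> real E" by (simp add: field_simps)
    then have "(2 powr L) powr (1 / 2 ^ 71 * log 2 L) \<le> 2 powr real E"
      by (simp add: powr_powr mult_ac)
    moreover have "2 powr L = real n" using n5 by (simp add: L_def)
    ultimately have "real n powr (1 / 2 ^ 71 * log 2 L) \<le> 2 ^ E" by (simp add: powr_realpow)
    then have "2 powr (real n powr (1 / 2 ^ 71 * log 2 L)) \<le> 2 powr (real (2 ^ E))"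
      by (intro powr_mono) auto
    also have "\<dots> = real (2 ^ (2 ^ E))"
      by (subst powr_realpow) auto
    finally have "tower_bound 4 (1 / 2 ^ 71) n \<le> real (2 ^ (2 ^ E))"
      by (simp add: tower_bound_def L_def numeral_2_eq_2)
    then show ?thesis using no by blast
  qed
  then show ?thesis by (auto simp: eventually_sequentially)
qed

lemma polynomial_inverse:
  fixes n d M :: nat
  assumes "0 < d" "M ^ d \<le> n"
  shows "\<exists>m\<ge>M. m ^ d \<le> n \<and> n < (m + 1) ^ d"
proof -
  have ge: "i \<le> i ^ d" for i :: nat using assms(1) by (cases i) (auto intro: self_le_power)
  define m where "m = Max {m. m ^ d \<le> n}"
  have fin: "finite {m. m ^ d \<le> n}"
    by (rule finite_subset[of _ "{..n}"]) (use ge in \<open>auto intro: order_trans\<close>)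
  have "m \<in> {m. m ^ d \<le> n}" unfolding m_def using assms fin by (intro Max_in) auto
  moreover have "M \<le> m" unfolding m_def using assms fin by (intro Max_ge) auto
  moreover have "n < (m + 1) ^ d"
  proof (rule ccontr)
    assume "\<not> ?thesis"
    then have "m + 1 \<le> m" unfolding m_def using fin by (intro Max_ge) (auto simp: m_def)
    then show False by simp
  qed
  ultimately show ?thesis by auto
qed

text \<open>
  Let \<open>m\<close> be the largest number with \<open>m ^ (2 * k) \<le> n\<close>; stepping up from \<open>m\<close> then stays below \<open>n\<close>. Since
  \<open>n \<le> m ^ (4 * k)\<close>, passing from \<open>n\<close> to \<open>m\<close> costs a factor \<open>4 * k\<close> in the logarithm and, for large \<open>m\<close>, a
  factor 2 in the iterated logarithm.
\<close>

lemma lower_bound_step: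
  assumes k: "5 \<le> k" and c: "0 < c"
    and IH: "\<forall>\<^sub>F n in sequentially. \<exists>N. \<not> eh_arrow (k - 1) (k - 1) n N \<and> tower_bound (k - 1) c n \<le> real N"
  shows "\<forall>\<^sub>F n in sequentially. \<exists>N. \<not> eh_arrow k k n N \<and> tower_bound k (c / (8 * real k)) n \<le> real N"
proof -
  obtain M0 where M0: "\<And>n. M0 \<le> n \<Longrightarrow> \<exists>N. \<not> eh_arrow (k - 1) (k - 1) n N \<and> tower_bound (k - 1) c n \<le> real N"
    using IH by (auto simp: eventually_sequentially)
  define M where "M = max M0 (2 ^ (4 * k))"
  have "\<exists>N. \<not> eh_arrow k k n N \<and> tower_bound k (c / (8 * real k)) n \<le> real N" if n: "M ^ (2 * k) \<le> n" for n
  proof -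
    obtain m where m: "M \<le> m" "m ^ (2 * k) \<le> n" "n < (m + 1) ^ (2 * k)"
      using polynomial_inverse[of "2 * k" M n] n k by auto
    have m4k: "2 ^ (4 * k) \<le> m" using m(1) by (simp add: M_def)
    have km: "4 * k \<le> m" using m4k less_exp[of "4 * k"] by linarith
    obtain N where N: "\<not> eh_arrow (k - 1) (k - 1) m N" "tower_bound (k - 1) c m \<le> real N"
      using M0[of m] m(1) by (auto simp: M_def)
    have "\<not> eh_arrow k k (2 * m * ((m + (k - 3)) choose (k - 3)) + 1) (2 ^ N)"
      using k N(1) by (rule step_up_5)
    moreover have "2 * m * ((m + (k - 3)) choose (k - 3)) + 1 \<le> n"
    proof -
      have k123: "k - 2 = Suc (k - 3)" "k - 1 = Suc (k - 2)" using k by auto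
      have "(m + (k - 3)) choose (k - 3) \<le> (m + (k - 3)) ^ (k - 3)" by (intro binomial_le_pow) simp
      also have "\<dots> \<le> (2 * m) ^ (k - 3)" using km by (intro power_mono) auto
      finally have "2 * m * ((m + (k - 3)) choose (k - 3)) + 1 \<le> 2 * m * (2 * m) ^ (k - 3) + 1" by simp
      also have "\<dots> = (2 * m) ^ (k - 2) + 1" by (simp only: k123(1) power_Suc)
      also have "\<dots> \<le> (2 * m) ^ (k - 2) * (2 * m)"
      proof -
        have "1 \<le> (2 * m) ^ (k - 2)" using km k by simp
        moreover have "2 \<le> 2 * m" using km k by simp
        ultimately have "(2 * m) ^ (k - 2) + 1 \<le> (2 * m) ^ (k - 2) * 2" by linarith
        also have "\<dots> \<le> (2 * m) ^ (k - 2) * (2 * m)" using \<open>2 \<le> 2 * m\<close> by (intro mult_left_mono) auto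
        finally show ?thesis .
      qed
      also have "\<dots> = (2 * m) ^ (k - 1)" by (simp only: k123(2) power_Suc2)
      also have "\<dots> \<le> (m * m) ^ (k - 1)" using km k by (intro power_mono mult_right_mono) auto
      also have "\<dots> \<le> (m * m) ^ k" using km k by (intro power_increasing) auto
      also have "\<dots> = m ^ (2 * k)" by (simp add: power_mult power2_eq_square)
      finally show ?thesis using m(2) by linarith
    qed
    ultimately have no: "\<not> eh_arrow k k n (2 ^ N)" by (rule not_eh_arrow_mono)
    define L where "L = log 2 (real n)"
    define l where "l = log 2 (real m)"
    have m2: "2 \<le> m" "0 < m" using km k by auto
    have l: "4 * real k \<le> l"
    proof -
      have "real (2 ^ (4 * k)) \<le> real m" using m4k by (simp only: of_nat_le_iff)
      then have "log 2 (2 ^ (4 * k)) \<le> l" unfolding l_def by (intro log_mono) auto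
      then show ?thesis by (simp add: log_nat_power)
    qed
    have "m * 1 \<le> m ^ (2 * k)" using m2 k by (cases "2 * k") (auto intro: self_le_power)
    then have mn: "m \<le> n" using m(2) by simp
    have Ll: "L \<le> 4 * real k * l"
    proof -
      have "n \<le> (m * m) ^ (2 * k)"
      proof -
        have "m + 1 \<le> m * m" using m2 mult_le_mono1[of 2 m m] by linarith
        then have "(m + 1) ^ (2 * k) \<le> (m * m) ^ (2 * k)" by (rule power_mono) simp
        then show ?thesis using m(3) by linarith
      qed
      also have "\<dots> = m ^ (4 * k)" by (simp add: power_mult_distrib flip: power_add)
      finally have "real n \<le> real (m ^ (4 * k))" by (simp only: of_nat_le_iff)
      then have "L \<le> log 2 (real m ^ (4 * k))" unfolding L_def using mn m2 by (intro log_mono) auto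
      then show ?thesis using m2 by (simp add: log_nat_power l_def)
    qed
    have l1: "1 < l" "0 < l" using l k by auto
    have "l \<le> L" unfolding L_def l_def using mn m2 by (intro log_mono) auto
    then have L1: "1 < L" using l1 by simp
    have LL: "log 2 L \<le> 2 * log 2 l"
    proof -
      have "L \<le> l * l" using Ll l l1 by (meson mult_right_mono less_imp_le order_trans)
      then have "log 2 L \<le> log 2 (l * l)" using L1 by (intro log_mono) auto
      also have "\<dots> = 2 * log 2 l" using l1 by (simp add: log_mult)
      finally show ?thesis .
    qed
    have "L * log 2 L \<le> (4 * real k * l) * (2 * log 2 l)"
      using Ll LL L1 l1 k by (intro mult_mono) auto
    then have "c / (8 * real k) * (L * log 2 L) \<le> c / (8 * real k) * ((4 * real k * l) * (2 * log 2 l))"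
      using c by (intro mult_left_mono) auto
    also have "\<dots> = c * (l * log 2 l)" using k by simp
    finally have "real n powr (c / (8 * real k) * log 2 L) \<le> real m powr (c * log 2 l)"
      unfolding L_def l_def using m2 mn km k by (intro powr_log_log_le) auto
    moreover have "k - 1 - 2 = Suc (k - 4)" "k - 2 = Suc (Suc (k - 4))" using k by auto
    ultimately have "tower_bound k (c / (8 * real k)) n \<le> 2 powr tower_bound (k - 1) c m"
      unfolding tower_bound_def L_def l_def by (simp add: tw_mono)
    also have "\<dots> \<le> 2 powr real N" using N(2) by simp
    also have "\<dots> = real (2 ^ N)" by (simp add: powr_realpow)
    finally show ?thesis using no by blast
  qed
  then show ?thesis by (auto simp: eventually_sequentially)
qed

lemma lower_bound:
  assumes "4 \<le> k"
  shows "\<exists>c>0. \<forall>\<^sub>F n in sequentially. \<exists>N. \<not> eh_arrow k k n N \<and> tower_bound k c n \<le> real N"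
  using assms
proof (induction k rule: dec_induct)
  case base
  show ?case using lower_bound_4 by (intro exI[of _ "1 / 2 ^ 71"]) auto
next
  case (step k)
  then obtain c where c: "0 < c" "\<forall>\<^sub>F n in sequentially. \<exists>N. \<not> eh_arrow k k n N \<and> tower_bound k c n \<le> real N"
    by blast
  have "\<forall>\<^sub>F n in sequentially. \<exists>N. \<not> eh_arrow (Suc k) (Suc k) n N \<and> tower_bound (Suc k) (c / (8 * real (Suc k))) n \<le> real N"
    by (rule lower_bound_step) (use c step in auto)
  then show ?case using c(1) by (intro exI[of _ "c / (8 * real (Suc k))"]) auto
qed

theorem corollary3p5:
  fixes k :: nat
  assumes "k \<ge> 5"
  shows "\<exists>c::real. c > 0 \<and>
    (\<forall>\<^sub>F n in sequentially.
       real (erdos_hajnal k k n) > tw (k - 2) (real n powr (c * log 2 (log 2 (real n)))))"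
proof -
  obtain c where c: "0 < c"
    and ev: "\<forall>\<^sub>F n in sequentially. \<exists>N. \<not> eh_arrow k k n N \<and> tower_bound k c n \<le> real N"
    using lower_bound[of k] assms by auto
  from ev have "\<forall>\<^sub>F n in sequentially.
      real (erdos_hajnal k k n) > tw (k - 2) (real n powr (c * log 2 (log 2 (real n))))"
  proof eventually_elim
    case (elim n)
    then obtain N where "\<not> eh_arrow k k n N" "tower_bound k c n \<le> real N" by blast
    moreover from this have "real N < real (erdos_hajnal k k n)" by (simp add: less_erdos_hajnal)
    ultimately show ?case by (simp add: tower_bound_def)
  qed
  then show ?thesis using c by blast
qed

end
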